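(* For general $y=(0:y_1:y_2:y_3:0:-y_3:-y_2:-y_1)\in\mathbf{P}^2_-\subset\mathbf{P}^7$, the scheme $V_{8,y}\subset\mathbf{P}^7$ defined by the $\mathbf{H}'$-invariant quadrics vanishing on the $\mathbf{H}_8$-orbit of $y$ is a $(2,2,2,2)$-complete intersection, which is singular precisely at the $64$ points which form the $\mathbf{H}_8$-orbit of $y$, and each of these singular points is an ordinary double point.
   Context: The base field is $\mathbf{C}$. On $\mathbf{P}^7$ with coordinates $x_i$, $i\in\mathbf{Z}_8$, the Heisenberg group $\mathbf{H}_8$ is generated by $\sigma(x_i)=x_{i-1}$ and $\tau(x_i)=\xi^{-i}x_i$, $\xi=e^{2\pi i/8}$; $\mathbf{H}'=\langle\sigma^4,\tau^4\rangle$. $\mathbf{P}^2_-$ is the projectivized $(-1)$-eigenspace of $\iota(x_i)=x_{-i}$. Let $f_0=x_0^2+x_4^2$, $f_1=x_1x_7+x_3x_5$, $f_2=x_2x_6$. Then $H^0(\mathcal{O}_{\mathbf{P}^7}(2))^{\mathbf{H}'}=\bigoplus_{i=0}^2\langle f_i,\sigma f_i,\sigma^2f_i,\sigma^3f_i\rangle$, and the subspace of those quadrics vanishing on the $\mathbf{H}_8$-orbit of $y$ is spanned by $f,\sigma(f),\sigma^2(f),\sigma^3(f)$ with $f=y_1y_3f_0-y_2^2f_1+(y_1^2+y_3^2)f_2$. $V_{8,y}\subset\mathbf{P}^7$ is the scheme defined by these quadrics. *)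

theory Defs
  imports
    "HOL-Analysis.Analysis"
    "HOL-Library.Poly_Mapping"
    "HOL-Library.Numeral_Type"
    "HOL-Library.Extended_Nat"
    "HOL-Algebra.Bij"
    "HOL-Algebra.Generated_Groups"
begin

section \<open>Polynomials\<close>

text \<open>Polynomials over \<open>'a\<close> in the indeterminates \<open>'v\<close>: the monoid algebra of the monoid
  \<open>'v \<Rightarrow>\<^sub>0 nat\<close> of exponents.\<close>

type_synonym ('v, 'a) mpoly = "('v \<Rightarrow>\<^sub>0 nat) \<Rightarrow>\<^sub>0 'a"

definition mvar :: "'v \<Rightarrow> ('v, 'a::zero_neq_one) mpoly" where
  "mvar i = Poly_Mapping.single (Poly_Mapping.single i 1) 1"

text \<open>The value, in an algebra with structure map \<open>c\<close>, of \<open>p\<close> at the assignment \<open>s\<close>.\<close>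

definition poly_eval ::
    "('a::zero \<Rightarrow> 'b::comm_semiring_1) \<Rightarrow> ('v \<Rightarrow> 'b) \<Rightarrow> ('v, 'a) mpoly \<Rightarrow> 'b" where
  "poly_eval c s p =
     (\<Sum>m\<in>Poly_Mapping.keys p. c (Poly_Mapping.lookup p m) *
        (\<Prod>i\<in>Poly_Mapping.keys m. s i ^ Poly_Mapping.lookup m i))"

definition peval :: "('v, complex) mpoly \<Rightarrow> complex ^ 'v \<Rightarrow> complex" where
  "peval p x = poly_eval id (\<lambda>i. x $ i) p"

definition mdegree :: "('v \<Rightarrow>\<^sub>0 nat) \<Rightarrow> nat" where
  "mdegree m = (\<Sum>i\<in>Poly_Mapping.keys m. Poly_Mapping.lookup m i)"

definition homogeneous :: "nat \<Rightarrow> ('v, 'a::zero) mpoly \<Rightarrow> bool" where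
  "homogeneous d p \<longleftrightarrow> (\<forall>m\<in>Poly_Mapping.keys p. mdegree m = d)"

text \<open>The partial derivative. For \<open>i\<close> not occurring in \<open>m\<close> the summand is zero, because the factor
  \<open>lookup m i\<close> is.\<close>

definition pdiff :: "'v \<Rightarrow> ('v, complex) mpoly \<Rightarrow> ('v, complex) mpoly" where
  "pdiff i p =
     (\<Sum>m\<in>Poly_Mapping.keys p.
        Poly_Mapping.single (m - Poly_Mapping.single i 1)
          (of_nat (Poly_Mapping.lookup m i) * Poly_Mapping.lookup p m))"

section \<open>Ideals\<close>

text \<open>Ideals of a commutative ring are its submodules, the ring being a module over itself.\<close>

abbreviation is_ideal :: "'a::comm_ring_1 set \<Rightarrow> bool" where
  "is_ideal \<equiv> module.subspace (*)"

abbreviation ideal_gen :: "'a::comm_ring_1 set \<Rightarrow> 'a set" where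
  "ideal_gen \<equiv> module.span (*)"

definition prime_ideal :: "'a::comm_ring_1 set \<Rightarrow> bool" where
  "prime_ideal P \<longleftrightarrow> is_ideal P \<and> 1 \<notin> P \<and> (\<forall>a b. a * b \<in> P \<longrightarrow> a \<in> P \<or> b \<in> P)"

definition homogeneous_ideal :: "('v, complex) mpoly set \<Rightarrow> bool" where
  "homogeneous_ideal I \<longleftrightarrow> I = ideal_gen {q \<in> I. \<exists>d. homogeneous d q}"

section \<open>Projective space and its closed subschemes\<close>

text \<open>A (closed) point of projective space is a punctured line through the origin. For a linear
  subspace \<open>W\<close>, \<open>proj_space W\<close> is its projectivization.\<close>

definition proj_pt :: "complex ^ 'v \<Rightarrow> (complex ^ 'v) set" where
  "proj_pt x = {c *s x | c. c \<noteq> 0}"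

definition proj_space :: "(complex ^ 'v) set \<Rightarrow> (complex ^ 'v) set set" where
  "proj_space W = proj_pt ` (W - {0})"

definition vanishes_at :: "('v, complex) mpoly \<Rightarrow> (complex ^ 'v) set \<Rightarrow> bool" where
  "vanishes_at q z \<longleftrightarrow> (\<forall>x\<in>z. peval q x = 0)"

definition proj_zeros :: "('v, complex) mpoly set \<Rightarrow> (complex ^ 'v) set set" where
  "proj_zeros S = {z \<in> proj_space UNIV. \<forall>q\<in>S. vanishes_at q z}"

text \<open>\<open>P\<close> holds at the general point of the projectivization of \<open>W\<close>: at every point of some
  nonempty Zariski-open subset.\<close>

definition for_general :: "(complex ^ 'v) set \<Rightarrow> ((complex ^ 'v) set \<Rightarrow> bool) \<Rightarrow> bool" where
  "for_general W P \<longleftrightarrow>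
     (\<exists>S. (\<forall>q\<in>S. \<exists>d. homogeneous d q) \<and>
          proj_space W - proj_zeros S \<noteq> {} \<and>
          (\<forall>z \<in> proj_space W - proj_zeros S. P z))"

text \<open>A closed subscheme of projective space is given by a homogeneous ideal \<open>I\<close> of the polynomial
  ring \<open>S\<close>. The points of the scheme \<open>Proj (S/I)\<close> are the homogeneous primes containing \<open>I\<close> that do
  not contain the irrelevant ideal.\<close>

definition Proj :: "('v, complex) mpoly set \<Rightarrow> ('v, complex) mpoly set set" where
  "Proj I = {P. prime_ideal P \<and> homogeneous_ideal P \<and> I \<subseteq> P \<and> \<not> range mvar \<subseteq> P}"

text \<open>A chain of irreducible closed subsets of \<open>Proj (S/I)\<close>, given by their generic points (so
  inclusions of subsets are reversed).\<close>

definition proj_chain ::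
    "('v, complex) mpoly set \<Rightarrow> nat \<Rightarrow> (nat \<Rightarrow> ('v, complex) mpoly set) \<Rightarrow> bool" where
  "proj_chain I n P \<longleftrightarrow> (\<forall>i\<le>n. P i \<in> Proj I) \<and> (\<forall>i<n. P i \<subset> P (Suc i))"

text \<open>Krull dimension. (The empty scheme gets dimension \<open>0\<close>, the supremum of the empty set.)\<close>

definition proj_dim :: "('v, complex) mpoly set \<Rightarrow> enat" where
  "proj_dim I = (SUP n\<in>{n. \<exists>P. proj_chain I n P}. enat n)"

text \<open>Krull dimension of the local ring at the closed point \<open>z\<close>. Its primes are the points of
  \<open>Proj (S/I)\<close> specializing to \<open>z\<close>.\<close>

definition local_dim :: "('v, complex) mpoly set \<Rightarrow> (complex ^ 'v) set \<Rightarrow> enat" where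
  "local_dim I z =
     (SUP n\<in>{n. \<exists>P. proj_chain I n P \<and> (\<forall>q\<in>P n. vanishes_at q z)}. enat n)"

text \<open>Complete intersection of multidegree \<open>ds\<close>: cut out by \<open>length ds\<close> forms of the degrees listed in
  \<open>ds\<close>, and of codimension \<open>length ds\<close> in projective space of dimension \<open>CARD('v) - 1\<close>.\<close>

definition complete_intersection :: "nat list \<Rightarrow> ('v::finite, complex) mpoly set \<Rightarrow> bool" where
  "complete_intersection ds I \<longleftrightarrow>
     (\<exists>Fs. list_all2 homogeneous ds Fs \<and> I = ideal_gen (set Fs)) \<and>
     proj_dim I + enat (length ds) + 1 = enat CARD('v)"

text \<open>The Zariski tangent space at \<open>z\<close> of the affine cone over the scheme; the Zariski tangent space of
  the scheme itself at \<open>z\<close> is its quotient by the line of \<open>z\<close>.\<close>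

definition cone_tangent_space ::
    "('v::finite, complex) mpoly set \<Rightarrow> (complex ^ 'v) set \<Rightarrow> (complex ^ 'v) set" where
  "cone_tangent_space I z =
     {v. \<forall>q\<in>I. \<forall>x\<in>z. (\<Sum>i\<in>UNIV. peval (pdiff i q) x * v $ i) = 0}"

text \<open>A closed point is singular if the local ring is not regular, that is, if its Krull dimension is
  smaller than the dimension of the Zariski tangent space. The summand \<open>1\<close> accounts for the passage to
  the cone.\<close>

definition singular_points :: "('v::finite, complex) mpoly set \<Rightarrow> (complex ^ 'v) set set" where
  "singular_points I =
     {z \<in> proj_zeros I. local_dim I z + 1 < enat (vec.dim (cone_tangent_space I z))}"

section \<open>Formal power series in several indeterminates\<close>

typedef 'v mps = "UNIV :: (('v \<Rightarrow>\<^sub>0 nat) \<Rightarrow> complex) set"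
  morphisms mps_coeff Abs_mps ..

setup_lifting type_definition_mps

definition splits :: "('v \<Rightarrow>\<^sub>0 nat) \<Rightarrow> (('v \<Rightarrow>\<^sub>0 nat) \<times> ('v \<Rightarrow>\<^sub>0 nat)) set" where
  "splits m = {(a, b). a + b = m}"

lemma finite_splits [simp]: "finite (splits (m :: 'v::finite \<Rightarrow>\<^sub>0 nat))"
proof -
  let ?A = "{a :: 'v \<Rightarrow>\<^sub>0 nat. \<forall>i. Poly_Mapping.lookup a i \<le> Poly_Mapping.lookup m i}"
  have "Poly_Mapping.lookup ` ?A \<subseteq> (\<Pi>\<^sub>E i\<in>UNIV. {..Poly_Mapping.lookup m i})"
    by auto
  then have "finite (Poly_Mapping.lookup ` ?A)"
    by (rule finite_subset) (simp add: finite_PiE)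
  moreover have "inj_on Poly_Mapping.lookup ?A"
    by (rule inj_onI) simp
  ultimately have "finite ?A"
    by (rule finite_imageD)
  moreover have "splits m \<subseteq> ?A \<times> ?A"
    by (auto simp: splits_def lookup_add)
  ultimately show ?thesis
    by (meson finite_SigmaI finite_subset)
qed

lemma sum_splits_commute:
  fixes f g :: "('v::finite \<Rightarrow>\<^sub>0 nat) \<Rightarrow> complex"
  shows "(\<Sum>(a, b)\<in>splits m. f a * g b) = (\<Sum>(a, b)\<in>splits m. g a * f b)"
  by (rule sum.reindex_bij_witness[of _ prod.swap prod.swap])
    (auto simp: splits_def add.commute mult.commute)

lemma sum_splits_one:
  fixes f :: "('v::finite \<Rightarrow>\<^sub>0 nat) \<Rightarrow> complex"
  shows "(\<Sum>(a, b)\<in>splits m. (if a = 0 then 1 else 0) * f b) = f m"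
proof -
  have "(\<Sum>p\<in>splits m. (if fst p = 0 then 1 else 0) * f (snd p)) =
      (\<Sum>p\<in>{(0 :: 'v \<Rightarrow>\<^sub>0 nat, m)}. (if fst p = 0 then 1 else 0) * f (snd p))"
    by (rule sum.mono_neutral_right, simp) (auto simp: splits_def)
  then show ?thesis
    by (simp add: case_prod_unfold)
qed

lemma sum_splits_assoc:
  fixes f g h :: "('v::finite \<Rightarrow>\<^sub>0 nat) \<Rightarrow> complex"
  shows "(\<Sum>(a, b)\<in>splits m. (\<Sum>(c, d)\<in>splits a. f c * g d) * h b) =
      (\<Sum>(a, b)\<in>splits m. f a * (\<Sum>(c, d)\<in>splits b. g c * h d))"
proof -
  have "(\<Sum>(a, b)\<in>splits m. (\<Sum>(c, d)\<in>splits a. f c * g d) * h b) =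
      (\<Sum>p\<in>splits m. \<Sum>r\<in>splits (fst p). f (fst r) * g (snd r) * h (snd p))"
    by (simp only: case_prod_unfold sum_distrib_right)
  also have "\<dots> = (\<Sum>(p, r)\<in>Sigma (splits m) (\<lambda>p. splits (fst p)).
      f (fst r) * g (snd r) * h (snd p))"
    by (rule sum.Sigma) simp_all
  also have "\<dots> = (\<Sum>(p, r)\<in>Sigma (splits m) (\<lambda>p. splits (snd p)).
      f (fst p) * (g (fst r) * h (snd r)))"
    by (rule sum.reindex_bij_witness
          [of _ "\<lambda>((a, b), (c, d)). ((a + c, d), (a, c))" "\<lambda>((a, b), (c, d)). ((c, d + b), (d, b))"])
      (auto simp: splits_def add.assoc mult.assoc)
  also have "\<dots> = (\<Sum>p\<in>splits m. \<Sum>r\<in>splits (snd p). f (fst p) * (g (fst r) * h (snd r)))"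
    by (rule sum.Sigma[symmetric]) simp_all
  also have "\<dots> = (\<Sum>(a, b)\<in>splits m. f a * (\<Sum>(c, d)\<in>splits b. g c * h d))"
    by (simp only: case_prod_unfold sum_distrib_left)
  finally show ?thesis .
qed

instantiation mps :: (finite) comm_ring_1
begin

lift_definition zero_mps :: "'a mps" is "\<lambda>m. 0" .
lift_definition one_mps :: "'a mps" is "\<lambda>m. if m = 0 then 1 else 0" .
lift_definition plus_mps :: "'a mps \<Rightarrow> 'a mps \<Rightarrow> 'a mps" is "\<lambda>f g m. f m + g m" .
lift_definition minus_mps :: "'a mps \<Rightarrow> 'a mps \<Rightarrow> 'a mps" is "\<lambda>f g m. f m - g m" .
lift_definition uminus_mps :: "'a mps \<Rightarrow> 'a mps" is "\<lambda>f m. - f m" .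
lift_definition times_mps :: "'a mps \<Rightarrow> 'a mps \<Rightarrow> 'a mps" is
  "\<lambda>f g m. \<Sum>(a, b)\<in>splits m. f a * g b" .

instance
proof
  fix f g h :: "'a mps"
  show "f + g + h = f + (g + h)" by transfer (simp add: add.assoc)
  show "f + g = g + f" by transfer (simp add: add.commute)
  show "0 + f = f" by transfer simp
  show "- f + f = 0" by transfer simp
  show "f - g = f + - g" by transfer simp
  show "(0::'a mps) \<noteq> 1" by transfer (metis zero_neq_one)
  show "(f + g) * h = f * h + g * h"
    by transfer (simp add: distrib_right case_prod_unfold sum.distrib)
  show "f * g = g * f" by transfer (rule ext, rule sum_splits_commute)
  show "1 * f = f" by transfer (rule ext, rule sum_splits_one)
  show "f * g * h = f * (g * h)" by transfer (rule ext, rule sum_splits_assoc)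
qed

end

lift_definition mps_const :: "complex \<Rightarrow> 'v mps" is "\<lambda>c m. if m = 0 then c else 0" .

lift_definition mps_var :: "'v \<Rightarrow> 'v mps" is
  "\<lambda>i m. if m = Poly_Mapping.single i 1 then 1 else 0" .

section \<open>Ordinary double points\<close>

text \<open>The Taylor expansion \<open>q(x + u)\<close> of \<open>q\<close> at \<open>x\<close>.\<close>

definition taylor :: "complex ^ 'v \<Rightarrow> ('v::finite, complex) mpoly \<Rightarrow> 'v mps" where
  "taylor x q = poly_eval mps_const (\<lambda>i. mps_const (x $ i) + mps_var i) q"

text \<open>For \<open>x $ k \<noteq> 0\<close>, the hyperplane \<open>u\<^sub>k = 0\<close> through \<open>x\<close> is an affine chart of projective space around
  the point of \<open>x\<close>. So the power series ring modulo this ideal is the completed local ring at that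
  point of the scheme defined by \<open>I\<close>.\<close>

definition formal_ideal :: "('v::finite, complex) mpoly set \<Rightarrow> complex ^ 'v \<Rightarrow> 'v \<Rightarrow> 'v mps set" where
  "formal_ideal I x k = ideal_gen (insert (mps_var k) (taylor x ` I))"

text \<open>Formal coordinates at the origin: no constant terms and invertible Jacobian matrix.\<close>

definition formal_coordinates :: "('v::finite \<Rightarrow> 'v mps) \<Rightarrow> bool" where
  "formal_coordinates \<phi> \<longleftrightarrow>
     (\<forall>i. mps_coeff (\<phi> i) 0 = 0) \<and>
     invertible (\<chi> i j. mps_coeff (\<phi> i) (Poly_Mapping.single j 1))"

text \<open>An ordinary double point of dimension \<open>n\<close>: in suitable formal coordinates of the ambient space, the
  scheme is the hypersurface \<open>t\<^sub>0\<^sup>2 + \<dots> + t\<^sub>n\<^sup>2 = 0\<close> in a coordinate subspace of dimension \<open>n + 1\<close>. Here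
  \<open>A\<close> indexes the coordinates of this subspace; the other coordinates vanish on it.\<close>

definition ordinary_double_point :: "('v::finite, complex) mpoly set \<Rightarrow> (complex ^ 'v) set \<Rightarrow> bool" where
  "ordinary_double_point I z \<longleftrightarrow>
     z \<in> proj_zeros I \<and>
     (\<exists>x\<in>z. \<exists>k. x $ k \<noteq> 0 \<and>
       (\<exists>\<phi> A. formal_coordinates \<phi> \<and> enat (card A) = local_dim I z + 1 \<and>
          formal_ideal I x k = ideal_gen (insert (\<Sum>i\<in>A. (\<phi> i)\<^sup>2) (\<phi> ` (- A)))))"

section \<open>The Heisenberg group and the schemes \<open>V\<^bsub>8,y\<^esub>\<close>\<close>

text \<open>The indices are taken in the type \<open>8\<close>, whose arithmetic is modulo \<open>8\<close>. \<open>Rep_bit0 i\<close> is the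
  representative of \<open>i\<close> in \<open>{0..<8}\<close>. The transformations act on vectors; on the coordinate
  functions, composition with them yields \<open>x\<^sub>i \<mapsto> x\<^sub>i\<^sub>-\<^sub>1\<close>, \<open>x\<^sub>i \<mapsto> \<xi>\<^sup>-\<^sup>i x\<^sub>i\<close>, and \<open>x\<^sub>i \<mapsto> x\<^sub>-\<^sub>i\<close>.\<close>

definition xi :: complex where
  "xi = exp (2 * of_real pi * \<i> / 8)"

definition sigma :: "complex ^ 8 \<Rightarrow> complex ^ 8" where
  "sigma x = (\<chi> i. x $ (i - 1))"

definition tau :: "complex ^ 8 \<Rightarrow> complex ^ 8" where
  "tau x = (\<chi> i. xi powi (- Rep_bit0 i) * x $ i)"

definition iota :: "complex ^ 8 \<Rightarrow> complex ^ 8" where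
  "iota x = (\<chi> i. x $ (- i))"

definition H8 :: "(complex ^ 8 \<Rightarrow> complex ^ 8) set" where
  "H8 = generate (BijGroup UNIV) {sigma, tau}"

definition H' :: "(complex ^ 8 \<Rightarrow> complex ^ 8) set" where
  "H' = generate (BijGroup UNIV) {sigma ^^ 4, tau ^^ 4}"

definition H8_orbit :: "(complex ^ 8) set \<Rightarrow> (complex ^ 8) set set" where
  "H8_orbit y = (\<lambda>h. h ` y) ` H8"

text \<open>The vectors \<open>(0, y\<^sub>1, y\<^sub>2, y\<^sub>3, 0, -y\<^sub>3, -y\<^sub>2, -y\<^sub>1)\<close>.\<close>

definition iota_minus :: "(complex ^ 8) set" where
  "iota_minus = {x. iota x = - x}"

definition H'_invariant :: "(8, complex) mpoly \<Rightarrow> bool" where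
  "H'_invariant q \<longleftrightarrow> (\<forall>h\<in>H'. \<forall>x. peval q (h x) = peval q x)"

text \<open>A point \<open>y\<close> is a punctured line, so \<open>h ` y\<close> is its image under the projective transformation
  induced by \<open>h\<close>. \<open>V8 y\<close> is the homogeneous ideal defining the scheme \<open>V\<^bsub>8,y\<^esub>\<close>.\<close>

definition V8_quadrics :: "(complex ^ 8) set \<Rightarrow> (8, complex) mpoly set" where
  "V8_quadrics y =
     {q. homogeneous 2 q \<and> H'_invariant q \<and> (\<forall>z\<in>H8_orbit y. vanishes_at q z)}"

definition V8 :: "(complex ^ 8) set \<Rightarrow> (8, complex) mpoly set" where
  "V8 y = ideal_gen (V8_quadrics y)"

end

theory Submission
  imports Defs "HOL-Computational_Algebra.Polynomial"
begin

text \<open>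
  If \<open>y\<^sub>1 y\<^sub>3 \<noteq> 0\<close>, the four quadrics have the leading monomials \<open>x\<^sub>4\<^sup>2\<close>, \<open>x\<^sub>5\<^sup>2\<close>, \<open>x\<^sub>6\<^sup>2\<close>, \<open>x\<^sub>7\<^sup>2\<close> for a suitable
  weight, so they form a Groebner basis and the coordinate ring is free over the polynomial ring in
  \<open>x\<^sub>0\<close>, \<dots>, \<open>x\<^sub>3\<close>. Comparing dimensions of graded pieces with the algebraic independence that a chain
  of primes provides, chains are bounded by \<open>3\<close>; regularity of sequences of linear forms in
  \<open>x\<^sub>0\<close>, \<dots>, \<open>x\<^sub>3\<close> gives chains of length \<open>3\<close> through every closed point.

  In the coordinates \<open>u\<^sub>j = x\<^sub>j + x\<^sub>j\<^sub>+\<^sub>4\<close>, \<open>v\<^sub>j = x\<^sub>j - x\<^sub>j\<^sub>+\<^sub>4\<close>, every quadric of the linear system splits into binary forms in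
  \<open>(u\<^sub>0, u\<^sub>2)\<close>, \<open>(v\<^sub>0, v\<^sub>2)\<close>, \<open>(u\<^sub>1, u\<^sub>3)\<close>, \<open>(v\<^sub>1, v\<^sub>3)\<close>. A singular point lies in the kernel of some quadric, and
  its four blocks lie in the kernels of the binary forms. For general \<open>y\<close> the four discriminants have no
  common zero, so one block of a singular point vanishes; at most one does, by the equations of the
  scheme. The Heisenberg group permutes the blocks, and the points with a vanishing first block can be
  solved for explicitly. The quadric that is singular at \<open>y\<close> induces a nondegenerate quadratic form
  on the Zariski tangent space at \<open>y\<close>, which makes \<open>y\<close> an ordinary double point.
\<close>

section \<open>Polynomials\<close>

text \<open>All dimensions are suprema over chains of homogeneous primes. Long chains come from one
  fact: if a form is not a zero divisor modulo a homogeneous ideal, then below any prime over that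
  ideal there is a homogeneous prime over it that omits the form. The generality condition becomes
  readable in \<open>al = (y1 + y3)^2\<close>, \<open>be = -(y1 - y3)^2\<close>,
  \<open>ga = 2 y2^2\<close>. These are \<open>2 p + s\<close>, \<open>2 p - s\<close>,
  \<open>2 q\<close> for the coefficients in \<open>f = p f0 - q f1 + s f2\<close>, and they are
  what the coordinates \<open>u\<close>, \<open>v\<close> produce. Vanishing of the four
  discriminants is a linear system in the squares of suitable coefficients of the quadric; iterating
  it gives \<open>al^4 - be^4\<close> on one side and \<open>ga^4\<close> on the other. The same
  number \<open>al^4 - be^4 - ga^4\<close> is, up to nonzero factors, the determinant of each half
  of the quadratic form at the double point, so one inequality governs both the position of the
  singularities and their nondegeneracy. The other inequalities keep two blocks from vanishing
  together and make single pivots invertible.\<close>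

abbreviation "lookup \<equiv> Poly_Mapping.lookup"
abbreviation "keys \<equiv> Poly_Mapping.keys"
abbreviation "single \<equiv> Poly_Mapping.single"

interpretation ideal: module "(*) :: 'a::comm_ring_1 \<Rightarrow> 'a \<Rightarrow> 'a"
  by standard (simp_all add: algebra_simps)

text \<open>As a simplification rule, it would undo \<open>mult.assoc\<close>.\<close>

declare ideal.scale_scale [simp del]

lemma is_ideal_iff:
  "is_ideal I \<longleftrightarrow> 0 \<in> I \<and> (\<forall>a\<in>I. \<forall>b\<in>I. a + b \<in> I) \<and> (\<forall>c. \<forall>a\<in>I. c * a \<in> I)"
  unfolding ideal.subspace_def by blast

section \<open>Monomials and evaluation homomorphisms\<close>

definition mval :: "('v::finite \<Rightarrow> 'b::comm_semiring_1) \<Rightarrow> ('v \<Rightarrow>\<^sub>0 nat) \<Rightarrow> 'b" where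
  "mval s m = (\<Prod>i\<in>UNIV. s i ^ lookup m i)"

lemma mval_add: "mval s (a + b) = mval s a * mval s b"
  by (simp add: mval_def lookup_add power_add prod.distrib)

lemma mval_0 [simp]: "mval s 0 = 1"
  by (simp add: mval_def)

lemma mval_single [simp]: "mval s (single i k) = s i ^ k"
proof -
  have "mval s (single i k) = (\<Prod>j\<in>{i}. s j ^ lookup (single i k) j)"
    unfolding mval_def by (rule prod.mono_neutral_right) (auto simp: lookup_single when_def)
  then show ?thesis by simp
qed

lemma poly_eval_mval:
  "poly_eval c s p = (\<Sum>m\<in>keys p. c (lookup p m) * mval s m)"
proof -
  have "(\<Prod>i\<in>keys m. s i ^ lookup m i) = mval s m" for m
    unfolding mval_def by (rule prod.mono_neutral_left) (auto simp: in_keys_iff)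
  then show ?thesis by (simp add: poly_eval_def)
qed

lemma mpoly_sum_single: "p = (\<Sum>m\<in>keys p. single m (lookup p m))"
proof (rule poly_mapping_eqI)
  fix k
  have "(\<Sum>m\<in>keys p. lookup (single m (lookup p m)) k)
     = (\<Sum>m\<in>keys p. if m = k then lookup p k else 0)"
    by (rule sum.cong) (auto simp: lookup_single)
  also have "\<dots> = lookup p k"
    by (simp add: in_keys_iff)
  finally show "lookup p k
     = lookup (\<Sum>m\<in>keys p. single m (lookup p m)) k"
    by (simp add: lookup_sum)
qed

lemma mpoly_induct [case_names zero add]:
  assumes z: "P 0" and a: "\<And>p m a. P p \<Longrightarrow> P (p + single m a)"
  shows "P (p :: 'k \<Rightarrow>\<^sub>0 'b::comm_monoid_add)"
proof -
  have "P (\<Sum>m\<in>K. single m (f m))" if "finite K" for f and K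
    using that by induction (use a in \<open>auto simp: z add.commute [of "single _ _"]\<close>)
  then show ?thesis by (subst mpoly_sum_single) simp
qed

definition cst :: "'a::zero \<Rightarrow> ('v, 'a) mpoly" where
  "cst a = single 0 a"

lemma cst_mult_single: "cst a * single m b = single m (a * b)"
  for a :: "'a::comm_semiring_1"
  by (simp add: cst_def mult_single)

lemma mvar_power: "mvar i ^ k = (single (single i k) 1 :: ('v, 'a::comm_semiring_1) mpoly)"
  by (induction k) (simp_all add: mvar_def mult_single single_add [symmetric])

lemma mval_mvar: "mval mvar m = (single m 1 :: ('v::finite, 'a::comm_semiring_1) mpoly)"
proof -
  have *: "(\<Prod>i\<in>K. single (t i) 1) = (single (\<Sum>i\<in>K. t i) 1 :: ('v, 'a) mpoly)"
    if "finite K" for K and t :: "'v \<Rightarrow> _"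
    using that by induction (simp_all add: mult_single)
  have "(\<Sum>i\<in>UNIV. single i (lookup m i)) = m"
    by (rule poly_mapping_eqI)
      (simp add: lookup_sum lookup_single when_def)
  then show ?thesis
    by (simp add: mval_def mvar_power *)
qed

text \<open>The structure map is a parameter because four evaluations share these rules: values
  (\<open>id\<close>), substitution of polynomials (\<open>cst\<close>), Taylor expansion
  (\<open>mps_const\<close>) and homogenization (\<open>[:cst a:]\<close>).\<close>

locale eval_hom =
  fixes c :: "'a::comm_semiring_1 \<Rightarrow> 'b::comm_semiring_1"
  assumes c0 [simp]: "c 0 = 0" and c1 [simp]: "c 1 = 1"
    and cadd: "c (a + b) = c a + c b" and cmult: "c (a * b) = c a * c b"
begin

lemma eval_superset:
  fixes s :: "'v::finite \<Rightarrow> 'b"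
  assumes "finite K" "keys p \<subseteq> K"
  shows "poly_eval c s p = (\<Sum>m\<in>K. c (lookup p m) * mval s m)"
  unfolding poly_eval_mval using assms
  by (intro sum.mono_neutral_left) (auto simp: in_keys_iff)

lemma eval_0 [simp]: "poly_eval c (s :: 'v::finite \<Rightarrow> 'b) 0 = 0"
  by (simp add: poly_eval_mval)

lemma eval_add: "poly_eval c (s :: 'v::finite \<Rightarrow> 'b) (p + q) = poly_eval c s p + poly_eval c s q"
  using keys_add [of p q]
  by (simp add: eval_superset [of "keys p \<union> keys q"]
      lookup_add cadd distrib_right sum.distrib)

lemma eval_sum: "poly_eval c (s :: 'v::finite \<Rightarrow> 'b) (sum f K) = (\<Sum>k\<in>K. poly_eval c s (f k))"
  by (induction K rule: infinite_finite_induct) (simp_all add: eval_add)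

lemma eval_single: "poly_eval c (s :: 'v::finite \<Rightarrow> 'b) (single m a) = c a * mval s m"
  by (subst eval_superset [of "{m}"]) auto

lemma eval_mult: "poly_eval c (s :: 'v::finite \<Rightarrow> 'b) (p * q) = poly_eval c s p * poly_eval c s q"
proof (induction p rule: mpoly_induct)
  case (add p m a)
  have "poly_eval c s (single m a * q) = poly_eval c s (single m a) * poly_eval c s q"
    by (induction q rule: mpoly_induct)
      (simp_all add: distrib_left eval_add mult_single eval_single cmult mval_add mult_ac)
  with add show ?case by (simp add: distrib_right eval_add)
qed simp

lemma eval_cst: "poly_eval c (s :: 'v::finite \<Rightarrow> 'b) (cst a) = c a"
  by (simp add: cst_def eval_single)

lemma eval_1 [simp]: "poly_eval c (s :: 'v::finite \<Rightarrow> 'b) 1 = 1"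
  using eval_cst [of s 1] by (simp add: cst_def)

lemma eval_mvar: "poly_eval c (s :: 'v::finite \<Rightarrow> 'b) (mvar i) = s i"
  by (simp add: mvar_def eval_single)

lemma eval_power: "poly_eval c (s :: 'v::finite \<Rightarrow> 'b) (p ^ k) = poly_eval c s p ^ k"
  by (induction k) (simp_all add: eval_mult)

lemmas eval_simps = eval_add eval_mult eval_cst eval_mvar eval_power eval_sum

end

locale eval_ring_hom = eval_hom c for c :: "'a::comm_ring_1 \<Rightarrow> 'b::comm_ring_1"
begin

lemma eval_uminus: "poly_eval c (s :: 'v::finite \<Rightarrow> 'b) (- p) = - poly_eval c s p"
  using eval_add [of s p "- p"] by (simp add: eq_neg_iff_add_eq_0 add.commute)

lemma eval_diff: "poly_eval c (s :: 'v::finite \<Rightarrow> 'b) (p - q) = poly_eval c s p - poly_eval c s q"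
  using eval_add [of s p "- q"] by (simp add: eval_uminus)

lemma eval_ideal_gen:
  assumes "p \<in> ideal_gen G" and "is_ideal J" and "\<And>g. g \<in> G \<Longrightarrow> poly_eval c (s :: 'v::finite \<Rightarrow> 'b) g \<in> J"
  shows "poly_eval c s p \<in> J"
  using assms(1)
  by (induction rule: ideal.span_induct_alt)
    (use assms(2,3) in \<open>auto simp: eval_add eval_mult is_ideal_iff\<close>)

end

interpretation eid: eval_ring_hom "id :: 'a::comm_ring_1 \<Rightarrow> 'a"
  by standard simp_all

interpretation ecst: eval_ring_hom "cst :: 'a::comm_ring_1 \<Rightarrow> ('v, 'a) mpoly"
  by standard (simp_all add: cst_def single_add mult_single)

interpretation emps: eval_ring_hom "mps_const :: complex \<Rightarrow> 'v::finite mps"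
proof
  show "mps_const 0 = (0 :: 'v mps)" "mps_const 1 = (1 :: 'v mps)"
    by (transfer, auto)+
  show "mps_const (a + b) = (mps_const a + mps_const b :: 'v mps)" for a b
    by transfer auto
  show "mps_const (a * b) = (mps_const a * mps_const b :: 'v mps)" for a b
  proof transfer
    fix a b :: complex
    show "(\<lambda>m :: 'v \<Rightarrow>\<^sub>0 nat. if m = 0 then a * b else 0) = (\<lambda>m. \<Sum>(k, l)\<in>splits m.
         (if k = 0 then a else 0) * (if l = 0 then b else 0))"
    proof
      fix m :: "'v \<Rightarrow>\<^sub>0 nat"
      have "(\<Sum>(k, l)\<in>splits m. (if k = 0 then a else 0) * (if l = 0 then b else 0))
        = a * (\<Sum>(k, l)\<in>splits m. (if k = 0 then 1 else 0) * (if l = 0 then b else 0))"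
        by (auto simp: sum_distrib_left intro!: sum.cong)
      also have "\<dots> = a * (if m = 0 then b else 0)"
        by (subst sum_splits_one) simp
      finally show "(if m = 0 then a * b else 0) = (\<Sum>(k, l)\<in>splits m.
         (if k = 0 then a else 0) * (if l = 0 then b else 0))" by simp
    qed
  qed
qed

lemma poly_eval_cst_mvar: "poly_eval cst mvar p = (p :: ('v::finite, 'a::comm_ring_1) mpoly)"
  by (induction p rule: mpoly_induct)
    (simp_all add: ecst.eval_add ecst.eval_single mval_mvar cst_mult_single)

lemma peval_simps [simp]:
  "peval 0 (x :: complex ^ 'v::finite) = 0"
  "peval 1 x = 1"
  "peval (p + q) x = peval p x + peval q x"
  "peval (p - q) x = peval p x - peval q x"
  "peval (- p) x = - peval p x"
  "peval (p * q) x = peval p x * peval q x"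
  "peval (p ^ k) x = peval p x ^ k"
  "peval (cst a) x = a"
  "peval (mvar i) x = x $ i"
  by (simp_all add: peval_def eid.eval_simps eid.eval_diff eid.eval_uminus)

lemma peval_sum: "peval (sum f K) (x :: complex ^ 'v::finite) = (\<Sum>k\<in>K. peval (f k) x)"
  by (simp add: peval_def eid.eval_sum)

lemma peval_single: "peval (single m a) (x :: complex ^ 'v::finite) = a * mval (\<lambda>i. x $ i) m"
  by (simp add: peval_def eid.eval_single)

lemma peval_ideal_gen_zero:
  assumes "p \<in> ideal_gen G" and "\<And>g. g \<in> G \<Longrightarrow> peval g (x :: complex ^ 'v::finite) = 0"
  shows "peval p x = 0"
  using eid.eval_ideal_gen [of p G "{0}" "\<lambda>i. x $ i"] assms
  by (auto simp: peval_def is_ideal_iff)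

section \<open>Total degree and homogeneous polynomials\<close>

lemma mdegree_UNIV: "mdegree m = (\<Sum>i\<in>UNIV. lookup (m :: 'v::finite \<Rightarrow>\<^sub>0 nat) i)"
  unfolding mdegree_def by (rule sum.mono_neutral_left) (auto simp: in_keys_iff)

lemma mdegree_add: "mdegree (m + n) = mdegree m + mdegree (n :: 'v::finite \<Rightarrow>\<^sub>0 nat)"
  by (simp add: mdegree_UNIV lookup_add sum.distrib)

lemma mdegree_0 [simp]: "mdegree 0 = 0"
  by (simp add: mdegree_def)

lemma mdegree_single [simp]: "mdegree (single i k) = k"
  by (simp add: mdegree_def)

lemma mdegree_eq_0_iff: "mdegree m = 0 \<longleftrightarrow> m = (0 :: 'v::finite \<Rightarrow>\<^sub>0 nat)"
  by (auto simp: mdegree_UNIV intro: poly_mapping_eqI)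

lemma homogeneous_0 [simp]: "homogeneous d 0"
  by (simp add: homogeneous_def)

lemma homogeneous_add: "homogeneous d p \<Longrightarrow> homogeneous d q \<Longrightarrow> homogeneous d (p + q)"
  using keys_add [of p q] by (auto simp: homogeneous_def)

lemma homogeneous_uminus: "homogeneous d p \<Longrightarrow> homogeneous d (- p)" for p :: "('v, 'a::ab_group_add) mpoly"
  by (auto simp: homogeneous_def in_keys_iff)

lemma homogeneous_diff: "homogeneous d p \<Longrightarrow> homogeneous d q \<Longrightarrow> homogeneous d (p - q)"
  for p q :: "('v, 'a::ab_group_add) mpoly"
  using homogeneous_add [of d p "- q"] homogeneous_uminus [of d q] by simp

lemma homogeneous_mult:
  "homogeneous d p \<Longrightarrow> homogeneous e q \<Longrightarrow> homogeneous (d + e) (p * q)"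
  for p q :: "('v::finite, 'a::comm_semiring_1) mpoly"
  using keys_mult [of p q] by (fastforce simp: homogeneous_def mdegree_add)

lemma homogeneous_single: "homogeneous (mdegree m) (single m a)"
  by (simp add: homogeneous_def)

lemma homogeneous_cst: "homogeneous 0 (cst a)"
  by (simp add: homogeneous_def cst_def)

lemma homogeneous_mvar: "homogeneous 1 (mvar i :: ('v, 'a::zero_neq_one) mpoly)"
  by (simp add: homogeneous_def mvar_def)

lemma homogeneous_power: "homogeneous d p \<Longrightarrow> homogeneous (k * d) (p ^ k)"
  for p :: "('v::finite, 'a::comm_semiring_1) mpoly"
proof (induction k)
  case 0
  show ?case using homogeneous_cst [of "1 :: 'a"] by (simp add: cst_def)
qed (simp add: homogeneous_mult)

lemma homogeneous_cst_mult: "homogeneous d p \<Longrightarrow> homogeneous d (cst a * p)"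
  for p :: "('v::finite, 'a::comm_semiring_1) mpoly"
  using homogeneous_mult [OF homogeneous_cst] by fastforce

lemma homogeneous_mvar_mult: "homogeneous 2 (mvar i * mvar j :: ('v::finite, 'a::comm_semiring_1) mpoly)"
  using homogeneous_mult [OF homogeneous_mvar homogeneous_mvar] by (metis one_add_one)

lemma mval_smult: "mval (\<lambda>i. c * s i) m = c ^ mdegree m * mval s m"
  by (simp add: mval_def mdegree_UNIV power_mult_distrib prod.distrib power_sum)

lemma peval_homogeneous_smult:
  "homogeneous d p \<Longrightarrow> peval p (c *s x) = c ^ d * peval p (x :: complex ^ 'v::finite)"
  unfolding peval_def poly_eval_mval vector_smult_component mval_smult sum_distrib_left
  by (rule sum.cong) (auto simp: homogeneous_def)

section \<open>Formal partial derivatives as analytic directional derivatives\<close>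

lemma mval_has_field_derivative:
  fixes x v :: "'v::finite \<Rightarrow> complex"
  shows "((\<lambda>t. mval (\<lambda>i. x i + t * v i) m) has_field_derivative
     (\<Sum>i\<in>UNIV. of_nat (lookup m i) * mval x (m - single i 1) * v i)) (at 0)"
proof -
  have *: "mval x (m - single i 1)
     = x i ^ (lookup m i - 1) * (\<Prod>j\<in>UNIV - {i}. x j ^ lookup m j)" for i
    unfolding mval_def
    by (subst prod.remove [of UNIV i]) (auto simp: lookup_minus lookup_single intro!: prod.cong)
  have "((\<lambda>t. mval (\<lambda>i. x i + t * v i) m) has_field_derivative
     (\<Sum>i\<in>UNIV. (of_nat (lookup m i) * (v i * (x i + 0 * v i) ^ (lookup m i - 1)))
         * (\<Prod>j\<in>UNIV - {i}. (x j + 0 * v j) ^ lookup m j))) (at 0)"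
    unfolding mval_def
    by (rule has_field_derivative_prod) (auto intro!: derivative_eq_intros)
  moreover have "(\<Sum>i\<in>UNIV. (of_nat (lookup m i) * (v i * (x i + 0 * v i) ^ (lookup m i - 1)))
         * (\<Prod>j\<in>UNIV - {i}. (x j + 0 * v j) ^ lookup m j))
     = (\<Sum>i\<in>UNIV. of_nat (lookup m i) * mval x (m - single i 1) * v i)"
    unfolding * by (intro sum.cong refl) (simp only: mult_zero_left add_0_right mult_ac)
  ultimately show ?thesis
    by (simp only:)
qed

text \<open>Reading \<open>pdiff\<close> through the derivative along a line makes the analytic
  product rule applicable: \<open>DERIV_mult\<close> and uniqueness of derivatives later stand in
  for a Leibniz rule for polynomials.\<close>

lemma peval_has_field_derivative:
  fixes x v :: "complex ^ 'v::finite"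
  shows "((\<lambda>t. peval q (x + t *s v)) has_field_derivative
     (\<Sum>i\<in>UNIV. peval (pdiff i q) x * v $ i)) (at 0)"
proof -
  have eq: "peval q (x + t *s v)
     = (\<Sum>m\<in>keys q. lookup q m * mval (\<lambda>i. x $ i + t * v $ i) m)" for t
    by (simp add: peval_def poly_eval_mval)
  have "((\<lambda>t. peval q (x + t *s v)) has_field_derivative
     (\<Sum>m\<in>keys q. lookup q m *
       (\<Sum>i\<in>UNIV. of_nat (lookup m i) * mval (\<lambda>i. x $ i) (m - single i 1) * v $ i))) (at 0)"
    unfolding eq by (intro DERIV_sum DERIV_cmult mval_has_field_derivative)
  moreover have "(\<Sum>m\<in>keys q. lookup q m *
       (\<Sum>i\<in>UNIV. of_nat (lookup m i) * mval (\<lambda>i. x $ i) (m - single i 1) * v $ i))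
     = (\<Sum>i\<in>UNIV. peval (pdiff i q) x * v $ i)"
    unfolding pdiff_def peval_sum peval_single sum_distrib_left sum_distrib_right
    by (subst sum.swap) (intro sum.cong refl, simp only: mult_ac)
  ultimately show ?thesis
    by (simp only:)
qed

section \<open>Normal forms\<close>

lemma keys_cst_mult: "keys (cst a * p) \<subseteq> keys p" for p :: "('v, complex) mpoly"
  using keys_mult [of "cst a" p] by (auto simp: cst_def split: if_splits)

text \<open>The relations \<open>x\<^sub>i\<^sup>2 = r\<^sub>i\<close> for \<open>i \<in> V\<close> have pairwise coprime leading monomials with respect to the
  weight \<open>w\<close>, so they form a Groebner basis: the quotient is free over the polynomial ring in the
  remaining variables, with the squarefree monomials in the variables from \<open>V\<close> as a basis.\<close>

locale square_relations =
  fixes V :: "'v::finite set" and r :: "'v \<Rightarrow> ('v, complex) mpoly" and w :: "'v \<Rightarrow> nat"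
  assumes homogeneous_r: "i \<in> V \<Longrightarrow> homogeneous 2 (r i)"
    and weight_r: "i \<in> V \<Longrightarrow> t \<in> keys (r i) \<Longrightarrow>
      (\<Sum>j\<in>UNIV. w j * lookup t j) < 2 * w i"
begin

definition weight :: "('v \<Rightarrow>\<^sub>0 nat) \<Rightarrow> nat" where
  "weight m = (\<Sum>j\<in>UNIV. w j * lookup m j)"

lemma weight_add: "weight (m + n) = weight m + weight n"
  by (simp add: weight_def lookup_add distrib_left sum.distrib)

lemma weight_single: "weight (single i k) = w i * k"
proof -
  have "weight (single i k) = (\<Sum>j\<in>UNIV. if j = i then w i * k else 0)"
    unfolding weight_def by (rule sum.cong) (auto simp: lookup_single)
  then show ?thesis by simp
qed

lemma split_square: "2 \<le> lookup (m :: 'v \<Rightarrow>\<^sub>0 nat) i \<Longrightarrow> single i 2 + (m - single i 2) = m"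
  by (rule poly_mapping_eqI) (auto simp: lookup_add lookup_minus lookup_single when_def)

text \<open>The choice is arbitrary; \<open>nf_mon_reduce\<close> shows that every admissible choice
  leads to the same normal form.\<close>

definition red :: "('v \<Rightarrow>\<^sub>0 nat) \<Rightarrow> 'v" where
  "red m = (SOME i. i \<in> V \<and> 2 \<le> lookup m i)"

lemma red: "\<exists>i\<in>V. 2 \<le> lookup m i \<Longrightarrow> red m \<in> V \<and> 2 \<le> lookup m (red m)"
  unfolding red_def by (rule someI_ex) blast

text \<open>Rewriting terminates because each monomial of \<open>r i\<close> weighs less than the
  square it replaces.\<close>

function nf_mon :: "('v \<Rightarrow>\<^sub>0 nat) \<Rightarrow> ('v, complex) mpoly" where
  "nf_mon m = (if \<exists>i\<in>V. 2 \<le> lookup m i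
     then \<Sum>t\<in>keys (r (red m)). cst (lookup (r (red m)) t) *
       nf_mon (t + (m - single (red m) 2))
     else single m 1)"
  by auto
termination
proof (relation "Wellfounded.measure weight")
  fix m t assume *: "\<exists>i\<in>V. 2 \<le> lookup m i" and t: "t \<in> keys (r (red m))"
  have "weight m = 2 * w (red m) + weight (m - single (red m) 2)"
    using split_square [of m "red m"] red [OF *] by (metis weight_add weight_single mult.commute)
  then show "(t + (m - single (red m) 2), m) \<in> Wellfounded.measure weight"
    using weight_r [OF _ t] red [OF *] by (simp add: weight_add) (simp add: weight_def)
qed simp

declare nf_mon.simps [simp del]

definition normal :: "('v \<Rightarrow>\<^sub>0 nat) \<Rightarrow> bool" where
  "normal m \<longleftrightarrow> (\<forall>i\<in>V. lookup m i < 2)"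

lemma nf_mon_normal: "normal m \<Longrightarrow> nf_mon m = single m 1"
  by (subst nf_mon.simps) (auto simp: normal_def dest: leD)

definition nf :: "('v, complex) mpoly \<Rightarrow> ('v, complex) mpoly" where
  "nf p = (\<Sum>m\<in>keys p. cst (lookup p m) * nf_mon m)"

lemma nf_superset:
  "finite K \<Longrightarrow> keys p \<subseteq> K \<Longrightarrow> nf p = (\<Sum>m\<in>K. cst (lookup p m) * nf_mon m)"
  unfolding nf_def by (intro sum.mono_neutral_left) (auto simp: in_keys_iff)

lemma nf_0 [simp]: "nf 0 = 0"
  by (simp add: nf_def)

lemma nf_add: "nf (p + q) = nf p + nf q"
  using keys_add [of p q]
  by (simp add: nf_superset [of "keys p \<union> keys q"]
      lookup_add ecst.cadd distrib_right sum.distrib)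

lemma nf_sum: "nf (sum f K) = (\<Sum>k\<in>K. nf (f k))"
  by (induction K rule: infinite_finite_induct) (simp_all add: nf_add)

lemma nf_single: "nf (single m a) = cst a * nf_mon m"
  by (subst nf_superset [of "{m}"]) auto

lemma nf_cst_mult: "nf (cst a * p) = cst a * nf p"
proof (induction p rule: mpoly_induct)
  case (add p m b)
  have "nf (cst a * single m b) = cst a * nf (single m b)"
    unfolding cst_mult_single nf_single by (simp only: ecst.cmult mult.assoc)
  with add show ?case by (simp only: distrib_left nf_add)
qed simp

lemma nf_uminus: "nf (- p) = - nf p"
  using nf_add [of p "- p"] by (simp add: eq_neg_iff_add_eq_0 add.commute)

lemma nf_diff: "nf (p - q) = nf p - nf q"
  using nf_add [of p "- q"] by (simp add: nf_uminus)

lemma nf_mult_single: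
  "nf (p * single m 1) = (\<Sum>t\<in>keys p. cst (lookup p t) * nf_mon (t + m))"
proof -
  have "p * single m 1
     = (\<Sum>t\<in>keys p. single t (lookup p t) * single m 1)"
    by (subst sum_distrib_right [symmetric]) (simp flip: mpoly_sum_single)
  then show ?thesis by (simp add: nf_sum mult_single nf_single)
qed

text \<open>Confluence, as in Buchberger's criterion for coprime leading monomials. If the normal
  form starts at another square \<open>j\<close>, both squares divide the monomial, and reducing
  them in either order leads to \<open>nf (r i * r j * single n 1)\<close>. Induction on the weight
  covers the intermediate monomials.\<close>

lemma nf_mon_reduce:
  "i \<in> V \<Longrightarrow> nf_mon (single i 2 + m) = nf (r i * single m 1)"
proof (induction "weight (single i 2 + m)" arbitrary: i m rule: less_induct)
  case less
  define M where "M = single i 2 + m"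
  define j where "j = red M"
  have ex: "\<exists>i\<in>V. 2 \<le> lookup M i"
    using less.prems by (auto simp: M_def lookup_add intro!: bexI [of _ i])
  from red [OF this] have jV: "j \<in> V" and j2: "2 \<le> lookup M j"
    by (auto simp: j_def)
  have M: "nf_mon M = (\<Sum>t\<in>keys (r j). cst (lookup (r j) t) *
       nf_mon (t + (M - single j 2)))"
    by (subst nf_mon.simps) (use ex in \<open>simp add: j_def\<close>)
  show ?case
  proof (cases "j = i")
    case True
    then show ?thesis
      using M by (simp add: M_def nf_mult_single)
  next
    case False
    define n where "n = m - single j 2"
    have m: "m = single j 2 + n"
      using j2 False by (auto simp: n_def M_def lookup_add lookup_single split_square)
    have wM: "weight M = 2 * w i + 2 * w j + weight n"
      by (simp add: M_def m weight_add weight_single)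
    \<comment> \<open>One square has been replaced by the lighter \<open>t\<close>, so the weight is
      below that of \<open>M\<close> and the induction hypothesis reduces the other square.\<close>
    have swap: "nf_mon (t + (single k 2 + n)) = nf (r k * single (t + n) 1)"
      if "t \<in> keys (r l)" "k = i \<and> l = j \<or> k = j \<and> l = i" for t k l
    proof -
      have "weight (single k 2 + (t + n)) < weight M"
        using weight_r [of l t] that jV less.prems
        by (auto simp: weight_add weight_single wM) (auto simp: weight_def)
      then show ?thesis
        using less.hyps [of k "t + n"] that jV less.prems by (auto simp: M_def add.left_commute)
    qed
    have exp: "(\<Sum>t\<in>keys (r l). cst (lookup (r l) t) *
        nf (r k * single (t + n) 1)) = nf (r k * r l * single n 1)" for k l
    proof -
      have "nf (r k * r l * single n 1) = nf (\<Sum>t\<in>keys (r l).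
         r k * single t (lookup (r l) t) * single n 1)"
        by (simp flip: sum_distrib_right sum_distrib_left mpoly_sum_single)
      also have "\<dots> = (\<Sum>t\<in>keys (r l). cst (lookup (r l) t) *
        nf (r k * single (t + n) 1))"
        unfolding nf_sum
      proof (intro sum.cong refl)
        fix t
        have "r k * single t a * single n 1
          = cst a * (r k * single (t + n) 1)" for a
          by (simp only: mult.left_commute [of "cst _"] cst_mult_single mult.assoc mult_single mult_1_right)
        then show "nf (r k * single t (lookup (r l) t) * single n 1)
          = cst (lookup (r l) t) * nf (r k * single (t + n) 1)"
          by (simp only: nf_cst_mult)
      qed
      finally show ?thesis by simp
    qed
    have "nf_mon M = (\<Sum>t\<in>keys (r j). cst (lookup (r j) t) *
       nf_mon (t + (single i 2 + n)))"
      by (subst M) (simp add: M_def m add.left_commute [of "single i 2"])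
    also have "\<dots> = nf (r i * r j * single n 1)"
      by (simp add: swap [of _ j i] flip: exp)
    also have "\<dots> = (\<Sum>t\<in>keys (r i). cst (lookup (r i) t) *
       nf_mon (t + (single j 2 + n)))"
      by (simp add: swap [of _ i j] exp mult.commute [of "r i"])
    also have "\<dots> = nf (r i * single m 1)"
      by (simp add: nf_mult_single m)
    finally show ?thesis by (simp add: M_def)
  qed
qed

definition rel :: "'v \<Rightarrow> ('v, complex) mpoly" where
  "rel i = mvar i ^ 2 - r i"

lemma nf_rel_mult: "i \<in> V \<Longrightarrow> nf (p * rel i) = 0"
proof (induction p rule: mpoly_induct)
  case (add p m a)
  have "single m a * rel i
     = cst a * (single (single i 2 + m) 1 - r i * single m 1)"
    by (simp add: rel_def mvar_power right_diff_distrib mult_single cst_mult_single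
        mult.left_commute [of "cst _"] mult.commute add.commute)
  then have "nf (single m a * rel i) = 0"
    using add.prems by (simp add: nf_cst_mult nf_diff nf_single nf_mon_reduce)
  with add show ?case by (simp add: distrib_right nf_add)
qed simp

lemma nf_ideal_eq_0: "p \<in> ideal_gen (rel ` V) \<Longrightarrow> nf p = 0"
  by (induction rule: ideal.span_induct_alt) (auto simp: nf_add nf_rel_mult)

lemma diff_nf_mon_in_ideal: "single m 1 - nf_mon m \<in> ideal_gen (rel ` V)"
proof (induction m rule: nf_mon.induct)
  case (1 m)
  show ?case
  proof (cases "\<exists>i\<in>V. 2 \<le> lookup m i")
    case True
    define j where "j = red m"
    define n where "n = m - single j 2"
    have j: "j \<in> V" "m = single j 2 + n"
      using red [OF True] by (auto simp: j_def n_def split_square)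
    have IH: "single (t + n) 1 - nf_mon (t + n) \<in> ideal_gen (rel ` V)"
      if "t \<in> keys (r j)" for t
      using 1 [OF True, of t] that by (simp add: j_def n_def)
    have "(\<Sum>t\<in>keys (r j). cst (lookup (r j) t) *
        (single (t + n) 1 - nf_mon (t + n))) \<in> ideal_gen (rel ` V)"
      by (intro ideal.span_sum ideal.span_scale IH)
    moreover have "(\<Sum>t\<in>keys (r j). cst (lookup (r j) t) * single (t + n) 1)
       = r j * single n 1"
    proof -
      have "r j * single n 1 = (\<Sum>t\<in>keys (r j).
         single t (lookup (r j) t)) * single n 1"
        by (simp flip: mpoly_sum_single)
      then show ?thesis
        by (simp add: sum_distrib_right mult_single cst_mult_single)
    qed
    moreover have "nf_mon m = (\<Sum>t\<in>keys (r j). cst (lookup (r j) t) * nf_mon (t + n))"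
      by (subst nf_mon.simps) (use True in \<open>simp add: j_def n_def\<close>)
    ultimately have "r j * single n 1 - nf_mon m \<in> ideal_gen (rel ` V)"
      by (simp add: right_diff_distrib sum_subtractf)
    moreover have "single n 1 * rel j \<in> ideal_gen (rel ` V)"
      using j(1) by (intro ideal.span_scale ideal.span_base imageI)
    moreover have "single n 1 * rel j = single m 1 - r j * single n 1"
      by (simp add: rel_def mvar_power right_diff_distrib mult_single j(2) mult.commute add.commute)
    ultimately show ?thesis
      using ideal.span_add by fastforce
  next
    case False
    then show ?thesis by (subst nf_mon.simps) (simp add: ideal.span_zero)
  qed
qed

lemma diff_nf_in_ideal: "p - nf p \<in> ideal_gen (rel ` V)"
proof (induction p rule: mpoly_induct)
  case (add p m a)
  have "cst a * (single m 1 - nf_mon m) \<in> ideal_gen (rel ` V)"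
    by (intro ideal.span_scale diff_nf_mon_in_ideal)
  from ideal.span_add [OF add this] show ?case
    by (simp add: nf_add nf_single right_diff_distrib cst_mult_single algebra_simps)
qed (simp add: ideal.span_zero)

lemma nf_eq_0_iff: "nf p = 0 \<longleftrightarrow> p \<in> ideal_gen (rel ` V)"
  using diff_nf_in_ideal [of p] nf_ideal_eq_0 by auto

text \<open>Homogeneous relations preserve degrees; this lets the dimension count take place in
  bounded degree.\<close>

lemma keys_nf_mon: "t \<in> keys (nf_mon m) \<Longrightarrow> normal t \<and> mdegree t = mdegree m"
proof (induction m arbitrary: t rule: nf_mon.induct)
  case (1 m)
  show ?case
  proof (cases "\<exists>i\<in>V. 2 \<le> lookup m i")
    case True
    define j where "j = red m"
    define n where "n = m - single j 2"
    let ?f = "\<lambda>t. cst (lookup (r j) t) * nf_mon (t + n)"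
    have "nf_mon m = sum ?f (keys (r j))"
      by (subst nf_mon.simps) (use True in \<open>simp add: j_def n_def\<close>)
    with "1.prems" have "t \<in> keys (sum ?f (keys (r j)))"
      by simp
    then have "t \<in> (\<Union>u\<in>keys (r j). keys (?f u))"
      by (rule subsetD [OF keys_sum])
    then obtain u where "u \<in> keys (r j)" "t \<in> keys (?f u)"
      by blast
    then have u: "u \<in> keys (r (red m))"
      "t \<in> keys (nf_mon (u + (m - single (red m) 2)))"
      using keys_cst_mult by (auto simp: j_def n_def)
    have "mdegree u = 2"
      using homogeneous_r red [OF True] u(1) by (auto simp: homogeneous_def)
    moreover have "mdegree m = 2 + mdegree (m - single (red m) 2)"
      using split_square [of m "red m"] red [OF True] by (metis mdegree_add mdegree_single)
    ultimately show ?thesis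
      using "1.IH" [OF True u] by (simp add: mdegree_add)
  next
    case False
    then have "normal m" by (auto simp: normal_def not_le)
    with "1.prems" show ?thesis by (simp add: nf_mon_normal)
  qed
qed

lemma keys_nf:
  assumes "t \<in> keys (nf p)"
  shows "normal t \<and> (\<exists>m\<in>keys p. mdegree t = mdegree m)"
proof -
  have "t \<in> (\<Union>m\<in>keys p. keys (cst (lookup p m) * nf_mon m))"
    using assms unfolding nf_def by (rule subsetD [OF keys_sum])
  then show ?thesis
    using keys_cst_mult keys_nf_mon by blast
qed

lemma nf_normal:
  assumes "\<And>t. t \<in> keys p \<Longrightarrow> normal t"
  shows "nf p = p"
proof -
  have "nf p = (\<Sum>m\<in>keys p. single m (lookup p m))"
    unfolding nf_def by (rule sum.cong) (simp_all add: assms nf_mon_normal cst_mult_single)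
  then show ?thesis by (simp flip: mpoly_sum_single)
qed

text \<open>Multiplying by a polynomial without variables from \<open>V\<close> keeps normal
  monomials normal. So the normal form is linear over the polynomial ring in the free variables,
  which is the form in which freeness is used.\<close>

lemma nf_free_mult:
  assumes "\<And>t i. t \<in> keys a \<Longrightarrow> i \<in> V \<Longrightarrow> lookup t i = 0"
  shows "nf (a * p) = a * nf p"
proof -
  have "nf (a * (p - nf p)) = 0"
    using diff_nf_in_ideal by (simp add: nf_eq_0_iff ideal.span_scale)
  then have "nf (a * p) = nf (a * nf p)"
    by (simp add: right_diff_distrib nf_diff)
  also have "\<dots> = a * nf p"
  proof (rule nf_normal)
    fix t assume "t \<in> keys (a * nf p)"
    then obtain u v where "t = u + v" "u \<in> keys a" "v \<in> keys (nf p)"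
      using keys_mult by blast
    then show "normal t"
      using assms keys_nf [of v p] by (simp add: normal_def lookup_add)
  qed
  finally show ?thesis .
qed

end

section \<open>Chains of primes\<close>

lemma prime_idealD:
  assumes "prime_ideal P"
  shows "is_ideal P" "1 \<notin> P" "a * b \<in> P \<Longrightarrow> a \<in> P \<or> b \<in> P"
  using assms by (auto simp: prime_ideal_def)

lemma prime_ideal_power: "prime_ideal P \<Longrightarrow> a ^ n \<in> P \<Longrightarrow> a \<in> P"
  by (induction n) (auto dest: prime_idealD)

lemma prime_ideal_cst: "prime_ideal P \<Longrightarrow> cst (a :: complex) \<in> P \<Longrightarrow> a = 0"
proof (rule ccontr)
  assume "prime_ideal P" "cst a \<in> P" "a \<noteq> 0"
  then have "cst (1 / a) * cst a \<in> P"
    by (auto simp: prime_ideal_def is_ideal_iff)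
  with \<open>a \<noteq> 0\<close> have "1 \<in> P"
    by (simp flip: ecst.cmult)
  with \<open>prime_ideal P\<close> show False by (auto simp: prime_ideal_def)
qed

text \<open>The list records a witness for each strict inclusion. The witnesses, not the primes, are
  what turns out to be algebraically independent.\<close>

fun prime_chain :: "'a::comm_ring_1 set \<Rightarrow> 'a list \<Rightarrow> bool" where
  "prime_chain P [] \<longleftrightarrow> prime_ideal P"
| "prime_chain P (a # as) \<longleftrightarrow> prime_ideal P \<and> a \<notin> P \<and> (\<exists>P'. P \<subseteq> P' \<and> a \<in> P' \<and> prime_chain P' as)"

fun list_power :: "'a::comm_monoid_mult list \<Rightarrow> nat list \<Rightarrow> 'a" where
  "list_power (a # as) (j # js) = a ^ j * list_power as js"
| "list_power _ _ = 1"

lemma prime_chain_prime: "prime_chain P as \<Longrightarrow> prime_ideal P"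
  by (cases as) auto

text \<open>A relation modulo the bottom prime is divided by the lowest power of the first witness
  that occurs, which is allowed since the witness lies outside this prime. Modulo the next prime the
  witness vanishes, and a relation in the remaining witnesses survives.\<close>

lemma prime_chain_algebraically_independent:
  fixes c :: "nat list \<Rightarrow> complex" and as :: "('v::finite, complex) mpoly list"
  assumes "prime_chain P as" "finite F" "\<And>js. js \<in> F \<Longrightarrow> length js = length as"
    and "(\<Sum>js\<in>F. cst (c js) * list_power as js) \<in> P"
  shows "\<forall>js\<in>F. c js = 0"
  using assms
proof (induction as arbitrary: P F c)
  case Nil
  show ?case
  proof
    fix js assume "js \<in> F"
    with Nil.prems(3) have "F = {[]}" "js = []" by auto
    with Nil.prems show "c js = 0" by (auto dest: prime_ideal_cst)
  qed
next
  case (Cons a as)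
  from Cons.prems(1) obtain P' where P: "prime_ideal P" "a \<notin> P" "P \<subseteq> P'" "a \<in> P'" and P': "prime_chain P' as"
    by auto
  have idP: "is_ideal P" and idP': "is_ideal P'"
    using P P' prime_chain_prime prime_idealD by blast+
  show ?case
  proof (rule ccontr)
    assume neg: "\<not> ?thesis"
    \<comment> \<open>Restricting to nonzero coefficients ensures that the minimal exponent
      \<open>e\<close> belongs to a nonzero term, which the induction hypothesis then
      contradicts.\<close>
    define F' where "F' = {js \<in> F. c js \<noteq> 0}"
    define e where "e = Min (hd ` F')"
    have fin: "finite F'" and ne: "F' \<noteq> {}"
      using neg Cons.prems(2) by (auto simp: F'_def)
    have le: "e \<le> hd js" if "js \<in> F'" for js
      using fin that by (simp add: e_def)
    have "e \<in> hd ` F'"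
      unfolding e_def using fin ne by (intro Min_in) auto
    then obtain js0 where js0: "js0 \<in> F'" "hd js0 = e" by auto
    have split: "js = hd js # tl js" if "js \<in> F'" for js
      using that Cons.prems(3) [of js] by (cases js) (auto simp: F'_def)
    define g where "g js = cst (c js) * (a ^ (hd js - e) * list_power as (tl js))" for js
    have "(\<Sum>js\<in>F. cst (c js) * list_power (a # as) js) = (\<Sum>js\<in>F'. cst (c js) * list_power (a # as) js)"
      using Cons.prems(2) by (intro sum.mono_neutral_right) (auto simp: F'_def)
    also have "\<dots> = (\<Sum>js\<in>F'. a ^ e * g js)"
    proof (rule sum.cong)
      fix js assume js: "js \<in> F'"
      have "list_power (a # as) js = a ^ hd js * list_power as (tl js)"
        by (subst split [OF js]) simp
      also have "a ^ hd js = a ^ e * a ^ (hd js - e)"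
        using le [OF js] by (simp flip: power_add)
      finally show "cst (c js) * list_power (a # as) js = a ^ e * g js"
        by (simp only: g_def mult_ac)
    qed simp
    also have "\<dots> = a ^ e * (\<Sum>js\<in>F'. g js)"
      by (simp add: sum_distrib_left)
    finally have "a ^ e * (\<Sum>js\<in>F'. g js) \<in> P"
      using Cons.prems(4) by simp
    then have "(\<Sum>js\<in>F'. g js) \<in> P'"
      using P prime_idealD(3) prime_ideal_power by blast
    define F0 where "F0 = {js \<in> F'. hd js = e}"
    have "(\<Sum>js\<in>F'. g js) = (\<Sum>js\<in>F0. g js) + (\<Sum>js\<in>F' - F0. g js)"
      using sum.subset_diff [of F0 F' g] fin by (auto simp: F0_def add.commute)
    moreover have "(\<Sum>js\<in>F' - F0. g js) \<in> P'"
    proof (rule ideal.subspace_sum [OF idP'])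
      fix js assume "js \<in> F' - F0"
      then have "hd js - e = Suc (hd js - e - 1)"
        using le [of js] by (auto simp: F0_def)
      then have "g js = (cst (c js) * a ^ (hd js - e - 1) * list_power as (tl js)) * a"
        unfolding g_def by (metis (no_types, lifting) mult.assoc mult.commute power_Suc)
      then show "g js \<in> P'"
        using ideal.subspace_scale [OF idP' P(4)] by simp
    qed
    ultimately have "(\<Sum>js\<in>F0. g js) \<in> P'"
      using \<open>(\<Sum>js\<in>F'. g js) \<in> P'\<close> ideal.subspace_diff [OF idP'] by fastforce
    moreover have "(\<Sum>js\<in>F0. g js) = (\<Sum>ks\<in>tl ` F0. cst (c (e # ks)) * list_power as ks)"
    proof (subst sum.reindex)
      show "inj_on tl F0"
      proof (rule inj_onI)
        fix x y assume "x \<in> F0" "y \<in> F0" "tl x = tl y"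
        then show "x = y" using split [of x] split [of y] by (auto simp: F0_def)
      qed
      show "sum g F0 = sum ((\<lambda>ks. cst (c (e # ks)) * list_power as ks) \<circ> tl) F0"
      proof (rule sum.cong)
        fix js assume "js \<in> F0"
        then have "hd js = e" "e # tl js = js" using split [of js] by (auto simp: F0_def)
        then show "g js = ((\<lambda>ks. cst (c (e # ks)) * list_power as ks) \<circ> tl) js"
          by (simp add: g_def)
      qed simp
    qed
    moreover have "finite F0" "F0 \<subseteq> F"
      using Cons.prems(2) by (auto simp: F0_def F'_def)
    ultimately have "\<forall>ks\<in>tl ` F0. c (e # ks) = 0"
      using Cons.prems(3) by (intro Cons.IH [OF P'] finite_imageI) auto
    moreover have "js0 \<in> F0" "e # tl js0 = js0"
      using js0 split [OF js0(1)] by (auto simp: F0_def)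
    ultimately show False
      using js0(1) by (force simp: F'_def)
  qed
qed

section \<open>Counting normal monomials in bounded degree\<close>

interpretation mvs: vector_space "\<lambda>a p. cst a * (p :: ('v, complex) mpoly)"
  by standard (simp_all only: distrib_left distrib_right ecst.cadd ecst.cmult mult.assoc ecst.c1 mult_1_left)

declare mvs.scale_scale [simp del]

lemma list_power_keys:
  fixes as :: "('v::finite, complex) mpoly list"
  assumes "\<And>a m. a \<in> set as \<Longrightarrow> m \<in> keys a \<Longrightarrow> mdegree m \<le> e"
    and "length js = length as" "t \<in> keys (list_power as js)"
  shows "mdegree t \<le> e * sum_list js"
  using assms
proof (induction as js arbitrary: t rule: list_power.induct)
  case (1 a as j js)
  have pw: "mdegree u \<le> e * n" if "u \<in> keys (a ^ n)" for u n
    using that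
  proof (induction n arbitrary: u)
    case (Suc n)
    then obtain v w where "u = v + w" "v \<in> keys a" "w \<in> keys (a ^ n)"
      using keys_mult [of a "a ^ n"] by auto
    then show ?case
      using Suc.IH [of w] "1.prems"(1) [of a v] by (simp add: mdegree_add)
  qed simp
  from "1.prems"(3) obtain u v where uv: "t = u + v" "u \<in> keys (a ^ j)"
    "v \<in> keys (list_power as js)"
    using keys_mult [of "a ^ j" "list_power as js"] by auto
  have "mdegree v \<le> e * sum_list js"
    using "1.prems" uv by (intro "1.IH") auto
  then show ?case
    using pw [OF uv(2)] by (simp add: uv(1) mdegree_add distrib_left)
qed auto

context square_relations
begin

text \<open>Exponents of free variables are at most the degree, the others at most one. What matters
  is the order of growth in \<open>K\<close>: the number of free variables.\<close>

lemma card_normal: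
  "finite {t. normal t \<and> mdegree t \<le> K}"
  "card {t. normal t \<and> mdegree t \<le> K} \<le> (K + 1) ^ card (- V) * 2 ^ card V"
proof -
  let ?B = "\<Pi>\<^sub>E i\<in>UNIV. if i \<in> V then {..<2} else {..K}"
  have le: "lookup t i \<le> mdegree t" for t :: "'v \<Rightarrow>\<^sub>0 nat" and i
    unfolding mdegree_UNIV by (rule member_le_sum) auto
  have sub: "lookup ` {t. normal t \<and> mdegree t \<le> K} \<subseteq> ?B"
    using le order_trans by (fastforce simp: normal_def)
  have inj: "inj_on lookup {t. normal t \<and> mdegree t \<le> K}"
    by (rule inj_onI) simp
  have fin: "finite ?B"
    by (rule finite_PiE) auto
  show "finite {t. normal t \<and> mdegree t \<le> K}"
    using finite_subset [OF sub fin] inj by (rule finite_imageD)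
  have "card {t. normal t \<and> mdegree t \<le> K} \<le> card ?B"
    using card_mono [OF fin sub] by (simp add: card_image [OF inj])
  also have "\<dots> = (\<Prod>i\<in>UNIV. if i \<in> V then 2 else K + 1)"
    by (subst card_PiE) (auto intro!: prod.cong)
  also have "\<dots> = 2 ^ card V * (K + 1) ^ card (- V)"
    by (subst prod.If_cases) (simp_all add: Compl_eq)
  finally show "card {t. normal t \<and> mdegree t \<le> K} \<le> (K + 1) ^ card (- V) * 2 ^ card V"
    by (simp add: mult.commute)
qed

text \<open>Products of \<open>N\<close> independent witnesses with exponents up to \<open>D\<close>
  have \<open>(D + 1) ^ N\<close> independent normal forms of degree at most
  \<open>e * (N * D)\<close>. The normal monomials of such degree number at most a constant times
  \<open>(D + 1) ^ n\<close>, which is too few for large \<open>D\<close> if \<open>N\<close>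
  exceeds \<open>n\<close>.\<close>

lemma prime_chain_length_le:
  assumes chain: "prime_chain P as" and I: "ideal_gen (rel ` V) \<subseteq> P"
  shows "length as \<le> card (- V)"
proof (rule ccontr)
  assume neg: "\<not> ?thesis"
  define N where "N = length as"
  define n where "n = card (- V)"
  have Nn: "Suc n \<le> N"
    using neg by (simp add: N_def n_def)
  define e where "e = Max (insert 0 (mdegree ` (\<Union>a\<in>set as. keys a)))"
  have e: "mdegree m \<le> e" if "a \<in> set as" "m \<in> keys a" for a m
    unfolding e_def using that by (intro Max_ge) auto
  \<comment> \<open>Chosen equal to the constant of the final estimate: with
    \<open>K + 1 \<le> (e * N + 1) * (D + 1)\<close> the count becomes
    \<open>(D + 1) ^ Suc n \<le> D * (D + 1) ^ n\<close>.\<close>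
  define D where "D = (e * N + 1) ^ n * 2 ^ card V"
  define L where "L = {js. set js \<subseteq> {..D} \<and> length js = N}"
  have L: "finite L" "card L = (D + 1) ^ N"
    unfolding L_def by (simp_all add: finite_lists_length_eq card_lists_length_eq)
  define K where "K = e * (N * D)"
  define T where "T = (\<lambda>t. single t (1 :: complex)) ` {t. normal t \<and> mdegree t \<le> K}"
  define f where "f js = nf (list_power as js)" for js
  have zero: "\<forall>js\<in>F. c js = 0" if "F \<subseteq> L" "(\<Sum>js\<in>F. cst (c js) * f js) = 0" for F c
  proof (rule prime_chain_algebraically_independent [OF chain])
    show "finite F" using that(1) L(1) by (rule finite_subset)
    show "length js = length as" if "js \<in> F" for js
      using that \<open>F \<subseteq> L\<close> by (auto simp: L_def N_def)
    have "nf (\<Sum>js\<in>F. cst (c js) * list_power as js) = 0"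
      using that(2) by (simp add: nf_sum nf_cst_mult f_def)
    then show "(\<Sum>js\<in>F. cst (c js) * list_power as js) \<in> P"
      using I by (auto simp: nf_eq_0_iff)
  qed
  have inj: "inj_on f L"
  proof (rule inj_onI, rule ccontr)
    fix x y assume xy: "x \<in> L" "y \<in> L" "f x = f y" "x \<noteq> y"
    then have "(\<Sum>js\<in>{x, y}. cst (if js = x then 1 else -1) * f js) = 0"
      using ecst.eval_uminus by (simp add: cst_def single_uminus)
    from zero [OF _ this] xy show False by (auto split: if_splits)
  qed
  have "f js \<in> mvs.span T" if "js \<in> L" for js
  proof -
    have "sum_list js \<le> length js * D" if "set js \<subseteq> {..D}" for js
      using that by (induction js) auto
    with that have "sum_list js \<le> N * D"
      by (auto simp: L_def)
    then have *: "e * sum_list js \<le> K"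
      by (simp add: K_def)
    have "single t (lookup (f js) t) \<in> mvs.span T"
      if t: "t \<in> keys (f js)" for t
    proof -
      obtain m where "m \<in> keys (list_power as js)" "normal t" "mdegree t = mdegree m"
        using keys_nf [of t "list_power as js"] t by (auto simp: f_def)
      moreover from this have "mdegree m \<le> e * sum_list js"
        using \<open>js \<in> L\<close> by (intro list_power_keys [OF e]) (auto simp: L_def N_def)
      ultimately have "single t 1 \<in> T"
        using * by (auto simp: T_def)
      from mvs.span_scale [OF mvs.span_base [OF this]] show ?thesis
        by (metis cst_mult_single mult_1_right)
    qed
    then show ?thesis
      by (subst mpoly_sum_single) (rule mvs.span_sum)
  qed
  then have sub: "f ` L \<subseteq> mvs.span T" by auto
  have ind: "mvs.independent (f ` L)"
  proof
    assume "mvs.dependent (f ` L)"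
    then obtain u v where u: "v \<in> f ` L" "u v \<noteq> 0" "(\<Sum>v\<in>f ` L. cst (u v) * v) = 0"
      using mvs.dependent_finite [of "f ` L"] L(1) by auto
    then have "(\<Sum>js\<in>L. cst (u (f js)) * f js) = 0"
      by (simp add: sum.reindex [OF inj])
    from zero [OF _ this] u show False by auto
  qed
  have "finite T"
    unfolding T_def by (intro finite_imageI card_normal)
  moreover have "card T \<le> (K + 1) ^ n * 2 ^ card V"
    unfolding T_def n_def by (rule order_trans [OF card_image_le card_normal(2)]) (rule card_normal)
  ultimately have "card (f ` L) \<le> (K + 1) ^ n * 2 ^ card V"
    using mvs.independent_span_bound [OF _ ind sub] by linarith
  then have "(D + 1) ^ N \<le> (K + 1) ^ n * 2 ^ card V"
    by (simp add: card_image [OF inj] L(2))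
  moreover have "(D + 1) ^ Suc n \<le> (D + 1) ^ N"
    using Nn by (intro power_increasing) auto
  moreover have "(K + 1) ^ n \<le> ((e * N + 1) * (D + 1)) ^ n"
    by (intro power_mono) (auto simp: K_def algebra_simps)
  ultimately have "(D + 1) ^ Suc n \<le> ((e * N + 1) * (D + 1)) ^ n * 2 ^ card V"
    by (meson le_trans mult_le_mono1)
  also have "\<dots> = ((e * N + 1) ^ n * 2 ^ card V) * (D + 1) ^ n"
    by (simp only: power_mult_distrib mult_ac)
  also have "\<dots> = D * (D + 1) ^ n"
    by (simp only: D_def)
  finally show False by simp
qed

end

section \<open>Dimension\<close>

text \<open>Krull's argument: by Zorn's lemma some ideal is maximal among those over
  \<open>J\<close> that miss \<open>M\<close>. Adjoining an element outside it produces a member of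
  \<open>M\<close>, and the product of two such members shows that a product of outside elements
  stays outside.\<close>

lemma prime_ideal_avoiding:
  assumes J: "is_ideal J" and "J \<inter> M = {}" and M: "1 \<in> M" "\<And>a b. a \<in> M \<Longrightarrow> b \<in> M \<Longrightarrow> a * b \<in> M"
  obtains P where "prime_ideal P" "J \<subseteq> P" "P \<inter> M = {}"
proof -
  define S where "S = {K. is_ideal K \<and> J \<subseteq> K \<and> K \<inter> M = {}}"
  have "\<Union>C \<in> S" if "C \<noteq> {}" "subset.chain S C" for C
  proof -
    have C: "K \<in> C \<Longrightarrow> is_ideal K \<and> J \<subseteq> K \<and> K \<inter> M = {}" for K
      using that by (auto simp: S_def subset.chain_def)
    have tot: "K \<in> C \<Longrightarrow> L \<in> C \<Longrightarrow> K \<subseteq> L \<or> L \<subseteq> K" for K L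
      using that by (auto simp: subset.chain_def)
    have "a + b \<in> \<Union>C" if "a \<in> K" "K \<in> C" "b \<in> L" "L \<in> C" for a b K L
    proof -
      from tot [of K L] that consider "a \<in> L" "b \<in> L" | "a \<in> K" "b \<in> K" by auto
      then show ?thesis
        using C [of K] C [of L] that by cases (meson UnionI ideal.subspace_add)+
    qed
    moreover have "0 \<in> \<Union>C" "\<And>c a. a \<in> \<Union>C \<Longrightarrow> c * a \<in> \<Union>C"
      using C \<open>C \<noteq> {}\<close> by (fastforce simp: is_ideal_iff)+
    ultimately have "is_ideal (\<Union>C)"
      unfolding is_ideal_iff by blast
    then show ?thesis
      using C \<open>C \<noteq> {}\<close> by (auto simp: S_def)
  qed
  moreover have "S \<noteq> {}"
    using assms by (auto simp: S_def)
  ultimately obtain P where P: "P \<in> S" and max: "\<And>K. K \<in> S \<Longrightarrow> P \<subseteq> K \<Longrightarrow> K = P"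
    using subset_Zorn_nonempty [of S] by metis
  have idP: "is_ideal P" and disj: "J \<subseteq> P" "P \<inter> M = {}"
    using P by (auto simp: S_def)
  have meet: "\<exists>p\<in>P. \<exists>c. p + c * a \<in> M" if "a \<notin> P" for a
  proof (rule ccontr)
    assume neg: "\<not> ?thesis"
    define K where "K = {p + c * a | p c. p \<in> P}"
    have mem: "p + c * a \<in> K" if "p \<in> P" for p c
      using that unfolding K_def by blast
    have 0: "0 \<in> P" using idP by (rule ideal.subspace_0)
    have "is_ideal K"
      unfolding is_ideal_iff
    proof (intro conjI ballI allI)
      show "0 \<in> K"
        using mem [OF 0, of 0] by simp
      show "x + y \<in> K" if "x \<in> K" "y \<in> K" for x y
      proof -
        from that obtain p c q d where xy: "x = p + c * a" "y = q + d * a" "p \<in> P" "q \<in> P"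
          unfolding K_def by blast
        have "(p + q) + (c + d) * a \<in> K"
          by (intro mem ideal.subspace_add [OF idP] xy)
        then show ?thesis by (simp add: xy algebra_simps)
      qed
      show "d * x \<in> K" if "x \<in> K" for d x
      proof -
        from that obtain p c where x: "x = p + c * a" "p \<in> P"
          unfolding K_def by blast
        have "d * p + d * c * a \<in> K"
          by (intro mem ideal.subspace_scale [OF idP] x)
        then show ?thesis by (simp only: x distrib_left mult.assoc)
      qed
    qed
    moreover have "P \<subseteq> K"
      using mem [of _ 0] by fastforce
    ultimately have "K = P"
      using neg disj by (intro max) (auto simp: S_def K_def)
    moreover have "a \<in> K"
      using mem [OF 0, of 1] by simp
    ultimately show False using that by simp
  qed
  have "prime_ideal P"
    unfolding prime_ideal_def
  proof (intro conjI allI impI)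
    show "1 \<notin> P" using disj M by auto
    fix a b assume ab: "a * b \<in> P"
    show "a \<in> P \<or> b \<in> P"
    proof (rule ccontr)
      assume "\<not> (a \<in> P \<or> b \<in> P)"
      with meet obtain p c q d where *: "p \<in> P" "q \<in> P" "p + c * a \<in> M" "q + d * b \<in> M"
        by meson
      have "(p + c * a) * (q + d * b) = (q + d * b) * p + c * a * q + c * d * (a * b)"
        by (simp add: algebra_simps)
      also have "\<dots> \<in> P"
        using ideal.subspace_add [OF idP] ideal.subspace_scale [OF idP *(1)]
          ideal.subspace_scale [OF idP *(2)] ideal.subspace_scale [OF idP ab] by blast
      finally show False
        using M(2) [OF *(3,4)] disj by auto
    qed
  qed (rule idP)
  with disj show ?thesis using that by blast
qed

text \<open>Substituting \<open>x\<^sub>i \<mapsto> x\<^sub>i t\<close> makes the homogeneous component of degree \<open>d\<close> the coefficient of \<open>t\<^sup>d\<close>.\<close>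

definition homog :: "('v, complex) mpoly \<Rightarrow> ('v::finite, complex) mpoly poly" where
  "homog = poly_eval (\<lambda>a. [:cst a:]) (\<lambda>i. Polynomial.monom (mvar i) 1)"

interpretation ehomog: eval_ring_hom "\<lambda>a::complex. [:cst a :: ('v::finite, complex) mpoly:]"
  by standard (simp_all add: ecst.cadd ecst.cmult one_pCons)

lemma homog_single:
  fixes m :: "'v::finite \<Rightarrow>\<^sub>0 nat"
  shows "homog (single m a) = Polynomial.monom (single m a) (mdegree m)"
proof -
  have "mval (\<lambda>i. Polynomial.monom (mvar i) 1) m
     = (Polynomial.monom (mval mvar m) (mdegree m) :: ('v, complex) mpoly poly)"
  proof -
    have "(\<Prod>i\<in>K. Polynomial.monom (mvar i) 1 ^ lookup m i)
       = Polynomial.monom (\<Prod>i\<in>K. mvar i ^ lookup m i :: ('v, complex) mpoly)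
           (\<Sum>i\<in>K. lookup m i)" for K
      by (induction K rule: infinite_finite_induct)
        (simp_all add: monom_power mult_monom)
    then show ?thesis by (simp add: mval_def mdegree_UNIV)
  qed
  then show ?thesis
    by (simp add: homog_def ehomog.eval_single mval_mvar smult_monom cst_mult_single)
qed

lemma homog_add: "homog (p + q) = homog p + homog q"
  by (simp add: homog_def ehomog.eval_add)

lemma homog_mult: "homog (p * q) = homog p * homog q"
  by (simp add: homog_def ehomog.eval_mult)

lemma homog_0 [simp]: "homog 0 = 0"
  by (simp add: homog_def)

lemma homog_sum: "homog (sum f K) = (\<Sum>k\<in>K. homog (f k))"
  by (simp add: homog_def ehomog.eval_sum)

lemma homog_homogeneous:
  assumes "homogeneous d p" shows "homog p = Polynomial.monom p d"
proof -
  have "homog p = (\<Sum>m\<in>keys p. homog (single m (lookup p m)))"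
    by (simp flip: homog_sum mpoly_sum_single)
  also have "\<dots> = (\<Sum>m\<in>keys p. Polynomial.monom (single m (lookup p m)) d)"
    using assms by (intro sum.cong) (auto simp: homog_single homogeneous_def)
  also have "\<dots> = Polynomial.monom p d"
    by (simp flip: monom_sum mpoly_sum_single)
  finally show ?thesis .
qed

lemma homogeneous_coeff_homog: "homogeneous d (coeff (homog p) d)"
  by (induction p rule: mpoly_induct)
    (auto simp: homog_add homog_single intro!: homogeneous_add homogeneous_single)

lemma sum_coeff_homog: "(\<Sum>d\<le>degree (homog p). coeff (homog p) d) = p"
proof -
  have "poly (homog p) 1 = p"
    by (induction p rule: mpoly_induct) (simp_all add: homog_add homog_single poly_monom)
  then show ?thesis by (simp add: poly_altdef)
qed

section \<open>The largest homogeneous ideal inside an ideal\<close>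

definition homogeneous_core :: "('v::finite, complex) mpoly set \<Rightarrow> ('v, complex) mpoly set" where
  "homogeneous_core P = {q. \<forall>d. coeff (homog q) d \<in> P}"

lemma homogeneous_core_subset: "is_ideal P \<Longrightarrow> homogeneous_core P \<subseteq> P"
proof
  fix q assume "is_ideal P" "q \<in> homogeneous_core P"
  then have "(\<Sum>d\<le>degree (homog q). coeff (homog q) d) \<in> P"
    by (intro ideal.subspace_sum) (auto simp: homogeneous_core_def)
  then show "q \<in> P" by (simp add: sum_coeff_homog)
qed

lemma homogeneous_in_core:
  "is_ideal P \<Longrightarrow> homogeneous d q \<Longrightarrow> q \<in> P \<Longrightarrow> q \<in> homogeneous_core P"
  by (auto simp: homogeneous_core_def homog_homogeneous is_ideal_iff)

lemma is_ideal_homogeneous_core: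
  assumes "is_ideal P" shows "is_ideal (homogeneous_core P)"
  unfolding is_ideal_iff homogeneous_core_def
proof (intro conjI ballI allI CollectI)
  fix c a :: "('a, complex) mpoly" and d assume "a \<in> {q. \<forall>d. coeff (homog q) d \<in> P}"
  then show "coeff (homog (c * a)) d \<in> P"
    using assms by (auto simp: homog_mult coeff_mult intro!: ideal.subspace_sum ideal.subspace_scale)
qed (use assms in \<open>auto simp: homog_add is_ideal_iff\<close>)

lemma homogeneous_ideal_core:
  assumes "is_ideal P" shows "homogeneous_ideal (homogeneous_core P)"
  unfolding homogeneous_ideal_def
proof (rule antisym)
  let ?H = "{q \<in> homogeneous_core P. \<exists>d. homogeneous d q}"
  show "homogeneous_core P \<subseteq> ideal_gen ?H"
  proof
    fix q assume q: "q \<in> homogeneous_core P"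
    have "coeff (homog q) d \<in> ?H" for d
      using q homogeneous_coeff_homog [of d q] homogeneous_in_core [OF assms]
      by (auto simp: homogeneous_core_def)
    then have "(\<Sum>d\<le>degree (homog q). coeff (homog q) d) \<in> ideal_gen ?H"
      by (intro ideal.span_sum ideal.span_base)
    then show "q \<in> ideal_gen ?H" by (simp add: sum_coeff_homog)
  qed
  show "ideal_gen ?H \<subseteq> homogeneous_core P"
    using is_ideal_homogeneous_core [OF assms] by (intro ideal.span_minimal) auto
qed

text \<open>If neither factor lies in the core, take the lowest components outside \<open>P\<close>,
  of degrees \<open>d\<close> and \<open>e\<close>. In degree \<open>d + e\<close> of the product,
  every summand but one contains a component below \<open>d\<close> or below \<open>e\<close>, which
  is in \<open>P\<close>.\<close>

lemma prime_ideal_homogeneous_core: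
  assumes "prime_ideal P" shows "prime_ideal (homogeneous_core P)"
  unfolding prime_ideal_def
proof (intro conjI allI impI)
  have id: "is_ideal P" using assms by (rule prime_idealD)
  show "is_ideal (homogeneous_core P)" by (rule is_ideal_homogeneous_core [OF id])
  show "1 \<notin> homogeneous_core P"
    using homogeneous_core_subset [OF id] assms by (auto simp: prime_ideal_def)
  fix a b assume ab: "a * b \<in> homogeneous_core P"
  show "a \<in> homogeneous_core P \<or> b \<in> homogeneous_core P"
  proof (rule ccontr)
    assume "\<not> ?thesis"
    then have ex: "\<exists>d. coeff (homog a) d \<notin> P" "\<exists>d. coeff (homog b) d \<notin> P"
      by (auto simp: homogeneous_core_def)
    define d where "d = (LEAST d. coeff (homog a) d \<notin> P)"
    define e where "e = (LEAST d. coeff (homog b) d \<notin> P)"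
    have d: "coeff (homog a) d \<notin> P" "\<And>i. i < d \<Longrightarrow> coeff (homog a) i \<in> P"
      unfolding d_def using LeastI_ex [OF ex(1)] not_less_Least by blast+
    have e: "coeff (homog b) e \<notin> P" "\<And>i. i < e \<Longrightarrow> coeff (homog b) i \<in> P"
      unfolding e_def using LeastI_ex [OF ex(2)] not_less_Least by blast+
    let ?f = "\<lambda>i. coeff (homog a) i * coeff (homog b) (d + e - i)"
    have "sum ?f {..d + e} \<in> P"
      using ab by (auto simp: homogeneous_core_def homog_mult coeff_mult)
    moreover have "sum ?f {..d + e} = ?f d + sum ?f ({..d + e} - {d})"
      by (rule sum.remove) auto
    moreover have "sum ?f ({..d + e} - {d}) \<in> P"
    proof (rule ideal.subspace_sum [OF id])
      fix i assume "i \<in> {..d + e} - {d}"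
      then consider "i < d" | "d + e - i < e" by force
      then show "?f i \<in> P"
        using d(2) e(2) ideal.subspace_scale [OF id] by cases (metis mult.commute, metis)
    qed
    ultimately have "?f d \<in> P"
      using ideal.subspace_diff [OF id] by fastforce
    then show False
      using assms d(1) e(1) by (auto simp: prime_ideal_def)
  qed
qed

text \<open>The set \<open>M\<close> of products of a power of \<open>l\<close> with an element
  outside \<open>P\<close> is multiplicative, and it misses the ideal because \<open>l\<close> is
  not a zero divisor modulo it. A prime missing \<open>M\<close> lies in \<open>P\<close> and omits
  \<open>l\<close>; its homogeneous core still contains the homogeneous generators.\<close>

lemma homogeneous_prime_below:
  fixes P :: "('v::finite, complex) mpoly set"
  assumes P: "prime_ideal P" and G: "\<And>g. g \<in> G \<Longrightarrow> \<exists>d. homogeneous d g" and GP: "ideal_gen G \<subseteq> P"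
    and l: "\<And>b. l * b \<in> ideal_gen G \<Longrightarrow> b \<in> ideal_gen G"
  obtains P' where "prime_ideal P'" "homogeneous_ideal P'" "ideal_gen G \<subseteq> P'" "P' \<subseteq> P" "l \<notin> P'"
proof -
  define M where "M = {l ^ n * b | n b. b \<notin> P}"
  have pow: "l ^ n * b \<in> ideal_gen G \<Longrightarrow> b \<in> ideal_gen G" for n b
    by (induction n) (use l in \<open>auto simp: mult.assoc\<close>)
  have "ideal_gen G \<inter> M = {}"
    using pow GP by (auto simp: M_def)
  moreover have "l ^ 0 * 1 \<in> M"
    using prime_idealD(2) [OF P] unfolding M_def by blast
  then have "1 \<in> M" by simp
  moreover have "a * b \<in> M" if "a \<in> M" "b \<in> M" for a b
  proof -
    from that obtain m n c d where ab: "a = l ^ m * c" "b = l ^ n * d" and "c \<notin> P" "d \<notin> P"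
      by (auto simp: M_def)
    then have "c * d \<notin> P"
      using prime_idealD(3) [OF P] by blast
    then have "l ^ (m + n) * (c * d) \<in> M"
      unfolding M_def by blast
    then show ?thesis
      by (simp only: ab power_add mult_ac)
  qed
  ultimately obtain Q where Q: "prime_ideal Q" "ideal_gen G \<subseteq> Q" "Q \<inter> M = {}"
    using prime_ideal_avoiding [OF ideal.subspace_span] by metis
  have id: "is_ideal Q" by (rule prime_idealD [OF Q(1)])
  have "l ^ 1 * 1 \<in> M"
    using prime_idealD(2) [OF P] unfolding M_def by blast
  then have "l \<in> M" by simp
  moreover have "b \<in> M" if "b \<notin> P" for b
  proof -
    have "l ^ 0 * b \<in> M"
      unfolding M_def using that by blast
    then show ?thesis by simp
  qed
  ultimately have "Q \<subseteq> P" "l \<notin> Q" using Q(3) by auto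
  moreover have "G \<subseteq> homogeneous_core Q"
    using Q(2) G homogeneous_in_core [OF id] ideal.span_base by blast
  then have "ideal_gen G \<subseteq> homogeneous_core Q"
    by (intro ideal.span_minimal is_ideal_homogeneous_core id)
  ultimately show ?thesis
    using that [of "homogeneous_core Q"] homogeneous_core_subset [OF id]
      prime_ideal_homogeneous_core [OF Q(1)] homogeneous_ideal_core [OF id] by blast
qed

section \<open>Chains in \<open>Proj\<close> and chains of primes\<close>

lemma prime_ideal_vanishing: "prime_ideal {q. peval q (x :: complex ^ 'v::finite) = 0}"
  by (auto simp: prime_ideal_def is_ideal_iff)

lemma homogeneous_prime_subset_irrelevant:
  assumes "prime_ideal P" "homogeneous_ideal P"
  shows "P \<subseteq> {q :: ('v::finite, complex) mpoly. peval q 0 = 0}"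
proof -
  have "is_ideal {q :: ('v, complex) mpoly. peval q 0 = 0}"
    by (rule prime_idealD [OF prime_ideal_vanishing])
  moreover have "peval q 0 = 0" if "q \<in> P" "homogeneous d q" for q d
  proof (cases "d = 0")
    case True
    then have "q = cst (lookup q 0)"
      using that by (intro poly_mapping_eqI)
        (auto simp: homogeneous_def cst_def lookup_single when_def mdegree_eq_0_iff in_keys_iff)
    with prime_ideal_cst [OF assms(1)] that(1) show ?thesis
      by (metis peval_simps(8))
  next
    case False
    with peval_homogeneous_smult [OF that(2), of 0 0] show ?thesis by (simp add: power_0_left)
  qed
  ultimately have "ideal_gen {q \<in> P. \<exists>d. homogeneous d q} \<subseteq> {q. peval q 0 = 0}"
    by (intro ideal.span_minimal) auto
  then show ?thesis
    using assms(2) by (simp add: homogeneous_ideal_def)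
qed

text \<open>The witness list is one longer than the chain: the irrelevant ideal sits strictly above
  the last prime, because that prime omits a variable. This accounts for the drop by one from the
  cone to the projective scheme.\<close>

lemma proj_chain_prime_chain:
  fixes P :: "nat \<Rightarrow> ('v::finite, complex) mpoly set"
  assumes "proj_chain I n P"
  shows "\<exists>as. prime_chain (P 0) as \<and> length as = Suc n"
proof -
  have P: "prime_ideal (P i)" "homogeneous_ideal (P i)" "\<not> range mvar \<subseteq> P i" if "i \<le> n" for i
    using assms that by (auto simp: proj_chain_def Proj_def)
  have "\<exists>as. prime_chain (P (n - i)) as \<and> length as = Suc i" if "i \<le> n" for i
    using that
  proof (induction i)
    case 0
    obtain k where "mvar k \<notin> P n" using P(3) [of n] by auto
    then have "prime_chain (P n) [mvar k]"
      using P(1) [of n] homogeneous_prime_subset_irrelevant [OF P(1,2), of n] prime_ideal_vanishing [of 0]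
      by (auto intro!: exI [of _ "{q. peval q 0 = 0}"])
    then show ?case by (intro exI [of _ "[mvar k]"]) auto
  next
    case (Suc i)
    then obtain as where as: "prime_chain (P (n - i)) as" "length as = Suc i" by auto
    have "P (n - Suc i) \<subset> P (Suc (n - Suc i))"
      using assms Suc.prems by (auto simp: proj_chain_def)
    also have "Suc (n - Suc i) = n - i" using Suc.prems by auto
    finally obtain a where "a \<in> P (n - i)" "a \<notin> P (n - Suc i)" "P (n - Suc i) \<subseteq> P (n - i)" by auto
    with as P(1) [of "n - Suc i"] have "prime_chain (P (n - Suc i)) (a # as)" by auto
    then show ?case using as(2) by (intro exI [of _ "a # as"]) auto
  qed
  from this [of n] show ?thesis by simp
qed

section \<open>Regular linear forms and chains through a closed point\<close>

lemma ideal_diff_mult: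
  assumes "is_ideal J" "a - a' \<in> J" "b - b' \<in> J" shows "a * b - a' * b' \<in> J"
proof -
  have "a * b - a' * b' = b * (a - a') + a' * (b - b')"
    by (simp add: algebra_simps)
  then show ?thesis
    using assms ideal.subspace_add [OF assms(1)] ideal.subspace_scale [OF assms(1)] by metis
qed

lemma (in eval_ring_hom) eval_diff_in_ideal:
  fixes s s' :: "'v::finite \<Rightarrow> 'b"
  assumes J: "is_ideal J" and "\<And>i. s i - s' i \<in> J"
  shows "poly_eval c s p - poly_eval c s' p \<in> J"
proof (induction p rule: mpoly_induct)
  case zero
  show ?case using J by (simp add: is_ideal_iff)
next
  case (add p m a)
  have pow: "s i ^ k - s' i ^ k \<in> J" for i k
    using ideal.subspace_0 [OF J] by (induction k) (auto intro: ideal_diff_mult [OF J assms(2)])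
  have "(\<Prod>i\<in>K. s i ^ lookup m i) - (\<Prod>i\<in>K. s' i ^ lookup m i) \<in> J" for K
    using ideal.subspace_0 [OF J]
    by (induction K rule: infinite_finite_induct) (auto intro: ideal_diff_mult [OF J pow])
  then have "c a * (mval s m - mval s' m) \<in> J"
    unfolding mval_def by (rule ideal.subspace_scale [OF J])
  from ideal.subspace_add [OF J add this] show ?case
    by (simp add: eval_add eval_single algebra_simps)
qed

text \<open>An order on the variables makes the polynomial ring a domain, and
  \<open>lin_nonzero_divisor\<close> cancels a factor in it.\<close>

locale square_relations_linorder = square_relations V r w
  for V :: "'v::{finite, linorder} set" and r :: "'v \<Rightarrow> ('v, complex) mpoly" and w :: "'v \<Rightarrow> nat"
begin

abbreviation I :: "('v, complex) mpoly set" where "I \<equiv> ideal_gen (rel ` V)"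

lemma homogeneous_rel: "i \<in> V \<Longrightarrow> homogeneous 2 (rel i)"
  unfolding rel_def
  by (intro homogeneous_diff homogeneous_r) (simp add: power2_eq_square homogeneous_mvar_mult)

lemma proj_dim_le: "proj_dim I \<le> enat (card (- V) - 1)"
  unfolding proj_dim_def
proof (rule SUP_least)
  fix n assume "n \<in> {n. \<exists>P. proj_chain I n P}"
  then obtain P where P: "proj_chain I n P" by auto
  then obtain as where as: "prime_chain (P 0) as" "length as = Suc n"
    using proj_chain_prime_chain by blast
  have "I \<subseteq> P 0"
    using P by (auto simp: proj_chain_def Proj_def)
  from prime_chain_length_le [OF as(1) this] as(2) show "enat n \<le> enat (card (- V) - 1)"
    by simp
qed

context
  fixes x :: "(complex, 'v) vec" and j0 :: 'v
  assumes zero: "\<And>i. i \<in> V \<Longrightarrow> peval (rel i) x = 0" and j0: "j0 \<notin> V" "x $ j0 \<noteq> 0"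
begin

text \<open>For \<open>j\<close> outside \<open>V\<close> these forms cut out the image of
  \<open>x\<close> in the projective space of the free coordinates.\<close>

definition lin :: "'v \<Rightarrow> ('v, complex) mpoly" where
  "lin j = cst (x $ j0) * mvar j - cst (x $ j) * mvar j0"

text \<open>The substitution that solves \<open>lin i = 0\<close> for \<open>i \<in> L\<close>; it
  realizes the quotient by these forms inside the polynomial ring.\<close>

definition restr :: "'v set \<Rightarrow> ('v, complex) mpoly \<Rightarrow> ('v, complex) mpoly" where
  "restr L = poly_eval cst (\<lambda>i. if i \<in> L then cst (x $ i / x $ j0) * mvar j0 else mvar i)"

lemma diff_restr: "p - restr L p \<in> ideal_gen (lin ` L)"
proof -
  have "mvar i - cst (x $ i / x $ j0) * mvar j0 \<in> ideal_gen (lin ` L)" if "i \<in> L" for i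
  proof -
    have "cst (1 / x $ j0) * lin i = mvar i - cst (x $ i / x $ j0) * mvar j0"
      using j0 by (simp add: lin_def right_diff_distrib flip: mult.assoc ecst.cmult)
    then show ?thesis
      using that by (metis ideal.span_base ideal.span_scale imageI)
  qed
  then have "poly_eval cst mvar p - restr L p \<in> ideal_gen (lin ` L)"
    unfolding restr_def by (intro ecst.eval_diff_in_ideal ideal.subspace_span) (auto simp: ideal.span_zero)
  then show ?thesis by (simp add: poly_eval_cst_mvar)
qed

lemma restr_lin: "j0 \<notin> L \<Longrightarrow> restr L (lin j) = (if j \<in> L then 0 else lin j)"
  using j0 by (simp add: restr_def lin_def ecst.eval_diff ecst.eval_simps flip: mult.assoc ecst.cmult)

lemma lin_nonzero: "j \<noteq> j0 \<Longrightarrow> lin j \<noteq> 0"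
proof
  assume "j \<noteq> j0" "lin j = 0"
  then have "peval (lin j) (axis j 1) = 0" by simp
  with \<open>j \<noteq> j0\<close> j0 show False by (simp add: lin_def axis_def)
qed

lemma nf_lin_mult:
  assumes "j \<notin> V" shows "nf (lin j * p) = lin j * nf p"
proof (rule nf_free_mult)
  have k: "keys (lin j) \<subseteq> {single j 1, single j0 1}"
    using keys_diff [of "cst (x $ j0) * mvar j" "cst (x $ j) * mvar j0"]
      keys_cst_mult [of "x $ j0" "mvar j"] keys_cst_mult [of "x $ j" "mvar j0"]
    by (auto simp: lin_def mvar_def)
  show "lookup t i = 0" if "t \<in> keys (lin j)" "i \<in> V" for t i
    using k that assms j0 by (auto simp: lookup_single when_def)
qed

lemma restr_nf_eq_0:
  assumes "L \<subseteq> - V" "j0 \<notin> L" "p \<in> ideal_gen (rel ` V \<union> lin ` L)"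
  shows "restr L (nf p) = 0"
  using assms(3)
proof (induction rule: ideal.span_induct_alt)
  case base
  show ?case by (simp add: restr_def)
next
  case (step c g y)
  have "restr L (nf (c * g)) = 0"
    using step(1)
  proof
    assume "g \<in> rel ` V"
    then show ?thesis by (auto simp: nf_rel_mult restr_def)
  next
    assume "g \<in> lin ` L"
    then obtain j where "j \<in> L" "g = lin j" by auto
    then have "restr L (nf (c * g)) = restr L (lin j) * restr L (nf c)"
      using assms(1) nf_lin_mult [of j c] by (auto simp: mult.commute [of c] restr_def ecst.eval_mult)
    then show ?thesis using restr_lin [OF assms(2)] \<open>j \<in> L\<close> by simp
  qed
  then show ?case using step(2) by (simp add: nf_add restr_def ecst.eval_add)
qed

text \<open>Membership in the ideal is detected by taking the normal form and then applying
  \<open>restr L\<close>. Both steps are compatible with multiplication by \<open>lin j\<close>,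
  which stays nonzero because \<open>j\<close> is not in \<open>L\<close>, so it can be cancelled in
  a domain.\<close>

lemma lin_nonzero_divisor:
  assumes L: "L \<subseteq> - V" "j0 \<notin> L" and j: "j \<notin> V" "j \<noteq> j0" "j \<notin> L"
    and b: "lin j * b \<in> ideal_gen (rel ` V \<union> lin ` L)"
  shows "b \<in> ideal_gen (rel ` V \<union> lin ` L)"
proof -
  have "restr L (lin j) * restr L (nf b) = 0"
    using restr_nf_eq_0 [OF L b] by (simp add: nf_lin_mult [OF j(1)] restr_def ecst.eval_mult)
  then have "restr L (nf b) = 0"
    using restr_lin [OF L(2), of j] j(3) lin_nonzero [OF j(2)] by simp
  with diff_restr [of "nf b" L] have "nf b \<in> ideal_gen (lin ` L)" by simp
  then have "nf b \<in> ideal_gen (rel ` V \<union> lin ` L)"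
    using ideal.span_mono [of "lin ` L" "rel ` V \<union> lin ` L"] by auto
  moreover have "b - nf b \<in> ideal_gen (rel ` V \<union> lin ` L)"
    using diff_nf_in_ideal ideal.span_mono [of "rel ` V" "rel ` V \<union> lin ` L"] by auto
  ultimately show ?thesis
    using ideal.span_add by fastforce
qed

lemma homogeneous_lin: "homogeneous 1 (lin j)"
  unfolding lin_def by (intro homogeneous_diff homogeneous_cst_mult homogeneous_mvar)

text \<open>Each linear form is worth one step: the regular form \<open>lin j\<close> yields a
  homogeneous prime strictly below \<open>P\<close> that still contains the remaining generators. As
  \<open>mvar j0\<close> is outside \<open>P\<close>, it is outside all smaller primes, which
  therefore stay relevant.\<close>

lemma chain_below:
  assumes "finite L" "L \<subseteq> - V" "j0 \<notin> L" "prime_ideal P" "homogeneous_ideal P" "mvar j0 \<notin> P"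
    and "ideal_gen (rel ` V \<union> lin ` L) \<subseteq> P"
  shows "\<exists>Q. proj_chain I (card L) Q \<and> Q (card L) = P"
  using assms
proof (induction L arbitrary: P)
  case empty
  then show ?case
    by (intro exI [of _ "\<lambda>_. P"]) (auto simp: proj_chain_def Proj_def)
next
  case (insert j L)
  let ?G = "rel ` V \<union> lin ` L"
  have sub: "ideal_gen ?G \<subseteq> P"
    using insert.prems(6) ideal.span_mono [of ?G "rel ` V \<union> lin ` insert j L"] by auto
  have linP: "lin j \<in> P"
    using insert.prems(6) ideal.span_base [of "lin j" "rel ` V \<union> lin ` insert j L"] by auto
  obtain P' where P': "prime_ideal P'" "homogeneous_ideal P'" "ideal_gen ?G \<subseteq> P'" "P' \<subseteq> P" "lin j \<notin> P'"
  proof (rule homogeneous_prime_below [OF insert.prems(3) _ sub])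
    show "\<exists>d. homogeneous d g" if "g \<in> ?G" for g
      using that homogeneous_rel homogeneous_lin by blast
    show "b \<in> ideal_gen ?G" if "lin j * b \<in> ideal_gen ?G" for b
      using that insert.prems insert.hyps by (intro lin_nonzero_divisor [of L j b]) auto
  qed
  obtain Q where Q: "proj_chain I (card L) Q" "Q (card L) = P'"
    using insert.IH [of P'] insert.prems P' by auto
  have "P' \<subset> P" using P'(4,5) linP by blast
  moreover have "P \<in> Proj I"
  proof -
    have "\<not> range mvar \<subseteq> P"
      using insert.prems(5) by blast
    then show ?thesis
      using insert.prems sub ideal.span_mono [of "rel ` V" ?G] by (auto simp: Proj_def)
  qed
  ultimately have "proj_chain I (Suc (card L)) (Q(Suc (card L) := P))"
    using Q by (auto simp: proj_chain_def less_Suc_eq le_Suc_eq)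
  then show ?case
    unfolding card_insert_disjoint [OF insert.hyps(1,2)]
    by (intro exI [of _ "Q(Suc (card L) := P)"] conjI fun_upd_same)
qed

text \<open>The chain ends at the homogeneous ideal of the point itself, which contains one linear
  form for each free variable other than \<open>j0\<close>.\<close>

lemma local_dim_ge: "enat (card (- V) - 1) \<le> local_dim I (proj_pt x)"
proof -
  define P where "P = homogeneous_core {q. peval q x = 0}"
  let ?L = "- V - {j0}"
  have id: "is_ideal {q. peval q x = 0}"
    by (rule prime_idealD [OF prime_ideal_vanishing])
  have Px: "P \<subseteq> {q. peval q x = 0}"
    unfolding P_def by (rule homogeneous_core_subset [OF id])
  have "rel ` V \<union> lin ` ?L \<subseteq> P"
    unfolding P_def using homogeneous_rel homogeneous_lin zero
    by (auto intro!: homogeneous_in_core [OF id]) (simp add: lin_def)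
  then have "ideal_gen (rel ` V \<union> lin ` ?L) \<subseteq> P"
    unfolding P_def by (intro ideal.span_minimal is_ideal_homogeneous_core id)
  moreover have "mvar j0 \<notin> P"
    using Px j0 by auto
  moreover have "prime_ideal P" "homogeneous_ideal P"
    unfolding P_def
    by (rule prime_ideal_homogeneous_core [OF prime_ideal_vanishing]) (rule homogeneous_ideal_core [OF id])
  ultimately obtain Q where Q: "proj_chain I (card ?L) Q" "Q (card ?L) = P"
    using chain_below [of ?L P] by auto
  have "vanishes_at q (proj_pt x)" if "q \<in> P" for q
  proof -
    have "peval (coeff (homog q) d) x = 0" for d
      using that by (auto simp: P_def homogeneous_core_def)
    then have "peval (coeff (homog q) d) (c *s x) = 0" for c d
      using peval_homogeneous_smult [OF homogeneous_coeff_homog [of d q], of c x] by simp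
    then have "peval (\<Sum>d\<le>degree (homog q). coeff (homog q) d) (c *s x) = 0" for c
      by (simp only: peval_sum sum.neutral_const)
    then show ?thesis
      by (auto simp: vanishes_at_def proj_pt_def sum_coeff_homog)
  qed
  with Q have "enat (card ?L) \<le> local_dim I (proj_pt x)"
    unfolding local_dim_def by (intro SUP_upper) auto
  then show ?thesis
    using j0 by (simp add: card_Diff_singleton)
qed

end

lemma local_dim_le: "local_dim I z \<le> proj_dim I"
  unfolding local_dim_def proj_dim_def by (rule SUP_subset_mono) auto

end

section \<open>Arithmetic of residues modulo 8\<close>

lemma UNIV_8: "(UNIV :: 8 set) = {0, 1, 2, 3, 4, 5, 6, 7}"
proof -
  have "card {0, 1, 2, 3, 4, 5, 6, 7 :: 8} = 8" by simp
  then have "card {0, 1, 2, 3, 4, 5, 6, 7 :: 8} = CARD(8)" by simp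
  then show ?thesis by (metis card_subset_eq finite subset_UNIV)
qed

lemma exhaust_8: "i = 0 \<or> i = 1 \<or> i = 2 \<or> i = 3 \<or> i = 4 \<or> i = 5 \<or> i = 6 \<or> i = 7" for i :: 8
proof -
  have "i \<in> {0, 1, 2, 3, 4, 5, 6, 7}"
    unfolding UNIV_8 [symmetric] by (rule UNIV_I)
  then show ?thesis
    unfolding insert_iff empty_iff by (simp only: simp_thms)
qed

lemma all_8: "(\<forall>i::8. P i) \<longleftrightarrow> P 0 \<and> P 1 \<and> P 2 \<and> P 3 \<and> P 4 \<and> P 5 \<and> P 6 \<and> P 7"
proof -
  have "(\<forall>i::8. P i) \<longleftrightarrow> (\<forall>i\<in>{0, 1, 2, 3, 4, 5, 6, 7}. P i)"
    unfolding UNIV_8 [symmetric] by simp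
  then show ?thesis by simp
qed

lemma sum_8: "(\<Sum>i\<in>UNIV. f i) = f 0 + f 1 + f 2 + f 3 + f 4 + f 5 + f 6 + f (7 :: 8)"
  unfolding UNIV_8 by (simp add: add.assoc)

lemma minus_numerals_8:
  "- 1 = (7 :: 8)" "- 2 = (6 :: 8)" "- 3 = (5 :: 8)" "- 4 = (4 :: 8)" "- 5 = (3 :: 8)" "- 6 = (2 :: 8)" "- 7 = (1 :: 8)"
  by simp_all

lemma numerals_8: "8 = (0 :: 8)" "9 = (1 :: 8)" "10 = (2 :: 8)" "11 = (3 :: 8)" "12 = (4 :: 8)" "13 = (5 :: 8)" "14 = (6 :: 8)" "15 = (7 :: 8)"
  "20 = (4 :: 8)" "24 = (0 :: 8)" "28 = (4 :: 8)"
  by simp_all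

section \<open>The Heisenberg group\<close>

lemma xi_power_4: "xi ^ 4 = - 1"
proof -
  have "xi ^ 4 = exp (of_real pi * \<i>)"
    unfolding xi_def by (subst exp_of_nat_mult [symmetric]) simp
  then show ?thesis by simp
qed

lemma xi_nonzero [simp]: "xi \<noteq> 0"
  by (simp add: xi_def)

text \<open>The faithful character of the residues modulo 8. With all scalars written as values of
  \<open>chi\<close>, group computations become arithmetic of residues.\<close>

definition chi :: "8 \<Rightarrow> complex" where
  "chi i = xi powi Rep_bit0 i"

lemma xi_powi_mod_8: "xi powi (n mod 8) = xi powi n"
proof -
  have "xi powi 8 = (xi ^ 4) ^ 2"
    by (simp flip: power_mult)
  then have "xi powi 8 = 1"
    by (simp add: xi_power_4)
  then have "xi powi (8 * (n div 8)) = 1"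
    by (simp only: power_int_mult power_int_1_left)
  moreover have "xi powi (8 * (n div 8) + n mod 8) = xi powi (8 * (n div 8)) * xi powi (n mod 8)"
    by (rule power_int_add) simp
  ultimately show ?thesis by simp
qed

lemma chi_add: "chi (i + j) = chi i * chi j"
proof -
  have "Rep_bit0 (i + j) = (Rep_bit0 i + Rep_bit0 j) mod 8"
    by (simp add: plus_bit0_def Abs_bit0'_code)
  then show ?thesis
    by (simp add: chi_def xi_powi_mod_8 power_int_add)
qed

lemma chi_0 [simp]: "chi 0 = 1"
  by (simp add: chi_def bit0.Rep_0)

lemma chi_nonzero [simp]: "chi i \<noteq> 0"
  by (simp add: chi_def)

lemma chi_uminus: "chi (- i) = inverse (chi i)"
  using chi_add [of i "- i"] by (simp add: field_simps)

lemma chi_4: "chi 4 = - 1"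
  using xi_power_4 by (simp add: chi_def bit0.Rep_numeral)

lemma chi_eq_1_iff: "chi i = 1 \<longleftrightarrow> i = 0"
proof
  assume i: "chi i = 1"
  then have "chi (i + i) = 1" "chi (i + i + (i + i)) = 1"
    using chi_add [of i i] chi_add [of "i + i" "i + i"] by simp_all
  with i exhaust_8 [of i] chi_4 show "i = 0" by (auto simp: numerals_8)
qed simp

text \<open>Every element of the Heisenberg group is a scalar times a diagonal character times a
  shift. In \<open>act_act\<close> the parameters add, apart from the term \<open>- b' * a\<close>,
  which records the commutator of shifts and characters.\<close>

definition act :: "8 \<Rightarrow> 8 \<Rightarrow> 8 \<Rightarrow> complex ^ 8 \<Rightarrow> complex ^ 8" where
  "act c b a x = (\<chi> i. chi (c + b * i) * x $ (i - a))"

lemma act_nth [simp]: "act c b a x $ i = chi (c + b * i) * x $ (i - a)"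
  by (simp add: act_def)

lemma act_act: "act c b a (act c' b' a' x) = act (c + c' - b' * a) (b + b') (a + a') x"
proof (rule vec_eq_iff [THEN iffD2], rule allI)
  fix i
  have "c + b * i + (c' + b' * (i - a)) = c + c' - b' * a + (b + b') * i"
    by (simp add: algebra_simps)
  then have "chi (c + b * i) * chi (c' + b' * (i - a)) = chi (c + c' - b' * a + (b + b') * i)"
    by (simp only: chi_add [symmetric])
  moreover have "i - a - a' = i - (a + a')"
    by (simp add: algebra_simps)
  ultimately show "act c b a (act c' b' a' x) $ i = act (c + c' - b' * a) (b + b') (a + a') x $ i"
    by (simp only: act_nth mult.assoc [symmetric])
qed

lemma act_0: "act 0 0 0 x = x"
  by (simp add: vec_eq_iff)

lemma sigma_act: "sigma = act 0 0 1"
  by (simp add: fun_eq_iff sigma_def vec_eq_iff)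

lemma tau_act: "tau = act 0 (- 1) 0"
proof -
  have "xi powi (- Rep_bit0 i) = chi (- i)" for i :: 8
    unfolding chi_uminus by (simp add: chi_def power_int_minus)
  then show ?thesis
    by (simp add: fun_eq_iff tau_def vec_eq_iff)
qed

lemma act_inverse:
  "act c b a (act (- c - b * a) (- b) (- a) x) = x"
  "act (- c - b * a) (- b) (- a) (act c b a x) = x"
  by (simp_all add: act_act act_0 algebra_simps)

lemma bij_act: "act c b a \<in> Bij UNIV"
  unfolding Bij_def using act_inverse [of c b a]
  by (auto intro!: bij_betw_byWitness [where f' = "act (- c - b * a) (- b) (- a)"])

lemma BijGroup_UNIV_simps:
  "f \<in> Bij UNIV \<Longrightarrow> g \<in> Bij UNIV \<Longrightarrow> f \<otimes>\<^bsub>BijGroup UNIV\<^esub> g = f \<circ> g"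
  "\<one>\<^bsub>BijGroup UNIV\<^esub> = id" "carrier (BijGroup UNIV) = Bij UNIV"
  by (auto simp: BijGroup_def compose_def fun_eq_iff)

lemma inv_act: "inv\<^bsub>BijGroup UNIV\<^esub> (act c b a) = act (- c - b * a) (- b) (- a)"
proof -
  interpret B: Group.group "BijGroup (UNIV :: (complex ^ 8) set)"
    by (rule group_BijGroup)
  show ?thesis
    by (rule B.inv_equality) (auto simp: BijGroup_UNIV_simps bij_act fun_eq_iff act_inverse)
qed

text \<open>Reduces statements about a generated group to closure of a set of parameter triples
  under the composition and inversion rules of \<open>act\<close>.\<close>

lemma generate_act:
  assumes h: "h \<in> generate (BijGroup UNIV) S"
    and S: "\<And>h. h \<in> S \<Longrightarrow> \<exists>(c, b, a)\<in>D. h = act c b a"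
    and D: "(0, 0, 0) \<in> D" "\<And>c b a. (c, b, a) \<in> D \<Longrightarrow> (- c - b * a, - b, - a) \<in> D"
      "\<And>c b a c' b' a'. (c, b, a) \<in> D \<Longrightarrow> (c', b', a') \<in> D \<Longrightarrow> (c + c' - b' * a, b + b', a + a') \<in> D"
  shows "\<exists>(c, b, a)\<in>D. h = act c b a"
  using h
proof (induction rule: generate.induct)
  case one
  show ?case
    using D(1) by (intro bexI [of _ "(0, 0, 0)"]) (auto simp: BijGroup_UNIV_simps fun_eq_iff act_0)
next
  case (incl h)
  then show ?case by (rule S)
next
  case (inv h)
  from S [OF this] obtain c b a where "(c, b, a) \<in> D" "h = act c b a" by blast
  then show ?case
    using D(2) by (intro bexI [of _ "(- c - b * a, - b, - a)"]) (auto simp: inv_act)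
next
  case (eng h1 h2)
  then obtain c b a c' b' a' where *: "(c, b, a) \<in> D" "h1 = act c b a" "(c', b', a') \<in> D" "h2 = act c' b' a'"
    by blast
  have "h1 \<otimes>\<^bsub>BijGroup UNIV\<^esub> h2 = act (c + c' - b' * a) (b + b') (a + a')"
    unfolding *(2,4) BijGroup_UNIV_simps(1) [OF bij_act bij_act] by (rule ext) (simp add: act_act)
  then show ?case
    using D(3) [OF *(1,3)] by (intro bexI [of _ "(c + c' - b' * a, b + b', a + a')"]) simp
qed

lemma H8_act: "h \<in> H8 \<Longrightarrow> \<exists>c b a. h = act c b a"
  using generate_act [of h "{sigma, tau}" UNIV] unfolding H8_def by (auto simp: sigma_act tau_act)

lemma funpow_act:
  assumes "b = 0 \<or> a = 0" shows "act 0 b a ^^ n = act 0 (of_nat n * b) (of_nat n * a)"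
proof (induction n)
  case 0
  show ?case by (simp add: fun_eq_iff act_0)
next
  case (Suc n)
  have "act 0 b a (act 0 (of_nat n * b) (of_nat n * a) x) = act 0 (of_nat (Suc n) * b) (of_nat (Suc n) * a) x" for x
    unfolding act_act using assms by (auto simp: distrib_right)
  then show ?case by (simp add: fun_eq_iff Suc)
qed

lemma sigma_4_act: "sigma ^^ 4 = act 0 0 4"
  using funpow_act [of 0 1 4] by (simp add: sigma_act)

lemma tau_4_act: "tau ^^ 4 = act 0 4 0"
  using funpow_act [of "- 1" 0 4] by (simp add: tau_act minus_numerals_8 numerals_8)

text \<open>For parameters in \<open>{0, 4}\<close> the commutator term is a multiple of 16, hence
  zero modulo 8, so no scalars arise.\<close>

lemma H'_act: "h \<in> H' \<Longrightarrow> \<exists>b\<in>{0, 4}. \<exists>a\<in>{0, 4}. h = act 0 b a"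
proof -
  assume h: "h \<in> H'"
  have "\<exists>(c, b, a)\<in>{0} \<times> {0, 4} \<times> {0, 4}. h = act c b a"
  proof (rule generate_act [OF h [unfolded H'_def]])
    show "\<exists>(c, b, a)\<in>{0} \<times> {0, 4} \<times> {0, 4}. h = act c b a" if "h \<in> {sigma ^^ 4, tau ^^ 4}" for h
      using that by (simp add: sigma_4_act tau_4_act) blast
    show "(- c - b * a, - b, - a) \<in> {0} \<times> {0, 4} \<times> {0, 4}" if "(c, b, a) \<in> {0} \<times> {0, 4} \<times> {0, 4}" for c b a :: 8
      using that by fastforce
    show "(c + c' - b' * a, b + b', a + a') \<in> {0} \<times> {0, 4} \<times> {0, 4}"
      if "(c, b, a) \<in> {0} \<times> {0, 4} \<times> {0, 4}" "(c', b', a') \<in> {0} \<times> {0, 4} \<times> {0, 4}" for c b a c' b' a' :: 8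
      using that by fastforce
  qed simp
  then show ?thesis by auto
qed

text \<open>The scalar \<open>c\<close> is left unspecified, since it has no effect on projective
  points.\<close>

lemma act_in_H8: "\<exists>c. act c b a \<in> H8"
proof -
  have mult: "act (c + c' - b' * a) (b + b') (a + a') \<in> H8"
    if "act c b a \<in> H8" "act c' b' a' \<in> H8" for a b c a' b' c'
    using generate.eng [OF that [unfolded H8_def]]
    by (simp add: H8_def BijGroup_UNIV_simps bij_act fun_eq_iff act_act comp_def)
  have s: "act 0 0 1 \<in> H8" and t: "act 0 (- 1) 0 \<in> H8"
    using generate.incl [of _ "{sigma, tau}"] by (auto simp: H8_def sigma_act tau_act)
  have "id \<in> H8"
    using generate.one [of "BijGroup UNIV"] by (simp add: H8_def BijGroup_UNIV_simps)
  then have "act 0 0 0 \<in> H8"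
    by (simp add: id_def act_0 [abs_def])
  have 1: "act 0 0 (of_nat n) \<in> H8" for n
  proof (induction n)
    case (Suc n)
    from mult [OF s this] show ?case by simp
  qed (simp add: \<open>act 0 0 0 \<in> H8\<close>)
  have 2: "act 0 (- of_nat n) 0 \<in> H8" for n
  proof (induction n)
    case (Suc n)
    from mult [OF t this] show ?case by simp
  qed (simp add: \<open>act 0 0 0 \<in> H8\<close>)
  from mult [OF 2 1]
  have "act 0 (- of_nat (nat (Rep_bit0 (- b)))) (of_nat (nat (Rep_bit0 a))) \<in> H8"
    by (metis add_0 add.right_neutral diff_zero mult_zero_left mult_zero_right)
  moreover have "of_nat (nat (Rep_bit0 i)) = i" for i :: 8
    using exhaust_8 [of i] by (auto simp: bit0.Rep_numeral bit0.Rep_0 bit0.Rep_1)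
  ultimately show ?thesis by auto
qed

lemma sum_chi_mult: "(\<Sum>b\<in>UNIV. chi (b * r)) = (if r = 0 then 8 else 0)"
proof (cases "r = 0")
  case False
  have "(\<Sum>b\<in>UNIV. chi (b * r)) = (\<Sum>b\<in>UNIV. chi ((b + 1) * r))"
    by (rule sum.reindex_bij_witness [of _ "\<lambda>b. b + 1" "\<lambda>b. b - 1"]) auto
  also have "\<dots> = chi r * (\<Sum>b\<in>UNIV. chi (b * r))"
    unfolding sum_distrib_left by (intro sum.cong refl) (simp only: distrib_right mult_1_left chi_add, rule mult.commute)
  finally have "(1 - chi r) * (\<Sum>b\<in>UNIV. chi (b * r)) = 0"
    by (simp add: left_diff_distrib)
  then show ?thesis using False chi_eq_1_iff [of r] by auto
qed simp

section \<open>The quadrics\<close>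

text \<open>\<open>qform p q s t k\<close> is the image of \<open>p f\<^sub>0 - q f\<^sub>1 + s f\<^sub>2\<close> under \<open>\<sigma>\<^sup>k\<close>, evaluated at \<open>t\<close>.\<close>

definition qform :: "'b::comm_ring_1 \<Rightarrow> 'b \<Rightarrow> 'b \<Rightarrow> (8 \<Rightarrow> 'b) \<Rightarrow> 8 \<Rightarrow> 'b" where
  "qform p q s t k = p * (t (- k) ^ 2 + t (4 - k) ^ 2)
     - q * (t (1 - k) * t (7 - k) + t (3 - k) * t (5 - k)) + s * (t (2 - k) * t (6 - k))"

text \<open>All five monomials have indices summing to \<open>- (k + k)\<close>, so the diagonal
  part multiplies them by one common factor, while the shift only moves \<open>k\<close>.\<close>

lemma qform_act:
  assumes "\<And>i j. i + j = - (k + k) \<Longrightarrow> e i * e j = E"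
  shows "qform p q s (\<lambda>i. e i * t (i - a)) k = E * qform p q s t (k + a)"
proof -
  have m: "e i * t (i - a) * (e j * t (j - a)) = E * (t (i - a) * t (j - a))" if "i + j = - (k + k)" for i j
    using assms [OF that] by (metis mult.assoc mult.left_commute)
  have eqs: "- k + - k = - (k + k)" "4 - k + (4 - k) = - (k + k)" "1 - k + (7 - k) = - (k + k)"
    "3 - k + (5 - k) = - (k + k)" "2 - k + (6 - k) = - (k + k)"
    by (simp_all add: algebra_simps)
  have idx: "- k - a = - (k + a)" "n - k - a = n - (k + a)" for n
    by (simp_all add: algebra_simps)
  show ?thesis
    unfolding qform_def power2_eq_square unfolding eqs [THEN m] unfolding idx
    by (simp only: distrib_left right_diff_distrib mult.left_commute [of E])
qed

lemma qform_add_4: "qform p q s t (k + 4) = qform p q s t k"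
proof -
  have eqs: "- (k + 4) = 4 - k" "4 - (k + 4) = - k" "1 - (k + 4) = 5 - k" "7 - (k + 4) = 3 - k"
    "3 - (k + 4) = 7 - k" "5 - (k + 4) = 1 - k" "2 - (k + 4) = 6 - k" "6 - (k + 4) = 2 - k"
    by (simp_all add: algebra_simps)
  show ?thesis unfolding qform_def eqs by (simp only: add.commute mult.commute)
qed

definition par_p :: "complex ^ 8 \<Rightarrow> complex" where "par_p y = y $ 1 * y $ 3"
definition par_q :: "complex ^ 8 \<Rightarrow> complex" where "par_q y = (y $ 2)\<^sup>2"
definition par_s :: "complex ^ 8 \<Rightarrow> complex" where "par_s y = (y $ 1)\<^sup>2 + (y $ 3)\<^sup>2"

definition quad :: "complex ^ 8 \<Rightarrow> 8 \<Rightarrow> (8, complex) mpoly" where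
  "quad y = qform (cst (par_p y)) (cst (par_q y)) (cst (par_s y)) mvar"

lemma (in eval_ring_hom) eval_qform:
  fixes s :: "'v::finite \<Rightarrow> 'b"
  shows "poly_eval c s (qform p q r t k) = qform (poly_eval c s p) (poly_eval c s q) (poly_eval c s r) (\<lambda>i. poly_eval c s (t i)) k"
  by (simp add: qform_def eval_simps eval_diff)

lemma peval_quad: "peval (quad y k) x = qform (par_p y) (par_q y) (par_s y) (\<lambda>i. x $ i) k"
  unfolding quad_def peval_def by (simp add: eid.eval_qform eid.eval_simps)

lemma homogeneous_quad: "homogeneous 2 (quad y k)"
  unfolding quad_def qform_def power2_eq_square
  by (intro homogeneous_add homogeneous_diff homogeneous_cst_mult homogeneous_mvar_mult)

lemma peval_quad_act: "peval (quad y k) (act c b a x) = chi (c + c - b * (k + k)) * peval (quad y (k + a)) x"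
proof -
  have "chi (c + b * i) * chi (c + b * j) = chi (c + c - b * (k + k))" if "i + j = - (k + k)" for i j
  proof -
    have "c + b * i + (c + b * j) = c + c + b * (i + j)"
      by (simp add: algebra_simps)
    then show ?thesis
      by (simp add: that flip: chi_add)
  qed
  then show ?thesis
    unfolding peval_quad act_nth by (rule qform_act)
qed

lemma iota_minus_nth:
  assumes "y \<in> iota_minus"
  shows "y $ 0 = 0" "y $ 4 = 0" "y $ 5 = - y $ 3" "y $ 6 = - y $ 2" "y $ 7 = - y $ 1"
proof -
  have "y $ (- i) = - y $ i" for i
    using assms by (simp add: iota_minus_def iota_def vec_eq_iff)
  from this [of 0] this [of 4] this [of 3] this [of 2] this [of 1]
  show "y $ 0 = 0" "y $ 4 = 0" "y $ 5 = - y $ 3" "y $ 6 = - y $ 2" "y $ 7 = - y $ 1"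
    by (auto simp: minus_numerals_8)
qed

text \<open>Inserting the antisymmetry of \<open>y\<close> leaves \<open>q s - s q\<close>,
  \<open>p s - s p\<close> or \<open>2 p q - 2 q p\<close>; this is the reason for the coefficients
  of \<open>f\<close>.\<close>

lemma peval_quad_self: "y \<in> iota_minus \<Longrightarrow> peval (quad y k) y = 0"
  using exhaust_8 [of k]
  by (auto simp: peval_quad qform_def par_p_def par_q_def par_s_def iota_minus_nth minus_numerals_8
      numerals_8 power2_eq_square algebra_simps)

lemma H'_invariant_iff:
  "H'_invariant q \<longleftrightarrow> (\<forall>b\<in>{0, 4}. \<forall>a\<in>{0, 4}. \<forall>x. peval q (act 0 b a x) = peval q x)"
proof
  have *: "act 0 0 4 \<in> H'" "act 0 4 0 \<in> H'"
    using generate.incl [of _ "{sigma ^^ 4, tau ^^ 4}"] by (auto simp: H'_def sigma_4_act tau_4_act)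
  have "act 0 4 4 = act 0 4 0 \<circ> act 0 0 4"
    by (simp add: fun_eq_iff act_act)
  also have "\<dots> = act 0 4 0 \<otimes>\<^bsub>BijGroup UNIV\<^esub> act 0 0 4"
    by (simp add: BijGroup_UNIV_simps bij_act)
  also have "\<dots> \<in> H'"
    using * unfolding H'_def by (intro generate.eng)
  finally have "act 0 4 4 \<in> H'" .
  moreover assume "H'_invariant q"
  ultimately show "\<forall>b\<in>{0, 4}. \<forall>a\<in>{0, 4}. \<forall>x. peval q (act 0 b a x) = peval q x"
    using * by (auto simp: H'_invariant_def act_0)
next
  assume "\<forall>b\<in>{0, 4}. \<forall>a\<in>{0, 4}. \<forall>x. peval q (act 0 b a x) = peval q x"
  then show "H'_invariant q"
    unfolding H'_invariant_def using H'_act by metis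
qed

lemma quad_in_V8_quadrics:
  assumes "y \<in> iota_minus" shows "quad y k \<in> V8_quadrics (proj_pt y)"
proof -
  have add4: "quad y (k + 4) = quad y k"
    by (simp add: quad_def qform_add_4)
  have "4 * (k + k) = (0 :: 8)"
    using exhaust_8 [of k] by auto
  then have "H'_invariant (quad y k)"
    unfolding H'_invariant_iff by (auto simp: peval_quad_act add4)
  moreover have "vanishes_at (quad y k) z" if "z \<in> H8_orbit (proj_pt y)" for z
  proof -
    from that obtain h where "h \<in> H8" "z = h ` proj_pt y"
      by (auto simp: H8_orbit_def)
    moreover from H8_act [OF this(1)] obtain c b a where "h = act c b a" by blast
    ultimately show ?thesis
      using peval_quad_self [OF assms]
      by (auto simp: vanishes_at_def proj_pt_def peval_quad_act peval_homogeneous_smult [OF homogeneous_quad])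
  qed
  ultimately show ?thesis
    by (simp add: V8_quadrics_def homogeneous_quad)
qed

section \<open>Quadrics as symmetric matrices\<close>

lemma sum_delta_delta:
  "(\<Sum>a\<in>UNIV. \<Sum>b\<in>UNIV. if a = i then if b = j then x else 0 else 0) = x" for i j :: "'v::finite"
proof -
  have "(\<Sum>a\<in>UNIV. \<Sum>b\<in>UNIV. if a = i then if b = j then x else 0 else 0)
    = (\<Sum>a\<in>UNIV. if a = i then \<Sum>b\<in>UNIV. if b = j then x else 0 else 0)"
    by (intro sum.cong) auto
  then show ?thesis by simp
qed

lemma homogeneous_2_matrix:
  fixes q :: "('v::finite, complex) mpoly"
  assumes "homogeneous 2 q"
  shows "\<exists>S. (\<forall>i j. S i j = S j i) \<and> q = (\<Sum>i\<in>UNIV. \<Sum>j\<in>UNIV. cst (S i j) * (mvar i * mvar j))"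
    (is "?P q")
proof -
  have add: "?P (p + q)" if "?P p" "?P q" for p q :: "('v, complex) mpoly"
  proof -
    from that obtain S T where "\<forall>i j. S i j = S j i" "p = (\<Sum>i\<in>UNIV. \<Sum>j\<in>UNIV. cst (S i j) * (mvar i * mvar j))"
      "\<forall>i j. T i j = T j i" "q = (\<Sum>i\<in>UNIV. \<Sum>j\<in>UNIV. cst (T i j) * (mvar i * mvar j))" by blast
    then show ?thesis
      by (intro exI [of _ "\<lambda>i j. S i j + T i j"]) (simp add: ecst.cadd distrib_right sum.distrib)
  qed
  have single: "?P (single m a)" if "mdegree m = 2" for m :: "'v \<Rightarrow>\<^sub>0 nat" and a
  proof -
    have split: "\<exists>i n. m = single i 1 + n \<and> mdegree m = Suc (mdegree n)"
      if "mdegree m \<noteq> 0" for m :: "'v \<Rightarrow>\<^sub>0 nat"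
    proof -
      from that obtain i where "lookup m i \<noteq> 0"
        by (auto simp: mdegree_UNIV)
      then have m: "m = single i 1 + (m - single i 1)"
        by (intro poly_mapping_eqI) (auto simp: lookup_add lookup_minus lookup_single when_def)
      then have "mdegree m = Suc (mdegree (m - single i 1))"
        by (metis mdegree_add mdegree_single plus_1_eq_Suc)
      with m show ?thesis by blast
    qed
    obtain i n where n: "m = single i 1 + n" "mdegree n = 1"
      using split [of m] \<open>mdegree m = 2\<close> by auto
    obtain j l where "n = single j 1 + l" "mdegree l = 0"
      using split [of n] n(2) by auto
    with n have "m = single i 1 + single j 1"
      by (simp add: mdegree_eq_0_iff)
    then have s: "single m a = cst a * (mvar i * mvar j)"
      by (simp add: mvar_def mult_single cst_mult_single)
    \<comment> \<open>Half of the coefficient goes to \<open>(i, j)\<close> and half to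
      \<open>(j, i)\<close>; for \<open>i = j\<close> both halves add up at the same entry.\<close>
    define S where "S b c = (if b = i then if c = j then a / 2 else 0 else 0)
      + (if b = j then if c = i then a / 2 else 0 else 0)" for b c
    have "cst (S b c) * (mvar b * mvar c)
      = (if b = i then if c = j then cst (a / 2) * (mvar i * mvar j) else 0 else 0)
      + (if b = j then if c = i then cst (a / 2) * (mvar i * mvar j :: ('v, complex) mpoly) else 0 else 0)" for b c
      by (auto simp: S_def ecst.cadd mult.commute distrib_left)
    moreover have "cst (a / 2) * (mvar i * mvar j) + cst (a / 2) * (mvar i * mvar j) = (single m a :: ('v, complex) mpoly)"
      unfolding s by (simp flip: distrib_right ecst.cadd)
    ultimately have "single m a = (\<Sum>b\<in>UNIV. \<Sum>c\<in>UNIV. cst (S b c) * (mvar b * mvar c :: ('v, complex) mpoly))"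
      by (simp only: sum.distrib sum_delta_delta)
    then show ?thesis
      by (intro exI [of _ S]) (auto simp: S_def)
  qed
  have zero: "?P 0"
    by (intro exI [of _ "\<lambda>_ _. 0"]) simp
  have "?P (\<Sum>m\<in>K. single m (f m))" if "finite K" "\<forall>m\<in>K. mdegree m = 2" for K and f :: "_ \<Rightarrow> complex"
    using that
  proof (induction K)
    case (insert m K)
    then have "?P (single m (f m))" "?P (\<Sum>m\<in>K. single m (f m))"
      using single by auto
    from add [OF this] insert.hyps show ?case by simp
  qed (use zero in simp)
  from this [of "keys q" "lookup q"] assms show ?thesis
    by (simp add: homogeneous_def flip: mpoly_sum_single)
qed

text \<open>Polarization at pairs of basis vectors recovers the entries, as 2 is invertible.\<close>

lemma symmetric_form_eqD:
  fixes S T :: "'v::finite \<Rightarrow> 'v \<Rightarrow> complex"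
  assumes S: "\<And>i j. S i j = S j i" and T: "\<And>i j. T i j = T j i"
    and eq: "\<And>x :: complex ^ 'v. (\<Sum>i\<in>UNIV. \<Sum>j\<in>UNIV. S i j * (x $ i * x $ j)) = (\<Sum>i\<in>UNIV. \<Sum>j\<in>UNIV. T i j * (x $ i * x $ j))"
  shows "S i j = T i j"
proof -
  define B where "B S x y = (\<Sum>i\<in>UNIV. \<Sum>j\<in>UNIV. S i j * (x $ i * y $ j))"
    for S :: "'v \<Rightarrow> 'v \<Rightarrow> complex" and x y :: "complex ^ 'v"
  have add: "B S (x + y) (x + y) = B S x x + B S x y + B S y x + B S y y" for S x y
    by (simp add: B_def distrib_left distrib_right sum.distrib)
  have B: "B S (axis i 1) (axis j 1) = S i j" for S i j
  proof -
    have "S a b * (axis i 1 $ a * axis j 1 $ b) = (if a = i then if b = j then S i j else 0 else 0)" for a b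
      by (simp add: axis_def)
    then have "B S (axis i 1) (axis j 1) = (\<Sum>a\<in>UNIV. \<Sum>b\<in>UNIV. if a = i then if b = j then S i j else 0 else 0)"
      unfolding B_def by (simp only:)
    then show ?thesis by (simp only: sum_delta_delta)
  qed
  have "B S x x = B T x x" for x
    using eq by (simp add: B_def)
  then have "B S (axis i 1 + axis j 1) (axis i 1 + axis j 1) = B T (axis i 1 + axis j 1) (axis i 1 + axis j 1)"
    "B S (axis i 1) (axis i 1) = B T (axis i 1) (axis i 1)" "B S (axis j 1) (axis j 1) = B T (axis j 1) (axis j 1)"
    by blast+
  then show ?thesis
    using S [of i j] T [of i j] by (simp add: add B)
qed

lemma sum_shift: "(\<Sum>i\<in>UNIV. f i) = (\<Sum>i\<in>UNIV. f (i + a))" for a :: 8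
  by (rule sum.reindex_bij_witness [of _ "\<lambda>i. i + a" "\<lambda>i. i - a"]) auto

lemma invariant_quadric_matrix:
  assumes S: "\<And>i j. S i j = S j i"
    and q: "q = (\<Sum>i\<in>UNIV. \<Sum>j\<in>UNIV. cst (S i j) * (mvar i * mvar j))"
    and inv: "\<And>x. peval q (act 0 b a x) = peval q x"
  shows "S i j = S (i + a) (j + a) * chi (b * (i + a) + b * (j + a))"
proof (rule symmetric_form_eqD [where S = S and T = "\<lambda>i j. S (i + a) (j + a) * chi (b * (i + a) + b * (j + a))"])
  fix x :: "complex ^ 8"
  have "(\<Sum>i\<in>UNIV. \<Sum>j\<in>UNIV. S i j * (x $ i * x $ j))
     = (\<Sum>i\<in>UNIV. \<Sum>j\<in>UNIV. S i j * ((chi (b * i) * x $ (i - a)) * (chi (b * j) * x $ (j - a))))"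
    using inv [of x] by (simp add: q peval_sum)
  also have "\<dots> = (\<Sum>i\<in>UNIV. \<Sum>j\<in>UNIV. S (i + a) (j + a) * ((chi (b * (i + a)) * x $ i) * (chi (b * (j + a)) * x $ j)))"
    by (rule trans [OF sum_shift [of _ a]], rule sum.cong [OF refl], rule trans [OF sum_shift [of _ a]]) simp
  also have "\<dots> = (\<Sum>i\<in>UNIV. \<Sum>j\<in>UNIV. S (i + a) (j + a) * chi (b * (i + a) + b * (j + a)) * (x $ i * x $ j))"
    by (intro sum.cong refl) (simp only: chi_add mult_ac)
  finally show "(\<Sum>i\<in>UNIV. \<Sum>j\<in>UNIV. S i j * (x $ i * x $ j))
    = (\<Sum>i\<in>UNIV. \<Sum>j\<in>UNIV. S (i + a) (j + a) * chi (b * (i + a) + b * (j + a)) * (x $ i * x $ j))" .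
qed (use S in \<open>simp_all add: add.commute\<close>)

text \<open>The diagonal elements of the group multiply the terms with index sum
  \<open>i + j\<close> by \<open>chi (b * (i + j))\<close>. Summing over \<open>b\<close> against
  the character of \<open>r\<close> isolates one antidiagonal, so vanishing on the orbit splits into
  conditions on single antidiagonals.\<close>

lemma vanishing_quadric_matrix:
  assumes q: "q = (\<Sum>i\<in>UNIV. \<Sum>j\<in>UNIV. cst (S i j) * (mvar i * mvar j))"
    and van: "\<And>z. z \<in> H8_orbit (proj_pt y) \<Longrightarrow> vanishes_at q z"
  shows "(\<Sum>i\<in>UNIV. S i (r - i) * (y $ (i - a) * y $ (r - i - a))) = 0"
proof -
  have zero: "(\<Sum>i\<in>UNIV. \<Sum>j\<in>UNIV. S i j * chi (b * (i + j)) * (y $ (i - a) * y $ (j - a))) = 0" for b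
  proof -
    obtain c where c: "act c b a \<in> H8" using act_in_H8 by blast
    have "y \<in> proj_pt y"
      by (auto simp: proj_pt_def intro!: exI [of _ 1])
    with c have "peval q (act c b a y) = 0"
      using van unfolding H8_orbit_def vanishes_at_def by blast
    then have "(\<Sum>i\<in>UNIV. \<Sum>j\<in>UNIV. S i j * ((chi (c + b * i) * y $ (i - a)) * (chi (c + b * j) * y $ (j - a)))) = 0"
      by (simp add: q peval_sum)
    also have "(\<Sum>i\<in>UNIV. \<Sum>j\<in>UNIV. S i j * ((chi (c + b * i) * y $ (i - a)) * (chi (c + b * j) * y $ (j - a))))
      = (chi c * chi c) * (\<Sum>i\<in>UNIV. \<Sum>j\<in>UNIV. S i j * chi (b * (i + j)) * (y $ (i - a) * y $ (j - a)))"
      unfolding sum_distrib_left by (intro sum.cong refl) (simp only: chi_add distrib_left mult_ac)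
    finally show ?thesis by simp
  qed
  have "0 = (\<Sum>b\<in>UNIV. chi (- (b * r)) * (\<Sum>i\<in>UNIV. \<Sum>j\<in>UNIV. S i j * chi (b * (i + j)) * (y $ (i - a) * y $ (j - a))))"
    by (simp add: zero)
  also have "\<dots> = (\<Sum>b\<in>UNIV. \<Sum>i\<in>UNIV. \<Sum>j\<in>UNIV. S i j * (y $ (i - a) * y $ (j - a)) * chi (b * (i + j - r)))"
    unfolding sum_distrib_left
  proof (intro sum.cong refl)
    fix b i j
    have "- (b * r) + b * (i + j) = b * (i + j - r)"
      by (simp add: algebra_simps)
    then have "chi (- (b * r)) * chi (b * (i + j)) = chi (b * (i + j - r))"
      by (simp only: chi_add [symmetric])
    then show "chi (- (b * r)) * (S i j * chi (b * (i + j)) * (y $ (i - a) * y $ (j - a)))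
      = S i j * (y $ (i - a) * y $ (j - a)) * chi (b * (i + j - r))"
      by (metis (no_types, lifting) mult.assoc mult.left_commute mult.commute)
  qed
  also have "\<dots> = (\<Sum>i\<in>UNIV. \<Sum>j\<in>UNIV. \<Sum>b\<in>UNIV. S i j * (y $ (i - a) * y $ (j - a)) * chi (b * (i + j - r)))"
    by (subst sum.swap) (intro sum.cong refl sum.swap)
  also have "\<dots> = (\<Sum>i\<in>UNIV. \<Sum>j\<in>UNIV. if j = r - i then 8 * (S i j * (y $ (i - a) * y $ (j - a))) else 0)"
    unfolding sum_distrib_left [symmetric] sum_chi_mult by (intro sum.cong refl) (auto simp: algebra_simps)
  also have "\<dots> = 8 * (\<Sum>i\<in>UNIV. S i (r - i) * (y $ (i - a) * y $ (r - i - a)))"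
    by (simp add: sum_distrib_left)
  finally show ?thesis by simp
qed

lemma cst_uminus: "cst (- a) = - cst (a :: complex)"
  by (simp add: cst_def single_uminus)

text \<open>Invariance under \<open>tau ^^ 4\<close> kills the entries with \<open>i + j\<close>
  odd, and invariance under \<open>sigma ^^ 4\<close> leaves three unknowns on each even
  antidiagonal. Vanishing on the orbit imposes two independent linear conditions on them, so each
  antidiagonal carries a multiple of one \<open>quad y k\<close>.\<close>

lemma V8_quadrics_subset:
  assumes y: "y \<in> iota_minus" "y $ 2 \<noteq> 0" and q: "q \<in> V8_quadrics (proj_pt y)"
  shows "q \<in> ideal_gen (range (quad y))"
proof -
  obtain S where sym: "\<And>i j. S i j = S j i"
    and qS: "q = (\<Sum>i\<in>UNIV. \<Sum>j\<in>UNIV. cst (S i j) * (mvar i * mvar j))"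
    using homogeneous_2_matrix [of q] q unfolding V8_quadrics_def by blast
  have inv: "peval q (act 0 b a x) = peval q x" if "a \<in> {0, 4}" "b \<in> {0, 4}" for a b x
    using q that by (auto simp: V8_quadrics_def H'_invariant_iff)
  have S4: "S (i + 4) (j + 4) = S i j" for i j
    using invariant_quadric_matrix [OF sym qS, of 0 4 i j] inv by simp
  have odd: "S i j = 0" if "4 * (i + j) \<noteq> 0" for i j
    using invariant_quadric_matrix [OF sym qS, of 4 0 i j] inv that chi_eq_1_iff [of "4 * (i + j)"]
    by (auto simp: distrib_left)
  have van: "(\<Sum>j\<in>UNIV. S (j - k) (- j - k) * (y $ (j - m) * y $ (- j - m))) = 0" for k m
  proof -
    have "(\<Sum>j\<in>UNIV. S (j - k) (- j - k) * (y $ (j - m) * y $ (- j - m)))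
       = (\<Sum>i\<in>UNIV. S i (- (k + k) - i) * (y $ (i - (m - k)) * y $ (- (k + k) - i - (m - k))))"
      by (rule sum.reindex_bij_witness [of _ "\<lambda>i. i + k" "\<lambda>j. j - k"]) (auto simp: algebra_simps minus_diff_commute)
    also have "\<dots> = 0"
      using q by (intro vanishing_quadric_matrix [OF qS]) (auto simp: V8_quadrics_def)
    finally show ?thesis .
  qed
  have S_eqs: "S (4 - k) (4 - k) = S (- k) (- k)" "S (3 - k) (5 - k) = S (1 - k) (7 - k)" for k
    using S4 [of "- k" "- k"] S4 [of "7 - k" "1 - k"] sym [of "7 - k" "1 - k"]
    by (simp_all add: algebra_simps numerals_8)
  have expand: "(\<Sum>j\<in>UNIV. f (j - k) (- j - k)) = f (- k) (- k) + f (4 - k) (4 - k) + (f (1 - k) (7 - k) + f (7 - k) (1 - k)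
     + f (3 - k) (5 - k) + f (5 - k) (3 - k)) + (f (2 - k) (6 - k) + f (6 - k) (2 - k))"
    for f :: "8 \<Rightarrow> 8 \<Rightarrow> (8, complex) mpoly" and k
    by (simp add: sum_8 minus_numerals_8 add_ac)
  have "\<exists>t. S (- k) (- k) = t * par_p y \<and> 2 * S (1 - k) (7 - k) = - t * par_q y \<and> 2 * S (2 - k) (6 - k) = t * par_s y" for k
  proof -
    define A B C where "A = S (- k) (- k)" and "B = S (1 - k) (7 - k)" and "C = S (2 - k) (6 - k)"
    define L where "L m = A * (y $ (- m) ^ 2 + y $ (4 - m) ^ 2) + 2 * B * (y $ (1 - m) * y $ (7 - m) + y $ (3 - m) * y $ (5 - m))
       + 2 * C * (y $ (2 - m) * y $ (6 - m))" for m
    have L: "L m = 0" for m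
      using van [of k m] sym [of "7 - k" "1 - k"] sym [of "5 - k" "3 - k"] sym [of "6 - k" "2 - k"]
      by (simp add: L_def sum_8 minus_numerals_8 S_eqs A_def B_def C_def power2_eq_square algebra_simps)
    \<comment> \<open>The shifts \<open>m = 0\<close> and \<open>m = 2\<close> already determine the
      three unknowns up to a scalar.\<close>
    have "2 * (B * par_s y + C * par_q y) = - L 0" "2 * (A * par_q y + 2 * B * par_p y) = L 2"
      by (simp_all add: L_def iota_minus_nth [OF y(1)] minus_numerals_8 par_p_def par_q_def par_s_def
          power2_eq_square algebra_simps)
    then have "B * par_s y + C * par_q y = 0" "A * par_q y + 2 * B * par_p y = 0"
      unfolding L by (simp_all del: distrib_left_numeral)
    then have "C * par_q y = - (B * par_s y)" "A * par_q y = - (2 * B * par_p y)"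
      by (simp_all only: eq_neg_iff_add_eq_0 add.commute)
    moreover have "par_q y \<noteq> 0" using y(2) by (simp add: par_q_def)
    ultimately show ?thesis
      by (intro exI [of _ "- 2 * B / par_q y"]) (simp add: field_simps flip: A_def B_def C_def)
  qed
  then obtain t where t: "\<And>k. S (- k) (- k) = t k * par_p y" "\<And>k. 2 * S (1 - k) (7 - k) = - t k * par_q y"
    "\<And>k. 2 * S (2 - k) (6 - k) = t k * par_s y"
    by metis
  define f where "f i j = cst (S i j) * (mvar i * mvar j :: (8, complex) mpoly)" for i j
  have even: "(\<Sum>i\<in>UNIV. f i (- (k + k) - i)) = cst (t k) * quad y k" for k
  proof -
    have "(\<Sum>i\<in>UNIV. f i (- (k + k) - i)) = (\<Sum>j\<in>UNIV. f (j - k) (- j - k))"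
      by (rule sum.reindex_bij_witness [of _ "\<lambda>j. j - k" "\<lambda>i. i + k"]) (auto simp: algebra_simps minus_diff_commute)
    also have "\<dots> = cst (S (- k) (- k)) * (mvar (- k) ^ 2 + mvar (4 - k) ^ 2)
      + cst (2 * S (1 - k) (7 - k)) * (mvar (1 - k) * mvar (7 - k) + mvar (3 - k) * mvar (5 - k))
      + cst (2 * S (2 - k) (6 - k)) * (mvar (2 - k) * mvar (6 - k))"
    proof -
      have "S (7 - k) (1 - k) = S (1 - k) (7 - k)" "S (5 - k) (3 - k) = S (1 - k) (7 - k)" "S (6 - k) (2 - k) = S (2 - k) (6 - k)"
        using sym S_eqs(2) by metis+
      moreover have "A * (a * a) + A * (b * b) + (B * (c * d) + B * (d * c) + B * (u * v) + B * (v * u)) + (C * (w * z) + C * (z * w))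
        = A * (a * a + b * b) + (B + B) * (c * d + u * v) + (C + C) * (w * z)"
        for A B C a b c d u v w z :: "(8, complex) mpoly"
        by (simp add: algebra_simps)
      ultimately show ?thesis
        unfolding expand [of f k] unfolding f_def by (simp only: S_eqs mult_2 ecst.cadd power2_eq_square)
    qed
    also have "\<dots> = cst (t k) * quad y k"
    proof -
      have "t * p * A + - t * q * B + t * s * C = t * (p * A - q * B + s * C)" for t p q s A B C :: "(8, complex) mpoly"
        by (simp add: algebra_simps)
      then show ?thesis
        unfolding t quad_def qform_def by (simp only: ecst.cmult cst_uminus)
    qed
    finally show ?thesis .
  qed
  have oddf: "(\<Sum>i\<in>UNIV. f i (r - i)) = 0" if "4 * r \<noteq> 0" for r
    using odd that by (simp add: f_def)
  have "q = (\<Sum>i\<in>UNIV. \<Sum>r\<in>UNIV. f i (r - i))"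
  proof -
    have "(\<Sum>j\<in>UNIV. f i j) = (\<Sum>r\<in>UNIV. f i (r - i))" for i
      using sum_shift [of "\<lambda>r. f i (r - i)" i] by simp
    then show ?thesis by (simp add: qS flip: f_def)
  qed
  also have "\<dots> = (\<Sum>r\<in>UNIV. \<Sum>i\<in>UNIV. f i (r - i))"
    by (rule sum.swap)
  also have "\<dots> = cst (t 0) * quad y 0 + cst (t 1) * quad y 1 + cst (t 2) * quad y 2 + cst (t 3) * quad y 3"
    unfolding sum_8 [of "\<lambda>r. \<Sum>i\<in>UNIV. f i (r - i)"]
    using even [of 0] even [of 1] even [of 2] even [of 3] oddf [of 1] oddf [of 3] oddf [of 5] oddf [of 7]
    by (simp add: minus_numerals_8 numerals_8)
  also have "\<dots> \<in> ideal_gen (range (quad y))"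
    by (intro ideal.span_add ideal.span_scale ideal.span_base rangeI)
  finally show ?thesis .
qed

lemma V8_eq:
  assumes "y \<in> iota_minus" "y $ 2 \<noteq> 0"
  shows "V8 (proj_pt y) = ideal_gen (range (quad y))"
  unfolding V8_def
proof (rule antisym)
  show "ideal_gen (V8_quadrics (proj_pt y)) \<subseteq> ideal_gen (range (quad y))"
    using V8_quadrics_subset [OF assms] by (intro ideal.span_minimal ideal.subspace_span) auto
  show "ideal_gen (range (quad y)) \<subseteq> ideal_gen (V8_quadrics (proj_pt y))"
    using quad_in_V8_quadrics [OF assms(1)] by (intro ideal.span_mono) auto
qed

section \<open>The complete intersection\<close>

lemma weight_8_lt:
  fixes i j k :: 8
  defines "w \<equiv> \<lambda>i :: 8. if i = 4 \<or> i = 7 then 2 else if i = 5 \<or> i = 6 then 3 else (0 :: nat)"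
  assumes "t = single j 1 + single k 1" "w j + w k < 2 * w i"
  shows "(\<Sum>j\<in>UNIV. w j * lookup t j) < 2 * w i"
proof -
  have "(\<Sum>l\<in>UNIV. w l * lookup (single j 1) l) = w j" for j
  proof -
    have "(\<Sum>l\<in>UNIV. w l * lookup (single j 1) l) = (\<Sum>l\<in>UNIV. if l = j then w j else 0)"
      by (rule sum.cong) (auto simp: lookup_single)
    then show ?thesis by simp
  qed
  then show ?thesis
    using assms(3) unfolding assms(2) lookup_add distrib_left sum.distrib by (simp only:)
qed

locale V8_data =
  fixes y :: "complex ^ 8"
  assumes y: "y \<in> iota_minus" and y123: "y $ 1 \<noteq> 0" "y $ 2 \<noteq> 0" "y $ 3 \<noteq> 0"
begin

text \<open>The squares at 5 and 6 must outweigh the products \<open>x4 x6\<close> and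
  \<open>x5 x7\<close> of their neighbours, so the weight has to be concave there; the squares at 4
  and 7 must outweigh a single factor \<open>x5\<close> or \<open>x6\<close>. The weights 2, 3, 3, 2
  do both.\<close>

definition wt :: "8 \<Rightarrow> nat" where
  "wt i = (if i = 4 \<or> i = 7 then 2 else if i = 5 \<or> i = 6 then 3 else 0)"

text \<open>The quadric with index \<open>- i\<close> contains the squares of the variables
  \<open>i\<close> and \<open>i + 4\<close> with coefficient \<open>par_p y\<close>; here it is
  solved for the first one.\<close>

definition rhs :: "8 \<Rightarrow> (8, complex) mpoly" where
  "rhs i = mvar i ^ 2 - cst (1 / par_p y) * quad y (- i)"

lemma par_nonzero: "par_p y \<noteq> 0" "par_q y \<noteq> 0"
  using y123 by (auto simp: par_p_def par_q_def)

lemma rhs_eq: "rhs i = cst (par_q y / par_p y) * (mvar (1 + i) * mvar (7 + i)) + cst (par_q y / par_p y) * (mvar (3 + i) * mvar (5 + i))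
    - cst (par_s y / par_p y) * (mvar (2 + i) * mvar (6 + i)) - cst 1 * (mvar (4 + i) * mvar (4 + i))"
proof -
  define P where "P = cst (1 / par_p y) * (cst (par_p y) :: (8, complex) mpoly)"
  have P: "P = 1"
    using par_nonzero unfolding P_def ecst.cmult [symmetric] by simp
  have "c * (p * (x + b) - q * (d + e) + s * f) = c * p * (x + b) - q * c * d - q * c * e + s * c * f"
    for c p q s x b d e f :: "(8, complex) mpoly"
    by (simp add: algebra_simps)
  then have "rhs i = mvar i ^ 2 - (P * (mvar i ^ 2 + mvar (4 + i) ^ 2)
     - cst (par_q y) * cst (1 / par_p y) * (mvar (1 + i) * mvar (7 + i))
     - cst (par_q y) * cst (1 / par_p y) * (mvar (3 + i) * mvar (5 + i))
     + cst (par_s y) * cst (1 / par_p y) * (mvar (2 + i) * mvar (6 + i)))"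
    unfolding rhs_def quad_def qform_def P_def by simp
  then show ?thesis
    by (simp add: P power2_eq_square flip: ecst.cmult)
qed

sublocale square_relations_linorder "{4, 5, 6, 7}" rhs wt
proof
  fix i :: 8 assume i: "i \<in> {4, 5, 6, 7}"
  show "homogeneous 2 (rhs i)"
    unfolding rhs_def power2_eq_square
    by (intro homogeneous_diff homogeneous_mvar_mult homogeneous_cst_mult homogeneous_quad)
  fix t assume t: "t \<in> keys (rhs i)"
  have m: "keys (cst c * (mvar j * mvar k)) \<subseteq> {single j 1 + single k 1}"
    for c :: complex and j k :: 8
    using keys_cst_mult [of c "mvar j * mvar k"] by (auto simp: mvar_def mult_single)
  have "\<exists>(j, k)\<in>{(1 + i, 7 + i), (3 + i, 5 + i), (2 + i, 6 + i), (4 + i, 4 + i)}.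
     t = single j 1 + single k 1"
  proof -
    have "keys (a + b - c - d)
       \<subseteq> keys a \<union> keys b \<union> keys c \<union> keys d"
      for a b c d :: "(8, complex) mpoly"
      using keys_diff [of "a + b - c" d] keys_diff [of "a + b" c] keys_add [of a b] by blast
    with t [unfolded rhs_eq] m show ?thesis by blast
  qed
  then obtain j k where jk: "(j, k) \<in> {(1 + i, 7 + i), (3 + i, 5 + i), (2 + i, 6 + i), (4 + i, 4 + i)}"
     "t = single j 1 + single k 1" by blast
  have "wt j + wt k < 2 * wt i"
    using i jk(1) by (auto simp: wt_def numerals_8)
  with weight_8_lt [OF jk(2)] show "(\<Sum>j\<in>UNIV. wt j * lookup t j) < 2 * wt i"
    unfolding wt_def [abs_def] by blast
qed

lemma quad_add_4: "quad y (k + 4) = quad y k"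
  by (simp add: quad_def qform_add_4)

lemma rel_eq: "rel i = cst (1 / par_p y) * quad y (- i)"
  by (simp add: rel_def rhs_def)

lemma quad_range: "range (quad y) = {quad y 0, quad y 1, quad y 2, quad y 3}"
proof -
  have "quad y 4 = quad y 0" "quad y 5 = quad y 1" "quad y 6 = quad y 2" "quad y 7 = quad y 3"
    using quad_add_4 [of 0] quad_add_4 [of 1] quad_add_4 [of 2] quad_add_4 [of 3] by simp_all
  then show ?thesis unfolding UNIV_8 by auto
qed

lemma V8_rel: "V8 (proj_pt y) = ideal_gen (rel ` {4, 5, 6, 7})"
proof -
  have q: "quad y (- i) = cst (par_p y) * rel i" for i
  proof -
    have "cst (par_p y) * rel i = cst (par_p y * (1 / par_p y)) * quad y (- i)"
      unfolding rel_eq by (simp only: ecst.cmult mult.assoc)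
    then show ?thesis using par_nonzero by simp
  qed
  have "quad y 0 = cst (par_p y) * rel 4" "quad y 1 = cst (par_p y) * rel 7"
    "quad y 2 = cst (par_p y) * rel 6" "quad y 3 = cst (par_p y) * rel 5"
    using q [of 4] q [of 7] q [of 6] q [of 5] quad_add_4 [of 0] by (simp_all add: minus_numerals_8)
  then have "range (quad y) \<subseteq> ideal_gen (rel ` {4, 5, 6, 7})"
    unfolding quad_range by (auto intro!: ideal.span_scale intro: ideal.span_base)
  moreover have "rel ` {4, 5, 6, 7} \<subseteq> ideal_gen (range (quad y))"
    unfolding rel_eq by (auto intro!: ideal.span_scale intro: ideal.span_base)
  ultimately show ?thesis
    unfolding V8_eq [OF y y123(2)] by (meson antisym ideal.span_minimal ideal.subspace_span)
qed

lemma V8_quad_in: "quad y k \<in> V8 (proj_pt y)"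
  unfolding V8_eq [OF y y123(2)] by (intro ideal.span_base rangeI)

lemma card_free_variables: "- {4, 5, 6, 7} = {0, 1, 2, 3 :: 8}" "enat (card (- {4, 5, 6, 7 :: 8}) - 1) = 3"
proof -
  show "- {4, 5, 6, 7} = {0, 1, 2, 3 :: 8}"
    using UNIV_8 by auto
  then show "enat (card (- {4, 5, 6, 7 :: 8}) - 1) = 3"
    by (simp add: numeral_eq_enat)
qed

lemma proj_dim_V8_le: "proj_dim (V8 (proj_pt y)) \<le> 3"
  using proj_dim_le unfolding V8_rel card_free_variables(2) .

lemma quad_explicit:
  "peval (quad y 0) x = par_p y * (x $ 0 ^ 2 + x $ 4 ^ 2) - par_q y * (x $ 1 * x $ 7 + x $ 3 * x $ 5) + par_s y * (x $ 2 * x $ 6)"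
  "peval (quad y 1) x = par_p y * (x $ 3 ^ 2 + x $ 7 ^ 2) - par_q y * (x $ 0 * x $ 6 + x $ 2 * x $ 4) + par_s y * (x $ 1 * x $ 5)"
  "peval (quad y 2) x = par_p y * (x $ 2 ^ 2 + x $ 6 ^ 2) - par_q y * (x $ 1 * x $ 3 + x $ 5 * x $ 7) + par_s y * (x $ 0 * x $ 4)"
  "peval (quad y 3) x = par_p y * (x $ 1 ^ 2 + x $ 5 ^ 2) - par_q y * (x $ 0 * x $ 2 + x $ 4 * x $ 6) + par_s y * (x $ 3 * x $ 7)"
  by (simp_all add: peval_quad qform_def minus_numerals_8 algebra_simps)

text \<open>\<open>local_dim_ge\<close> needs a nonzero free coordinate. It exists: where all four
  free coordinates vanish, the quadrics force \<open>x4\<close>, \<open>x7\<close>,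
  \<open>x6\<close>, \<open>x5\<close> to be zero one after the other, so the projection to the free
  coordinates is defined on the whole scheme.\<close>

lemma local_dim_V8:
  assumes zero: "\<And>k. peval (quad y k) x = 0" and x: "x \<noteq> 0"
  shows "local_dim (V8 (proj_pt y)) (proj_pt x) = 3"
proof -
  have "\<exists>j. j \<notin> {4, 5, 6, 7} \<and> x $ j \<noteq> 0"
  proof (rule ccontr)
    assume "\<not> (\<exists>j. j \<notin> {4, 5, 6, 7} \<and> x $ j \<noteq> 0)"
    then have z: "x $ 0 = 0" "x $ 1 = 0" "x $ 2 = 0" "x $ 3 = 0" by force+
    have x4: "x $ 4 = 0"
      using zero [of 0] par_nonzero by (simp add: quad_explicit z)
    have x7: "x $ 7 = 0"
      using zero [of 1] par_nonzero by (simp add: quad_explicit z)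
    have x6: "x $ 6 = 0"
      using zero [of 2] par_nonzero by (simp add: quad_explicit z x7)
    have "x $ 5 = 0"
      using zero [of 3] par_nonzero by (simp add: quad_explicit z x4)
    with z x4 x6 x7 have "x = 0"
      by (simp add: vec_eq_iff all_8)
    with x show False by simp
  qed
  then obtain j where j: "j \<notin> {4, 5, 6, 7}" "x $ j \<noteq> 0" by blast
  have "peval (rel i) x = 0" for i
    by (simp add: rel_eq zero)
  from local_dim_ge [OF this j] have "3 \<le> local_dim (V8 (proj_pt y)) (proj_pt x)"
    unfolding V8_rel card_free_variables(2) .
  moreover have "local_dim (V8 (proj_pt y)) (proj_pt x) \<le> 3"
    using local_dim_le proj_dim_V8_le unfolding V8_rel by (rule order_trans)
  ultimately show ?thesis by (rule antisym [rotated])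
qed

lemma y_nonzero: "y \<noteq> 0"
  using y123 by auto

lemma complete_intersection_V8: "complete_intersection [2, 2, 2, 2] (V8 (proj_pt y))"
proof -
  \<comment> \<open>Any closed point of the scheme gives the lower bound, and \<open>y\<close> is
    one.\<close>
  have "3 \<le> proj_dim (V8 (proj_pt y))"
    using local_dim_V8 [OF peval_quad_self [OF y] y_nonzero] local_dim_le unfolding V8_rel by metis
  with proj_dim_V8_le have "proj_dim (V8 (proj_pt y)) = 3" by (rule antisym)
  then have "proj_dim (V8 (proj_pt y)) + enat (length [2, 2, 2, 2 :: nat]) + 1 = enat CARD(8)"
    by (simp add: numeral_eq_enat one_enat_def)
  moreover have "V8 (proj_pt y) = ideal_gen (set [quad y 0, quad y 1, quad y 2, quad y 3])"
    by (simp add: V8_eq [OF y y123(2)] quad_range)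
  moreover have "list_all2 homogeneous [2, 2, 2, 2] [quad y 0, quad y 1, quad y 2, quad y 3]"
    by (simp add: homogeneous_quad)
  ultimately show ?thesis
    unfolding complete_intersection_def by blast
qed

end

section \<open>Tangent spaces\<close>

lemma dim_inter_kernel:
  fixes \<phi> :: "complex ^ 'n \<Rightarrow> complex"
  assumes "vec.subspace S" and add: "\<And>x z. \<phi> (x + z) = \<phi> x + \<phi> z" and scale: "\<And>c x. \<phi> (c *s x) = c * \<phi> x"
  shows "vec.dim S \<le> Suc (vec.dim (S \<inter> {x. \<phi> x = 0}))"
proof (cases "\<exists>s\<in>S. \<phi> s \<noteq> 0")
  case True
  then obtain s where s: "s \<in> S" "\<phi> s \<noteq> 0" by blast
  let ?K = "S \<inter> {x. \<phi> x = 0}"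
  have "S \<subseteq> vec.span (insert s ?K)"
  proof
    fix x assume x: "x \<in> S"
    let ?z = "x - (\<phi> x / \<phi> s) *s s"
    have "?z + (\<phi> x / \<phi> s) *s s = x" by simp
    then have "\<phi> ?z = 0"
      using add [of ?z "(\<phi> x / \<phi> s) *s s"] scale [of "\<phi> x / \<phi> s" s] s by simp
    moreover have "?z \<in> S"
      using assms(1) x s by (intro vec.subspace_diff vec.subspace_scale)
    ultimately have "?z \<in> vec.span (insert s ?K)"
      by (intro vec.span_base) auto
    moreover have "(\<phi> x / \<phi> s) *s s \<in> vec.span (insert s ?K)"
      by (intro vec.span_scale vec.span_base) auto
    ultimately have "?z + (\<phi> x / \<phi> s) *s s \<in> vec.span (insert s ?K)"
      by (rule vec.span_add)
    then show "x \<in> vec.span (insert s ?K)" by simp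
  qed
  then have "vec.dim S \<le> vec.dim (insert s ?K)"
    by (rule vec.dim_mono)
  also have "\<dots> \<le> Suc (vec.dim ?K)"
    by (simp add: vec.dim_insert)
  finally show ?thesis .
next
  case False
  then have "S \<inter> {x. \<phi> x = 0} = S" by auto
  then show ?thesis by simp
qed

text \<open>Independent rows give a right inverse of \<open>J\<close>, whose range is a complement
  of the kernel.\<close>

lemma dim_kernel_independent_rows:
  fixes J :: "complex ^ 'n ^ 'm"
  assumes "\<And>l. transpose J *v l = 0 \<Longrightarrow> l = 0"
  shows "vec.dim {v. J *v v = 0} + CARD('m) = CARD('n)"
proof -
  obtain B where "B ** transpose J = mat 1"
    using assms matrix_left_invertible_ker [of "transpose J"] by auto
  then have "transpose (B ** transpose J) = mat 1"
    by (simp add: transpose_mat)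
  then have R: "J ** transpose B = mat 1"
    by (simp add: matrix_transpose_mul)
  let ?K = "{v. J *v v = 0}" and ?f = "(*v) (transpose B)"
  have JR: "J *v ?f w = w" for w
    unfolding matrix_vector_mul_assoc R by simp
  have "vec.subspace ?K"
    by (auto simp: vec.subspace_def matrix_vector_right_distrib vector_scalar_commute)
  moreover have "vec.subspace (range ?f)"
    by (intro vec.subspace_image) (auto simp: matrix_vector_mul_linear_gen vec.subspace_UNIV)
  ultimately have "vec.dim {v + w | v w. v \<in> ?K \<and> w \<in> range ?f} + vec.dim (?K \<inter> range ?f)
    = vec.dim ?K + vec.dim (range ?f)"
    by (rule vec.dim_sums_Int)
  moreover have "{v + w | v w. v \<in> ?K \<and> w \<in> range ?f} = UNIV"
  proof -
    have "v = (v - ?f (J *v v)) + ?f (J *v v) \<and> v - ?f (J *v v) \<in> ?K" for v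
      using JR by (simp add: matrix_vector_mult_diff_distrib)
    then show ?thesis by blast
  qed
  moreover have "?K \<inter> range ?f = {0}"
  proof -
    have "?f w = 0" if "J *v ?f w = 0" for w
      using that unfolding JR by simp
    then have "?K \<inter> range ?f \<subseteq> {0}" by blast
    moreover have "0 \<in> ?K \<inter> range ?f"
      by (auto intro: range_eqI [of _ _ 0])
    ultimately show ?thesis by blast
  qed
  moreover have "vec.dim {0 :: complex ^ 'n} = 0"
    by (simp add: vec.dim_eq_0)
  ultimately have "CARD('n) = vec.dim ?K + vec.dim (range ?f)"
    by (simp only: vec_dim_card add_0_right)
  moreover have "vec.dim (range ?f) = CARD('m)"
  proof -
    have "inj ?f"
      using JR by (metis injI)
    then have "vec.dim (range ?f) = vec.dim (UNIV :: (complex ^ 'm) set)"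
      by (intro vec.dim_image_eq) (simp_all add: matrix_vector_mul_linear_gen)
    then show ?thesis by (simp only: vec_dim_card)
  qed
  ultimately show ?thesis by simp
qed

section \<open>Tangent spaces through the polar forms of the quadrics\<close>

context V8_data
begin

definition polar :: "8 \<Rightarrow> complex ^ 8 \<Rightarrow> complex ^ 8 \<Rightarrow> complex" where
  "polar k x v = peval (quad y k) (x + v) - peval (quad y k) x - peval (quad y k) v"

lemma polar_explicit:
  "polar 0 x v = par_p y * (2 * x $ 0 * v $ 0 + 2 * x $ 4 * v $ 4)
     - par_q y * (x $ 1 * v $ 7 + x $ 7 * v $ 1 + x $ 3 * v $ 5 + x $ 5 * v $ 3) + par_s y * (x $ 2 * v $ 6 + x $ 6 * v $ 2)"
  "polar 1 x v = par_p y * (2 * x $ 3 * v $ 3 + 2 * x $ 7 * v $ 7)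
     - par_q y * (x $ 0 * v $ 6 + x $ 6 * v $ 0 + x $ 2 * v $ 4 + x $ 4 * v $ 2) + par_s y * (x $ 1 * v $ 5 + x $ 5 * v $ 1)"
  "polar 2 x v = par_p y * (2 * x $ 2 * v $ 2 + 2 * x $ 6 * v $ 6)
     - par_q y * (x $ 1 * v $ 3 + x $ 3 * v $ 1 + x $ 5 * v $ 7 + x $ 7 * v $ 5) + par_s y * (x $ 0 * v $ 4 + x $ 4 * v $ 0)"
  "polar 3 x v = par_p y * (2 * x $ 1 * v $ 1 + 2 * x $ 5 * v $ 5)
     - par_q y * (x $ 0 * v $ 2 + x $ 2 * v $ 0 + x $ 4 * v $ 6 + x $ 6 * v $ 4) + par_s y * (x $ 3 * v $ 7 + x $ 7 * v $ 3)"
  by (simp_all add: polar_def quad_explicit power2_eq_square algebra_simps)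

lemma polar_add_4: "polar (k + 4) = polar k"
  by (simp add: polar_def quad_add_4 fun_eq_iff)

lemma polar_numerals: "polar 4 = polar 0" "polar 5 = polar 1" "polar 6 = polar 2" "polar 7 = polar 3"
  using polar_add_4 [of 0] polar_add_4 [of 1] polar_add_4 [of 2] polar_add_4 [of 3] by simp_all

lemma all_polar: "(\<forall>k. polar k x v = 0) \<longleftrightarrow> polar 0 x v = 0 \<and> polar 1 x v = 0 \<and> polar 2 x v = 0 \<and> polar 3 x v = 0"
  by (auto simp: all_8 polar_numerals)

lemma polar_linear:
  "polar k x (v + w) = polar k x v + polar k x w" "polar k x (c *s v) = c * polar k x v"
  "polar k (c *s x) v = c * polar k x v"
proof -
  have "\<forall>k. polar k x (v + w) = polar k x v + polar k x w \<and> polar k x (c *s v) = c * polar k x v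
     \<and> polar k (c *s x) v = c * polar k x v"
    by (simp add: all_8 polar_numerals polar_explicit algebra_simps)
  then show "polar k x (v + w) = polar k x v + polar k x w" "polar k x (c *s v) = c * polar k x v"
    "polar k (c *s x) v = c * polar k x v" by auto
qed

lemma quad_has_field_derivative:
  "((\<lambda>t. peval (quad y k) (x + t *s v)) has_field_derivative polar k x v) (at 0)"
proof -
  have "peval (quad y k) (x + t *s v) = peval (quad y k) x + t * polar k x v + t ^ 2 * peval (quad y k) v" for t
  proof -
    have "peval (quad y k) (x + t *s v) = peval (quad y k) x + polar k x (t *s v) + peval (quad y k) (t *s v)"
      by (simp add: polar_def)
    then show ?thesis
      by (simp only: polar_linear peval_homogeneous_smult [OF homogeneous_quad])
  qed
  then show ?thesis
    by (auto intro!: derivative_eq_intros)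
qed

text \<open>At a common zero of the generators the product rule removes the derivatives of the
  coefficients, so tangency has to be checked on the generators only.\<close>

lemma cone_tangent_V8:
  assumes zero: "\<And>k. peval (quad y k) x = 0"
  shows "cone_tangent_space (V8 (proj_pt y)) (proj_pt x) = {v. \<forall>k. polar k x v = 0}"
proof (intro equalityI subsetI)
  fix v assume v: "v \<in> cone_tangent_space (V8 (proj_pt y)) (proj_pt x)"
  have x: "x \<in> proj_pt x"
    by (auto simp: proj_pt_def intro!: exI [of _ 1])
  have "polar k x v = 0" for k
    using DERIV_unique [OF quad_has_field_derivative [of k x v] peval_has_field_derivative [of "quad y k" x v]] v x V8_quad_in [of k]
    by (auto simp: cone_tangent_space_def)
  then show "v \<in> {v. \<forall>k. polar k x v = 0}" by simp
next
  fix v assume "v \<in> {v. \<forall>k. polar k x v = 0}"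
  then have v: "polar k x v = 0" for k by simp
  have "(\<Sum>i\<in>UNIV. peval (pdiff i q) (c *s x) * v $ i) = 0" if "q \<in> V8 (proj_pt y)" for q c
  proof -
    let ?D = "\<lambda>q. (\<lambda>t. peval q (c *s x + t *s v))"
    from that have "peval q (c *s x) = 0 \<and> (?D q has_field_derivative 0) (at 0)"
      unfolding V8_eq [OF y y123(2)]
    proof (induction rule: ideal.span_induct_alt)
      case (step a g b)
      from step(1) obtain k where g: "g = quad y k" by blast
      have "peval g (c *s x) = 0"
        unfolding g by (simp add: peval_homogeneous_smult [OF homogeneous_quad] zero)
      moreover have "(?D g has_field_derivative 0) (at 0)"
        using quad_has_field_derivative [of k "c *s x" v] unfolding g by (simp add: polar_linear v)
      from DERIV_mult [OF peval_has_field_derivative this, of a]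
      have "((\<lambda>t. peval a (c *s x + t *s v) * peval g (c *s x + t *s v)) has_field_derivative 0) (at 0)"
        using \<open>peval g (c *s x) = 0\<close> by simp
      from DERIV_add [OF this conjunct2 [OF step(2)]]
      have "(?D (a * g + b) has_field_derivative 0) (at 0)" by simp
      ultimately show ?case
        using step(2) by simp
    qed simp
    then show ?thesis
      using DERIV_unique [OF peval_has_field_derivative [of q "c *s x" v]] by blast
  qed
  then show "v \<in> cone_tangent_space (V8 (proj_pt y)) (proj_pt x)"
    by (auto simp: cone_tangent_space_def proj_pt_def)
qed

lemma dim_tangent_le:
  assumes "\<And>l0 l1 l2 l3. (\<And>v. l0 * polar 0 x v + l1 * polar 1 x v + l2 * polar 2 x v + l3 * polar 3 x v = 0) \<Longrightarrow>
     l0 = 0 \<and> l1 = 0 \<and> l2 = 0 \<and> l3 = 0"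
  shows "vec.dim {v. \<forall>k. polar k x v = 0} = 4"
proof -
  define row :: "4 \<Rightarrow> 8" where "row r = (if r = 1 then 0 else if r = 2 then 1 else if r = 3 then 2 else 3)" for r
  have row: "row 1 = 0" "row 2 = 1" "row 3 = 2" "row 4 = 3"
    by (simp_all add: row_def)
  define J :: "complex ^ 8 ^ 4" where "J = (\<chi> r i. polar (row r) x (axis i 1))"
  have J: "(\<Sum>i\<in>UNIV. polar k x (axis i 1) * v $ i) = polar k x v" for k v
  proof -
    have "\<forall>k. (\<Sum>i\<in>UNIV. polar k x (axis i 1) * v $ i) = polar k x v"
      by (simp add: all_8 polar_numerals polar_explicit sum_8 axis_def algebra_simps)
    then show ?thesis by blast
  qed
  have kernel: "l = 0" if "transpose J *v l = 0" for l
  proof -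
    have "(\<Sum>r\<in>UNIV. polar (row r) x (axis i 1) * l $ r) = 0" for i
      using that by (simp add: vec_eq_iff matrix_vector_mult_def transpose_def J_def)
    then have i: "l $ 1 * polar 0 x (axis i 1) + l $ 2 * polar 1 x (axis i 1) + l $ 3 * polar 2 x (axis i 1)
       + l $ 4 * polar 3 x (axis i 1) = 0" for i
      by (simp add: sum_4 row mult.commute)
    have "l $ 1 * polar 0 x v + l $ 2 * polar 1 x v + l $ 3 * polar 2 x v + l $ 4 * polar 3 x v = 0" for v
    proof -
      have "l $ 1 * polar 0 x v + l $ 2 * polar 1 x v + l $ 3 * polar 2 x v + l $ 4 * polar 3 x v
        = (\<Sum>j\<in>UNIV. (l $ 1 * polar 0 x (axis j 1) + l $ 2 * polar 1 x (axis j 1) + l $ 3 * polar 2 x (axis j 1)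
       + l $ 4 * polar 3 x (axis j 1)) * v $ j)"
        unfolding J [of _ v, symmetric] by (simp add: distrib_right sum.distrib sum_distrib_left mult.assoc)
      then show ?thesis by (simp only: i mult_zero_left sum.neutral_const)
    qed
    from assms [OF this] show ?thesis
      by (simp add: vec_eq_iff forall_4)
  qed
  have "vec.dim {v. J *v v = 0} + CARD(4) = CARD(8)"
    by (rule dim_kernel_independent_rows) (rule kernel)
  then have "vec.dim {v. J *v v = 0} = 4" by simp
  moreover have "J *v v = 0 \<longleftrightarrow> (\<forall>k. polar k x v = 0)" for v
    by (simp add: vec_eq_iff matrix_vector_mult_def J_def J forall_4 row all_polar)
  ultimately show ?thesis by simp
qed

text \<open>A relation makes one of the four polar equations a consequence of the other three, and
  three linear equations lower the dimension 8 by at most three.\<close>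

lemma dim_tangent_ge:
  assumes rel: "\<And>v. l0 * polar 0 x v + l1 * polar 1 x v + l2 * polar 2 x v + l3 * polar 3 x v = 0"
    and nz: "\<not> (l0 = 0 \<and> l1 = 0 \<and> l2 = 0 \<and> l3 = 0)"
  shows "5 \<le> vec.dim {v. \<forall>k. polar k x v = 0}"
proof -
  have three: "5 \<le> vec.dim {v. polar i x v = 0 \<and> polar j x v = 0 \<and> polar k x v = 0}" for i j k
  proof -
    have cut: "vec.dim S \<le> Suc (vec.dim (S \<inter> {v. polar i x v = 0}))" if "vec.subspace S" for S i
      using that by (rule dim_inter_kernel) (rule polar_linear)+
    have sub: "vec.subspace (S \<inter> {v. polar i x v = 0})" if "vec.subspace S" for S i
      using that polar_linear(2) [of i x 0 0] by (auto simp: vec.subspace_def polar_linear)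
    have "{v. polar i x v = 0 \<and> polar j x v = 0 \<and> polar k x v = 0}
      = UNIV \<inter> {v. polar i x v = 0} \<inter> {v. polar j x v = 0} \<inter> {v. polar k x v = 0}" by auto
    then have eq: "vec.dim {v. polar i x v = 0 \<and> polar j x v = 0 \<and> polar k x v = 0}
      = vec.dim (UNIV \<inter> {v. polar i x v = 0} \<inter> {v. polar j x v = 0} \<inter> {v. polar k x v = 0})"
      by (simp only:)
    have "vec.dim (UNIV :: (complex ^ 8) set) = 8"
      by (simp only: vec_dim_card) simp
    then show ?thesis
      unfolding eq
      using cut [OF vec.subspace_UNIV, of i] cut [OF sub [OF vec.subspace_UNIV], of i j]
        cut [OF sub [OF sub [OF vec.subspace_UNIV]], of i j k] by linarith
  qed
  have *: "(\<forall>k. polar k x v = 0) \<longleftrightarrow> polar 0 x v = 0 \<and> polar 1 x v = 0 \<and> polar 2 x v = 0 \<and> polar 3 x v = 0" for v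
    by (rule all_polar)
  consider "l0 \<noteq> 0" | "l1 \<noteq> 0" | "l2 \<noteq> 0" | "l3 \<noteq> 0" using nz by blast
  then show ?thesis
  proof cases
    case 1
    then have "(\<forall>k. polar k x v = 0) \<longleftrightarrow> polar 1 x v = 0 \<and> polar 2 x v = 0 \<and> polar 3 x v = 0" for v
      using rel [of v] unfolding * by auto
    then show ?thesis using three by simp
  next
    case 2
    then have "(\<forall>k. polar k x v = 0) \<longleftrightarrow> polar 0 x v = 0 \<and> polar 2 x v = 0 \<and> polar 3 x v = 0" for v
      using rel [of v] unfolding * by auto
    then show ?thesis using three by simp
  next
    case 3
    then have "(\<forall>k. polar k x v = 0) \<longleftrightarrow> polar 0 x v = 0 \<and> polar 1 x v = 0 \<and> polar 3 x v = 0" for v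
      using rel [of v] unfolding * by auto
    then show ?thesis using three by simp
  next
    case 4
    then have "(\<forall>k. polar k x v = 0) \<longleftrightarrow> polar 0 x v = 0 \<and> polar 1 x v = 0 \<and> polar 2 x v = 0" for v
      using rel [of v] unfolding * by auto
    then show ?thesis using three by simp
  qed
qed

end

section \<open>Singular points\<close>

text \<open>The symmetric matrix with rows \<open>P, - Q\<close> and \<open>- Q, R\<close> kills the
  nonzero vector \<open>(u, w)\<close>, so its determinant vanishes.\<close>

lemma kernel_2x2:
  fixes P Q R u w :: "'a::idom"
  assumes "P * u = Q * w" "R * w = Q * u" "u \<noteq> 0 \<or> w \<noteq> 0"
  shows "P * R = Q * Q"
proof -
  have "(P * R - Q * Q) * u = 0" "(P * R - Q * Q) * w = 0"
    using assms(1,2) by algebra+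
  with assms(3) show ?thesis by auto
qed

text \<open>The first three inequalities exclude two vanishing blocks at a point of the scheme; the
  last one excludes four nonzero blocks at a singular point.\<close>

locale general_parameters =
  fixes al be ga :: complex
  assumes nz: "al \<noteq> 0" "be \<noteq> 0" "ga \<noteq> 0"
    and gen: "al ^ 4 \<noteq> be ^ 4" "al ^ 4 \<noteq> ga ^ 4" "be ^ 4 + ga ^ 4 \<noteq> 0" "al ^ 4 \<noteq> be ^ 4 + ga ^ 4"
begin

text \<open>The quadratic equations of \<open>V\<close> in the coordinates \<open>u\<^sub>j = x\<^sub>j + x\<^sub>j\<^sub>+\<^sub>4\<close> and \<open>v\<^sub>j = x\<^sub>j - x\<^sub>j\<^sub>+\<^sub>4\<close>.\<close>

definition eqs :: "complex \<Rightarrow> complex \<Rightarrow> complex \<Rightarrow> complex \<Rightarrow> complex \<Rightarrow> complex \<Rightarrow> complex \<Rightarrow> complex \<Rightarrow> bool" where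
  "eqs u0 u2 v0 v2 u1 u3 v1 v3 \<longleftrightarrow>
     al * (u0\<^sup>2 + u2\<^sup>2) + be * (v0\<^sup>2 + v2\<^sup>2) = 2 * ga * u1 * u3 \<and>
     be * (u0\<^sup>2 - u2\<^sup>2) + al * (v0\<^sup>2 - v2\<^sup>2) + 2 * ga * v1 * v3 = 0 \<and>
     al * (u1\<^sup>2 + u3\<^sup>2) + be * (v1\<^sup>2 + v3\<^sup>2) = 2 * ga * u0 * u2 \<and>
     be * (u1\<^sup>2 - u3\<^sup>2) + al * (v1\<^sup>2 - v3\<^sup>2) = 2 * ga * v0 * v2"

text \<open>The triple \<open>u^2 + w^2\<close>, \<open>u^2 - w^2\<close>, \<open>2 u w\<close>
  parametrizes a conic, and each block enters \<open>eqs\<close> only through this triple.\<close>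

lemma null_vector: "(u\<^sup>2 + w\<^sup>2)\<^sup>2 = (u\<^sup>2 - w\<^sup>2)\<^sup>2 + (2 * u * w)\<^sup>2" for u w :: complex
  by algebra

lemma null_vector_zero:
  fixes u w :: complex assumes "u\<^sup>2 + w\<^sup>2 = 0" "u\<^sup>2 - w\<^sup>2 = 0" shows "u = 0 \<and> w = 0"
proof -
  have "2 * u\<^sup>2 = 0" "2 * w\<^sup>2 = 0" using assms by algebra+
  then show ?thesis by simp
qed

text \<open>With two blocks zero, two of the equations make one coordinate of each remaining conic
  point vanish, so its other two have equal squares up to sign. The other two equations, squared,
  are then linear in these squares, with an excluded quantity as determinant. The facts
  \<open>same\<close>, \<open>cross\<close>, \<open>cross'\<close> and \<open>mixed\<close> sort the
  six pairs of blocks by the coordinates that vanish.\<close>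

lemma two_zero_blocks:
  assumes "eqs u0 u2 v0 v2 u1 u3 v1 v3"
  shows "u1 = 0 \<and> u3 = 0 \<and> v1 = 0 \<and> v3 = 0 \<Longrightarrow> u0 = 0 \<and> u2 = 0 \<and> v0 = 0 \<and> v2 = 0"
    "u0 = 0 \<and> u2 = 0 \<and> v0 = 0 \<and> v2 = 0 \<Longrightarrow> u1 = 0 \<and> u3 = 0 \<and> v1 = 0 \<and> v3 = 0"
    "v0 = 0 \<and> v2 = 0 \<and> v1 = 0 \<and> v3 = 0 \<Longrightarrow> u0 = 0 \<and> u2 = 0 \<and> u1 = 0 \<and> u3 = 0"
    "u0 = 0 \<and> u2 = 0 \<and> u1 = 0 \<and> u3 = 0 \<Longrightarrow> v0 = 0 \<and> v2 = 0 \<and> v1 = 0 \<and> v3 = 0"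
    "v0 = 0 \<and> v2 = 0 \<and> u1 = 0 \<and> u3 = 0 \<Longrightarrow> u0 = 0 \<and> u2 = 0 \<and> v1 = 0 \<and> v3 = 0"
    "u0 = 0 \<and> u2 = 0 \<and> v1 = 0 \<and> v3 = 0 \<Longrightarrow> u1 = 0 \<and> u3 = 0 \<and> v0 = 0 \<and> v2 = 0"
proof -
  let ?m = "\<lambda>u w :: complex. u\<^sup>2 + w\<^sup>2" and ?d = "\<lambda>u w :: complex. u\<^sup>2 - w\<^sup>2" and ?c = "\<lambda>u w :: complex. 2 * u * w"
  note e = assms [unfolded eqs_def]
  have same: "u = 0 \<and> w = 0 \<and> u' = 0 \<and> w' = 0"
    if "al * ?m u w + be * ?m u' w' = 0" "be * ?d u w + al * ?d u' w' = 0" "?c u w = 0" "?c u' w' = 0" for u w u' w'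
  proof -
    have s: "(?m u w)\<^sup>2 = (?d u w)\<^sup>2" "(?m u' w')\<^sup>2 = (?d u' w')\<^sup>2"
      unfolding null_vector that(3,4) by simp_all
    have "al\<^sup>2 * (?m u w)\<^sup>2 = be\<^sup>2 * (?m u' w')\<^sup>2"
      using that(1) by algebra
    moreover have "be\<^sup>2 * (?d u w)\<^sup>2 = al\<^sup>2 * (?d u' w')\<^sup>2"
      using that(2) by algebra
    ultimately have "(al ^ 4 - be ^ 4) * (?m u w)\<^sup>2 = 0" "(al ^ 4 - be ^ 4) * (?m u' w')\<^sup>2 = 0"
      unfolding s by algebra+
    then have m: "?m u w = 0" "?m u' w' = 0" using gen by auto
    with s have "?d u w = 0" "?d u' w' = 0" by simp_all
    with m null_vector_zero show ?thesis by blast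
  qed
  have cross: "u = 0 \<and> w = 0 \<and> u' = 0 \<and> w' = 0"
    if "h * ?m u w = ga * ?c u' w'" "h * ?m u' w' = ga * ?c u w" "?d u w = 0" "?d u' w' = 0" "h ^ 4 \<noteq> ga ^ 4" for u w u' w' h
  proof -
    have s: "(?c u w)\<^sup>2 = (?m u w)\<^sup>2" "(?c u' w')\<^sup>2 = (?m u' w')\<^sup>2"
      unfolding null_vector that(3,4) by simp_all
    have "h\<^sup>2 * (?m u w)\<^sup>2 = ga\<^sup>2 * (?c u' w')\<^sup>2" "h\<^sup>2 * (?m u' w')\<^sup>2 = ga\<^sup>2 * (?c u w)\<^sup>2"
      using that(1,2) by (metis power_mult_distrib)+
    then have "(h ^ 4 - ga ^ 4) * (?m u w)\<^sup>2 = 0" "(h ^ 4 - ga ^ 4) * (?m u' w')\<^sup>2 = 0"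
      unfolding s by algebra+
    then have m: "?m u w = 0" "?m u' w' = 0" using that(5) by auto
    with that null_vector_zero show ?thesis by blast
  qed
  have cross': "u = 0 \<and> w = 0 \<and> u' = 0 \<and> w' = 0"
    if "h * ?d u w + ga * ?c u' w' = 0" "h * ?d u' w' = ga * ?c u w" "?m u w = 0" "?m u' w' = 0" "h ^ 4 \<noteq> ga ^ 4" for u w u' w' h
  proof -
    have s: "(?c u w)\<^sup>2 = - (?d u w)\<^sup>2" "(?c u' w')\<^sup>2 = - (?d u' w')\<^sup>2"
      using that(3,4) by algebra+
    have "h\<^sup>2 * (?d u w)\<^sup>2 = ga\<^sup>2 * (?c u' w')\<^sup>2"
      using that(1) by algebra
    moreover have "h\<^sup>2 * (?d u' w')\<^sup>2 = ga\<^sup>2 * (?c u w)\<^sup>2"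
      using that(2) by (metis power_mult_distrib)
    ultimately have "(h ^ 4 - ga ^ 4) * (?d u w)\<^sup>2 = 0" "(h ^ 4 - ga ^ 4) * (?d u' w')\<^sup>2 = 0"
      unfolding s by algebra+
    then have m: "?d u w = 0" "?d u' w' = 0" using that(5) by auto
    with that null_vector_zero show ?thesis by blast
  qed
  have mixed: "u = 0 \<and> w = 0 \<and> u' = 0 \<and> w' = 0"
    if "be * ?d u w + h * ga * ?c u' w' = 0" "be * ?m u' w' = ga * ?c u w" "?m u w = 0" "?d u' w' = 0" "h\<^sup>2 = 1" for u w u' w' h
  proof -
    have s: "(?c u w)\<^sup>2 = - (?d u w)\<^sup>2" "(?c u' w')\<^sup>2 = (?m u' w')\<^sup>2"
      using that(3,4) by algebra+
    have "be\<^sup>2 * (?d u w)\<^sup>2 = h\<^sup>2 * ga\<^sup>2 * (?c u' w')\<^sup>2"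
      using that(1) by algebra
    moreover have "be\<^sup>2 * (?m u' w')\<^sup>2 = ga\<^sup>2 * (?c u w)\<^sup>2"
      using that(2) by (metis power_mult_distrib)
    ultimately have "(be ^ 4 + ga ^ 4) * (?d u w)\<^sup>2 = 0" "(be ^ 4 + ga ^ 4) * (?m u' w')\<^sup>2 = 0"
      unfolding s that(5) by algebra+
    then have "?d u w = 0" "?m u' w' = 0" using gen by auto
    with that null_vector_zero show ?thesis by blast
  qed
  note e1 = e [THEN conjunct1] and e2 = e [THEN conjunct2, THEN conjunct1]
    and e3 = e [THEN conjunct2, THEN conjunct2, THEN conjunct1] and e4 = e [THEN conjunct2, THEN conjunct2, THEN conjunct2]
  show "u0 = 0 \<and> u2 = 0 \<and> v0 = 0 \<and> v2 = 0" if z: "u1 = 0 \<and> u3 = 0 \<and> v1 = 0 \<and> v3 = 0"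
  proof (rule same)
    show "al * (u0\<^sup>2 + u2\<^sup>2) + be * (v0\<^sup>2 + v2\<^sup>2) = 0" using e1 z nz by simp
    show "be * (u0\<^sup>2 - u2\<^sup>2) + al * (v0\<^sup>2 - v2\<^sup>2) = 0" using e2 z nz by simp
    show "2 * u0 * u2 = 0" using e3 z nz by simp
    show "2 * v0 * v2 = 0" using e4 z nz by simp
  qed
  show "u1 = 0 \<and> u3 = 0 \<and> v1 = 0 \<and> v3 = 0" if z: "u0 = 0 \<and> u2 = 0 \<and> v0 = 0 \<and> v2 = 0"
  proof (rule same)
    show "al * (u1\<^sup>2 + u3\<^sup>2) + be * (v1\<^sup>2 + v3\<^sup>2) = 0" using e3 z nz by simp
    show "be * (u1\<^sup>2 - u3\<^sup>2) + al * (v1\<^sup>2 - v3\<^sup>2) = 0" using e4 z nz by simp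
    show "2 * u1 * u3 = 0" using e1 z nz by simp
    show "2 * v1 * v3 = 0" using e2 z nz by simp
  qed
  show "u0 = 0 \<and> u2 = 0 \<and> u1 = 0 \<and> u3 = 0" if z: "v0 = 0 \<and> v2 = 0 \<and> v1 = 0 \<and> v3 = 0"
  proof (rule cross)
    show "al * (u0\<^sup>2 + u2\<^sup>2) = ga * (2 * u1 * u3)" using e1 z nz by simp
    show "al * (u1\<^sup>2 + u3\<^sup>2) = ga * (2 * u0 * u2)" using e3 z nz by simp
    show "u0\<^sup>2 - u2\<^sup>2 = 0" using e2 z nz by simp
    show "u1\<^sup>2 - u3\<^sup>2 = 0" using e4 z nz by simp
  qed (rule gen)
  show "v0 = 0 \<and> v2 = 0 \<and> v1 = 0 \<and> v3 = 0" if z: "u0 = 0 \<and> u2 = 0 \<and> u1 = 0 \<and> u3 = 0"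
  proof (rule cross')
    show "al * (v0\<^sup>2 - v2\<^sup>2) + ga * (2 * v1 * v3) = 0" using e2 z by (simp add: mult_ac)
    show "al * (v1\<^sup>2 - v3\<^sup>2) = ga * (2 * v0 * v2)" using e4 z nz by simp
    show "v0\<^sup>2 + v2\<^sup>2 = 0" using e1 z nz by simp
    show "v1\<^sup>2 + v3\<^sup>2 = 0" using e3 z nz by simp
  qed (rule gen)
  show "u0 = 0 \<and> u2 = 0 \<and> v1 = 0 \<and> v3 = 0" if z: "v0 = 0 \<and> v2 = 0 \<and> u1 = 0 \<and> u3 = 0"
  proof (rule mixed [where h = 1])
    show "be * (u0\<^sup>2 - u2\<^sup>2) + 1 * ga * (2 * v1 * v3) = 0" using e2 z by (simp add: mult_ac)
    show "be * (v1\<^sup>2 + v3\<^sup>2) = ga * (2 * u0 * u2)" using e3 z nz by simp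
    show "u0\<^sup>2 + u2\<^sup>2 = 0" using e1 z nz by simp
    show "v1\<^sup>2 - v3\<^sup>2 = 0" using e4 z nz by simp
  qed simp
  show "u1 = 0 \<and> u3 = 0 \<and> v0 = 0 \<and> v2 = 0" if z: "u0 = 0 \<and> u2 = 0 \<and> v1 = 0 \<and> v3 = 0"
  proof (rule mixed [where h = "- 1"])
    show "be * (u1\<^sup>2 - u3\<^sup>2) + - 1 * ga * (2 * v0 * v2) = 0" using e4 z nz by simp
    show "be * (v0\<^sup>2 + v2\<^sup>2) = ga * (2 * u1 * u3)" using e1 z nz by simp
    show "u1\<^sup>2 + u3\<^sup>2 = 0" using e3 z nz by simp
    show "v0\<^sup>2 - v2\<^sup>2 = 0" using e2 z nz by simp
  qed simp
qed

text \<open>The equations are linear in squares: the matrix with rows \<open>al^2, - be^2\<close>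
  and \<open>be^2, - al^2\<close> maps \<open>(a^2, b^2)\<close> to \<open>ga^2 (c^2, d^2)\<close>
  and \<open>(c^2, d^2)\<close> to \<open>ga^2 (a^2, b^2)\<close>. Its square is the scalar
  \<open>al^4 - be^4\<close>, which differs from \<open>ga^4\<close>.\<close>

lemma no_four_blocks:
  assumes "(al * a + be * b) * (al * a - be * b) = ga * c * (ga * c)"
    "(be * a + al * b) * (be * a - al * b) = ga * d * (ga * d)"
    "(al * c - be * d) * (al * c + be * d) = ga * a * (ga * a)"
    "(be * c - al * d) * (be * c + al * d) = ga * b * (ga * b)"
  shows "a = 0 \<and> b = 0 \<and> c = 0 \<and> d = 0"
proof -
  have "(al ^ 4 - (be ^ 4 + ga ^ 4)) * a\<^sup>2 = 0" "(al ^ 4 - (be ^ 4 + ga ^ 4)) * b\<^sup>2 = 0"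
    using assms by algebra+
  then have "a = 0" "b = 0" using gen by auto
  with assms nz show ?thesis by auto
qed

text \<open>Without the discriminant of the first block, the second row of the same matrix identity
  still gives \<open>d = 0\<close>. The other three unknowns then vanish together or not at
  all.\<close>

lemma three_blocks:
  assumes "(be * a + al * b) * (be * a - al * b) = ga * d * (ga * d)"
    "(al * c - be * d) * (al * c + be * d) = ga * a * (ga * a)"
    "(be * c - al * d) * (be * c + al * d) = ga * b * (ga * b)"
    and "\<not> (a = 0 \<and> b = 0 \<and> c = 0 \<and> d = 0)"
  shows "d = 0 \<and> a \<noteq> 0 \<and> b \<noteq> 0 \<and> c \<noteq> 0"
proof -
  have "(al ^ 4 - (be ^ 4 + ga ^ 4)) * d\<^sup>2 = 0"
    using assms by algebra
  then have d: "d = 0" using gen by auto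
  have *: "be * a * (be * a) = al * b * (al * b)" "al * c * (al * c) = ga * a * (ga * a)"
    using assms(1,2) unfolding d by algebra+
  then have "be * a = 0 \<longleftrightarrow> al * b = 0" "al * c = 0 \<longleftrightarrow> ga * a = 0"
    by (metis mult_eq_0_iff)+
  with d assms(4) nz show ?thesis by auto
qed

end

section \<open>Projective points, blocks of coordinates and the group action\<close>

lemma mem_proj_pt: "x \<in> proj_pt x"
  by (auto simp: proj_pt_def intro!: exI [of _ 1])

lemma proj_pt_smult: "t \<noteq> 0 \<Longrightarrow> proj_pt (t *s x) = proj_pt x"
proof (intro equalityI subsetI)
  fix z assume "t \<noteq> 0" "z \<in> proj_pt x"
  then obtain c where "z = (c / t) *s (t *s x)" "c / t \<noteq> 0"
    by (auto simp: proj_pt_def)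
  then show "z \<in> proj_pt (t *s x)" unfolding proj_pt_def by blast
qed (auto simp: proj_pt_def)

locale V8_general = V8_data y + general_parameters al be ga for y al be ga +
  assumes al: "al = (y $ 1 + y $ 3)\<^sup>2" and be: "be = - (y $ 1 - y $ 3)\<^sup>2" and ga: "ga = 2 * (y $ 2)\<^sup>2"
begin

lemmas parameters = al be ga par_p_def par_q_def par_s_def

definition U :: "complex ^ 8 \<Rightarrow> 8 \<Rightarrow> complex" where "U x j = x $ j + x $ (j + 4)"
definition W :: "complex ^ 8 \<Rightarrow> 8 \<Rightarrow> complex" where "W x j = x $ j - x $ (j + 4)"

lemma U_W_zero:
  assumes "U x 0 = 0" "U x 1 = 0" "U x 2 = 0" "U x 3 = 0" "W x 0 = 0" "W x 1 = 0" "W x 2 = 0" "W x 3 = 0"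
  shows "x = 0"
  using assms by (simp add: U_def W_def vec_eq_iff all_8)

definition zero :: "complex ^ 8 \<Rightarrow> bool" where
  "zero x \<longleftrightarrow> (\<forall>k. peval (quad y k) x = 0)"

lemma zero_eqs:
  assumes "zero x" shows "eqs (U x 0) (U x 2) (W x 0) (W x 2) (U x 1) (U x 3) (W x 1) (W x 3)"
proof -
  have "al * ((U x 0)\<^sup>2 + (U x 2)\<^sup>2) + be * ((W x 0)\<^sup>2 + (W x 2)\<^sup>2) - 2 * ga * U x 1 * U x 3
     = 4 * (peval (quad y 0) x + peval (quad y 2) x)"
    "be * ((U x 0)\<^sup>2 - (U x 2)\<^sup>2) + al * ((W x 0)\<^sup>2 - (W x 2)\<^sup>2) + 2 * ga * W x 1 * W x 3
     = 4 * (peval (quad y 0) x - peval (quad y 2) x)"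
    "al * ((U x 1)\<^sup>2 + (U x 3)\<^sup>2) + be * ((W x 1)\<^sup>2 + (W x 3)\<^sup>2) - 2 * ga * U x 0 * U x 2
     = 4 * (peval (quad y 1) x + peval (quad y 3) x)"
    "be * ((U x 1)\<^sup>2 - (U x 3)\<^sup>2) + al * ((W x 1)\<^sup>2 - (W x 3)\<^sup>2) - 2 * ga * W x 0 * W x 2
     = 4 * (peval (quad y 3) x - peval (quad y 1) x)"
    by (simp_all add: quad_explicit U_def W_def parameters power2_eq_square algebra_simps)
  then show ?thesis
    using assms by (simp add: zero_def eqs_def)
qed

text \<open>Coefficients indexed by all residues keep the notion equivariant under shifts. Since
  \<open>polar (k + 4) = polar k\<close>, nontriviality is a condition on the sums
  \<open>l k + l (k + 4)\<close>.\<close>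

definition sing :: "complex ^ 8 \<Rightarrow> bool" where
  "sing x \<longleftrightarrow> (\<exists>l. (\<exists>k. l k + l (k + 4) \<noteq> 0) \<and> (\<forall>v. (\<Sum>k\<in>UNIV. l k * polar k x v) = 0))"

lemma sing_iff:
  "sing x \<longleftrightarrow> (\<exists>l0 l1 l2 l3. \<not> (l0 = 0 \<and> l1 = 0 \<and> l2 = 0 \<and> l3 = 0) \<and>
     (\<forall>v. l0 * polar 0 x v + l1 * polar 1 x v + l2 * polar 2 x v + l3 * polar 3 x v = 0))"
proof
  assume "sing x"
  then obtain l k where k: "l k + l (k + 4) \<noteq> 0" and l: "\<And>v. (\<Sum>k\<in>UNIV. l k * polar k x v) = 0"
    by (auto simp: sing_def)
  have "\<not> (l 0 + l 4 = 0 \<and> l 1 + l 5 = 0 \<and> l 2 + l 6 = 0 \<and> l 3 + l 7 = 0)"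
    using k exhaust_8 [of k] by (auto simp: numerals_8 add.commute)
  moreover have "(l 0 + l 4) * polar 0 x v + (l 1 + l 5) * polar 1 x v + (l 2 + l 6) * polar 2 x v
     + (l 3 + l 7) * polar 3 x v = 0" for v
    using l [of v] by (simp add: sum_8 polar_numerals algebra_simps)
  ultimately show "\<exists>l0 l1 l2 l3. \<not> (l0 = 0 \<and> l1 = 0 \<and> l2 = 0 \<and> l3 = 0) \<and>
     (\<forall>v. l0 * polar 0 x v + l1 * polar 1 x v + l2 * polar 2 x v + l3 * polar 3 x v = 0)"
    by blast
next
  assume "\<exists>l0 l1 l2 l3. \<not> (l0 = 0 \<and> l1 = 0 \<and> l2 = 0 \<and> l3 = 0) \<and>
     (\<forall>v. l0 * polar 0 x v + l1 * polar 1 x v + l2 * polar 2 x v + l3 * polar 3 x v = 0)"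
  then obtain l0 l1 l2 l3 where nz: "\<not> (l0 = 0 \<and> l1 = 0 \<and> l2 = 0 \<and> l3 = 0)"
    and rel: "\<And>v. l0 * polar 0 x v + l1 * polar 1 x v + l2 * polar 2 x v + l3 * polar 3 x v = 0"
    by blast
  define l where "l k = (if k = 0 then l0 else if k = 1 then l1 else if k = 2 then l2 else if k = 3 then l3 else 0)" for k :: 8
  have l: "l 0 = l0" "l 1 = l1" "l 2 = l2" "l 3 = l3" "l 4 = 0" "l 5 = 0" "l 6 = 0" "l 7 = 0"
    by (simp_all add: l_def)
  have "\<exists>k\<in>{0, 1, 2, 3}. l k + l (k + 4) \<noteq> 0"
    using nz by (auto simp: l)
  moreover have "(\<Sum>k\<in>UNIV. l k * polar k x v) = 0" for v
    using rel [of v] by (simp add: sum_8 l)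
  ultimately show "sing x" unfolding sing_def by blast
qed

lemma sing_kernel:
  assumes "sing x"
  obtains a b c d where "\<not> (a = 0 \<and> b = 0 \<and> c = 0 \<and> d = 0)"
    "(al * a + be * b) * U x 0 = ga * c * U x 2" "(al * a - be * b) * U x 2 = ga * c * U x 0"
    "(be * a + al * b) * W x 0 = - ga * d * W x 2" "(be * a - al * b) * W x 2 = - ga * d * W x 0"
    "(al * c - be * d) * U x 1 = ga * a * U x 3" "(al * c + be * d) * U x 3 = ga * a * U x 1"
    "(be * c - al * d) * W x 1 = - ga * b * W x 3" "(be * c + al * d) * W x 3 = - ga * b * W x 1"
proof -
  obtain l0 l1 l2 l3 where nz: "\<not> (l0 = 0 \<and> l1 = 0 \<and> l2 = 0 \<and> l3 = 0)"
    and rel: "\<And>v. l0 * polar 0 x v + l1 * polar 1 x v + l2 * polar 2 x v + l3 * polar 3 x v = 0"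
    using assms unfolding sing_iff by blast
  define R where "R v = l0 * polar 0 x v + l1 * polar 1 x v + l2 * polar 2 x v + l3 * polar 3 x v" for v
  have R: "R v = 0" for v using rel by (simp add: R_def)
  \<comment> \<open>With these sums and differences, the relation evaluated at
    \<open>axis j 1 + axis (j + 4) 1\<close> or \<open>axis j 1 - axis (j + 4) 1\<close> involves a
    single block.\<close>
  define a b c d where abcd: "a = l0 + l2" "b = l0 - l2" "c = l1 + l3" "d = l1 - l3"
  note simps = R_def polar_explicit axis_def U_def W_def abcd parameters power2_eq_square
  have "(al * a + be * b) * U x 0 - ga * c * U x 2 = 2 * R (axis 0 1 + axis 4 1)"
    "(al * a - be * b) * U x 2 - ga * c * U x 0 = 2 * R (axis 2 1 + axis 6 1)"
    "(be * a + al * b) * W x 0 - (- ga * d * W x 2) = 2 * R (axis 0 1 - axis 4 1)"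
    "(be * a - al * b) * W x 2 - (- ga * d * W x 0) = 2 * R (axis 2 1 - axis 6 1)"
    by (simp_all add: simps algebra_simps)
  moreover have "(al * c - be * d) * U x 1 - ga * a * U x 3 = 2 * R (axis 1 1 + axis 5 1)"
    "(al * c + be * d) * U x 3 - ga * a * U x 1 = 2 * R (axis 3 1 + axis 7 1)"
    "(be * c - al * d) * W x 1 - (- ga * b * W x 3) = 2 * R (axis 1 1 - axis 5 1)"
    "(be * c + al * d) * W x 3 - (- ga * b * W x 1) = 2 * R (axis 3 1 - axis 7 1)"
    by (simp_all add: simps algebra_simps)
  moreover have "\<not> (a = 0 \<and> b = 0 \<and> c = 0 \<and> d = 0)"
    using nz by (auto simp: abcd)
  ultimately show ?thesis
    using that [of a b c d] unfolding R mult_zero_right right_minus_eq by blast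
qed

definition in_orbit :: "complex ^ 8 \<Rightarrow> bool" where
  "in_orbit x \<longleftrightarrow> (\<exists>t c b a. t \<noteq> 0 \<and> x = t *s act c b a y)"

lemma act_smult: "act c b a (t *s x) = t *s act c b a x"
  by (simp add: vec_eq_iff)

lemma act_plus: "act c b a (x + v) = act c b a x + act c b a v"
  by (simp add: vec_eq_iff distrib_left)

lemma in_orbitI: "t \<noteq> 0 \<Longrightarrow> act c b a x = t *s act c' b' a' y \<Longrightarrow> in_orbit x"
  unfolding in_orbit_def using act_inverse(2) [of c b a x] by (metis act_act act_smult)

lemma in_orbit_act: "in_orbit (act c b a x) \<longleftrightarrow> in_orbit x"
proof
  assume "in_orbit (act c b a x)"
  then show "in_orbit x" using in_orbitI unfolding in_orbit_def by blast
next
  assume "in_orbit x"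
  then obtain t c' b' a' where "t \<noteq> 0" "x = t *s act c' b' a' y" by (auto simp: in_orbit_def)
  then show "in_orbit (act c b a x)"
    unfolding in_orbit_def by (metis act_act act_smult)
qed

lemma zero_act: "zero x \<Longrightarrow> zero (act c b a x)"
  by (simp add: zero_def peval_quad_act)

lemma polar_act: "polar k (act c b a x) (act c b a v) = chi (c + c - b * (k + k)) * polar (k + a) x v"
  by (simp add: polar_def peval_quad_act right_diff_distrib flip: act_plus)

lemma sing_act:
  assumes "sing x" shows "sing (act c b a x)"
proof -
  obtain l k0 where k0: "l k0 + l (k0 + 4) \<noteq> 0" and l: "\<And>v. (\<Sum>k\<in>UNIV. l k * polar k x v) = 0"
    using assms by (auto simp: sing_def)
  define E where "E k = chi (c + c - b * (k + k))" for k
  have E: "E (k + 4) = E k" "E k \<noteq> 0" for k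
  proof -
    have "c + c - b * (k + 4 + (k + 4)) = c + c - b * (k + k)"
      using exhaust_8 [of b] by (auto simp: algebra_simps)
    then show "E (k + 4) = E k" "E k \<noteq> 0" by (simp_all only: E_def chi_nonzero not_False_eq_True)
  qed
  define m where "m k = l (k + a) / E k" for k
  have "(\<Sum>k\<in>UNIV. m k * polar k (act c b a x) v) = 0" for v
  proof -
    have "(\<Sum>k\<in>UNIV. m k * polar k (act c b a x) v)
      = (\<Sum>k\<in>UNIV. m k * polar k (act c b a x) (act c b a (act (- c - b * a) (- b) (- a) v)))"
      by (simp only: act_inverse)
    also have "\<dots> = (\<Sum>k\<in>UNIV. l (k + a) * polar (k + a) x (act (- c - b * a) (- b) (- a) v))"
      unfolding polar_act E_def [symmetric] using E by (simp add: m_def)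
    also have "\<dots> = 0"
      using l sum_shift [of "\<lambda>k. l k * polar k x (act (- c - b * a) (- b) (- a) v)" a] by simp
    finally show ?thesis .
  qed
  moreover have "m (k0 - a) + m (k0 - a + 4) \<noteq> 0"
  proof -
    have "k0 - a + 4 + a = k0 + 4" by simp
    then have "m (k0 - a) + m (k0 - a + 4) = (l k0 + l (k0 + 4)) / E (k0 - a)"
      by (simp add: m_def E add_divide_distrib)
    then show ?thesis using k0 E by simp
  qed
  ultimately show ?thesis unfolding sing_def by blast
qed

lemma act_nonzero: "x \<noteq> 0 \<Longrightarrow> act c b a x \<noteq> 0"
  using act_inverse(2) [of c b a x] by (metis act_smult vector_smult_lzero)

lemma chi_add_4: "chi (j + 4) = - chi j"
  by (simp add: chi_add chi_4)

lemma U_W_tau: "U (act 0 1 0 x) j = chi j * W x j" "W (act 0 1 0 x) j = chi j * U x j"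
  by (simp_all add: U_def W_def chi_add_4 algebra_simps)

lemma U_W_tau_2: "U (act 0 2 0 x) j = chi (2 * j) * U x j" "W (act 0 2 0 x) j = chi (2 * j) * W x j"
proof -
  have eq: "2 * (j + 4) = 2 * j" using exhaust_8 [of j] by auto
  show "U (act 0 2 0 x) j = chi (2 * j) * U x j" "W (act 0 2 0 x) j = chi (2 * j) * W x j"
    unfolding U_def W_def act_nth eq by (simp_all only: add_0 diff_zero distrib_left right_diff_distrib)
qed

lemma U_W_sigma:
  "U (act 0 0 1 x) 0 = U x 3" "U (act 0 0 1 x) 2 = U x 1"
  by (simp_all add: U_def minus_numerals_8)

lemma U_W_sigma_2:
  "U (act 0 0 2 x) 0 = U x 2" "U (act 0 0 2 x) 2 = U x 0" "U (act 0 0 2 x) 1 = U x 3" "U (act 0 0 2 x) 3 = U x 1"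
  "W (act 0 0 2 x) 0 = - W x 2" "W (act 0 0 2 x) 2 = W x 0" "W (act 0 0 2 x) 1 = - W x 3" "W (act 0 0 2 x) 3 = W x 1"
  by (simp_all add: U_def W_def minus_numerals_8)

section \<open>Explicit solution for the singular points\<close>

lemma components:
  "x $ 0 = (U x 0 + W x 0) / 2" "x $ 1 = (U x 1 + W x 1) / 2" "x $ 2 = (U x 2 + W x 2) / 2" "x $ 3 = (U x 3 + W x 3) / 2"
  "x $ 4 = (U x 0 - W x 0) / 2" "x $ 5 = (U x 1 - W x 1) / 2" "x $ 6 = (U x 2 - W x 2) / 2" "x $ 7 = (U x 3 - W x 3) / 2"
  by (simp_all add: U_def W_def)

text \<open>The hypotheses determine the coordinates up to scale and the signs of
  \<open>U x 1\<close> and \<open>W x 1\<close>. The four sign choices are, up to scalars, the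
  images of \<open>y\<close> under the four elements of \<open>H'\<close>.\<close>

lemma in_orbit_normalized:
  assumes x: "x \<noteq> 0" and z: "U x 0 = 0" "U x 2 = 0" "W x 0 = 0" "U x 3 = - U x 1" "W x 3 = W x 1"
    and e: "be * (W x 2)\<^sup>2 = - (2 * ga * (U x 1)\<^sup>2)" "al * (W x 2)\<^sup>2 = 2 * ga * (W x 1)\<^sup>2"
  shows "in_orbit x"
proof -
  have nW: "W x 2 \<noteq> 0"
  proof
    assume "W x 2 = 0"
    with e nz have "U x 1 = 0" "W x 1 = 0" by auto
    with z \<open>W x 2 = 0\<close> have "x = 0" by (intro U_W_zero) simp_all
    with x show False by simp
  qed
  \<comment> \<open>The coordinate \<open>W y 2\<close> of \<open>y\<close> is
    \<open>2 * y $ 2\<close>, so \<open>t\<close> is the scale.\<close>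
  define t where "t = W x 2 / (2 * y $ 2)"
  have t: "t \<noteq> 0" "W x 2 = 2 * t * y $ 2"
    using nW y123 by (auto simp: t_def)
  have "(U x 1)\<^sup>2 = (t * (y $ 1 - y $ 3))\<^sup>2"
  proof -
    have "4 * (y $ 2)\<^sup>2 * (U x 1)\<^sup>2 = 4 * (y $ 2)\<^sup>2 * (t * (y $ 1 - y $ 3))\<^sup>2"
      using e(1) unfolding t be ga by algebra
    then show ?thesis using y123 by simp
  qed
  then have U1: "U x 1 = t * (y $ 1 - y $ 3) \<or> U x 1 = - (t * (y $ 1 - y $ 3))"
    by (simp add: power2_eq_iff)
  have "(W x 1)\<^sup>2 = (t * (y $ 1 + y $ 3))\<^sup>2"
  proof -
    have "4 * (y $ 2)\<^sup>2 * (W x 1)\<^sup>2 = 4 * (y $ 2)\<^sup>2 * (t * (y $ 1 + y $ 3))\<^sup>2"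
      using e(2) unfolding t al ga by algebra
    then show ?thesis using y123 by simp
  qed
  then have W1: "W x 1 = t * (y $ 1 + y $ 3) \<or> W x 1 = - (t * (y $ 1 + y $ 3))"
    by (simp add: power2_eq_iff)
  note simps = vec_eq_iff all_8 components [of x] z t(2) iota_minus_nth [OF y] minus_numerals_8 numerals_8 chi_4
  consider "U x 1 = t * (y $ 1 - y $ 3)" "W x 1 = t * (y $ 1 + y $ 3)"
    | "U x 1 = - (t * (y $ 1 - y $ 3))" "W x 1 = - (t * (y $ 1 + y $ 3))"
    | "U x 1 = - (t * (y $ 1 - y $ 3))" "W x 1 = t * (y $ 1 + y $ 3)"
    | "U x 1 = t * (y $ 1 - y $ 3)" "W x 1 = - (t * (y $ 1 + y $ 3))"
    using U1 W1 by blast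
  then show ?thesis
  proof cases
    case 1
    have "x = t *s act 0 0 0 y"
      by (simp add: simps 1 field_simps)
    with t(1) show ?thesis unfolding in_orbit_def by blast
  next
    case 2
    have "x = t *s act 0 4 0 y"
      by (simp add: simps 2 field_simps)
    with t(1) show ?thesis unfolding in_orbit_def by blast
  next
    case 3
    have "x = (- t) *s act 0 0 4 y"
      by (simp add: simps 3 field_simps)
    with t(1) show ?thesis unfolding in_orbit_def by (metis neg_equal_0_iff_equal)
  next
    case 4
    have "x = (- t) *s act 0 4 4 y"
      by (simp add: simps 4 field_simps)
    with t(1) show ?thesis unfolding in_orbit_def by (metis neg_equal_0_iff_equal)
  qed
qed

text \<open>Equal signs in \<open>U x 3 = h * U x 1\<close> and \<open>W x 3 = h * W x 1\<close>
  contradict the third equation. Of the two patterns with opposite signs, one is normalized and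
  \<open>act 0 2 0\<close> carries the other one to it.\<close>

lemma in_orbit_one_block:
  assumes x: "x \<noteq> 0" "zero x" and z: "U x 0 = 0" "U x 2 = 0" "W x 0 = 0"
    and sq: "(U x 1)\<^sup>2 = (U x 3)\<^sup>2" "(W x 1)\<^sup>2 = (W x 3)\<^sup>2"
  shows "in_orbit x"
proof -
  have e: "be * (W x 2)\<^sup>2 = 2 * ga * U x 1 * U x 3" "al * (W x 2)\<^sup>2 = 2 * ga * W x 1 * W x 3"
    "al * ((U x 1)\<^sup>2 + (U x 3)\<^sup>2) + be * ((W x 1)\<^sup>2 + (W x 3)\<^sup>2) = 0"
    using zero_eqs [OF x(2)] z by (simp_all add: eqs_def)
  have impossible: False if "U x 3 = h * U x 1" "W x 3 = h * W x 1" "h = 1 \<or> h = - 1" for h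
  proof -
    have h: "h\<^sup>2 = 1" using that(3) by auto
    \<comment> \<open>Multiply the first two equations by \<open>al\<close> and \<open>be\<close>
      and add; the third equation makes the right-hand side zero.\<close>
    have "4 * al * be * (W x 2)\<^sup>2 = 0"
      using e h unfolding that(1,2) by algebra
    then have "W x 2 = 0" using nz by auto
    with e that nz have "U x 1 = 0" "W x 1 = 0" by auto
    with that \<open>W x 2 = 0\<close> z have "x = 0" by (intro U_W_zero) simp_all
    with x show False by simp
  qed
  have "U x 3 = U x 1 \<or> U x 3 = - U x 1" "W x 3 = W x 1 \<or> W x 3 = - W x 1"
    using sq by (auto simp: power2_eq_iff)
  then consider "U x 3 = - U x 1" "W x 3 = W x 1" | "U x 3 = U x 1" "W x 3 = - W x 1"
    using impossible [of 1] impossible [of "- 1"] by auto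
  then show ?thesis
  proof cases
    case 1
    then show ?thesis
      using e by (intro in_orbit_normalized x z) (simp_all add: power2_eq_square)
  next
    case 2
    have "chi 2 * chi 2 = - 1" using chi_add [of 2 2] chi_4 by simp
    then have c2: "(chi 2)\<^sup>2 = - 1" by (simp add: power2_eq_square)
    have c6: "chi 6 = - chi 2" using chi_add_4 [of 2] by simp
    let ?x = "act 0 2 0 x"
    have "in_orbit ?x"
    proof (rule in_orbit_normalized)
      show "?x \<noteq> 0" by (rule act_nonzero [OF x(1)])
      show "be * (W ?x 2)\<^sup>2 = - (2 * ga * (U ?x 1)\<^sup>2)" "al * (W ?x 2)\<^sup>2 = 2 * ga * (W ?x 1)\<^sup>2"
        using e(1,2) 2 by (simp_all add: U_W_tau_2 power_mult_distrib c2 chi_4) (simp_all add: power2_eq_square)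
    qed (simp_all add: U_W_tau_2 z 2 c6)
    then show ?thesis by (simp only: in_orbit_act)
  qed
qed

text \<open>The other three blocks are nonzero, so three discriminants vanish and
  \<open>three_blocks\<close> gives \<open>d = 0\<close>. This equates the squares within the odd
  blocks and kills one coordinate of the remaining even block; if it is \<open>W x 2\<close>, then
  \<open>act 0 0 2\<close> exchanges it with \<open>W x 0\<close>.\<close>

lemma in_orbit_block:
  assumes x: "x \<noteq> 0" "zero x" "sing x" and z: "U x 0 = 0" "U x 2 = 0"
  shows "in_orbit x"
proof -
  note blocks = two_zero_blocks [OF zero_eqs [OF x(2)]]
  have W02: "W x 0 \<noteq> 0 \<or> W x 2 \<noteq> 0"
    using blocks(2) z x(1) U_W_zero [of x] by blast
  have U13: "U x 1 \<noteq> 0 \<or> U x 3 \<noteq> 0"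
    using blocks(4) z x(1) U_W_zero [of x] by blast
  have W13: "W x 1 \<noteq> 0 \<or> W x 3 \<noteq> 0"
    using blocks(6) z x(1) U_W_zero [of x] by blast
  obtain a b c d where nz': "\<not> (a = 0 \<and> b = 0 \<and> c = 0 \<and> d = 0)" and
    k: "(be * a + al * b) * W x 0 = - ga * d * W x 2" "(be * a - al * b) * W x 2 = - ga * d * W x 0"
    "(al * c - be * d) * U x 1 = ga * a * U x 3" "(al * c + be * d) * U x 3 = ga * a * U x 1"
    "(be * c - al * d) * W x 1 = - ga * b * W x 3" "(be * c + al * d) * W x 3 = - ga * b * W x 1"
    by (rule sing_kernel [OF x(3)]) (rule that; assumption)
  have "d = 0 \<and> a \<noteq> 0 \<and> b \<noteq> 0 \<and> c \<noteq> 0"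
    using kernel_2x2 [OF k(1,2) W02] kernel_2x2 [OF k(3,4) U13] kernel_2x2 [OF k(5,6) W13] nz'
    by (intro three_blocks) simp_all
  then have d: "d = 0" "a \<noteq> 0" "b \<noteq> 0" "c \<noteq> 0" by auto
  have "al * c * ((U x 1)\<^sup>2 - (U x 3)\<^sup>2) = 0" "be * c * ((W x 1)\<^sup>2 - (W x 3)\<^sup>2) = 0"
    using k unfolding d by algebra+
  then have sq: "(U x 1)\<^sup>2 = (U x 3)\<^sup>2" "(W x 1)\<^sup>2 = (W x 3)\<^sup>2"
    using nz d by auto
  show ?thesis
  proof (cases "W x 0 = 0")
    case True
    with x z sq show ?thesis by (intro in_orbit_one_block)
  next
    case False
    then have "be * a + al * b = 0" using k(1) d by simp
    have "W x 2 = 0"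
    proof (rule ccontr)
      assume "W x 2 \<noteq> 0"
      then have "be * a - al * b = 0" using k(2) d by simp
      with \<open>be * a + al * b = 0\<close> have "2 * be * a = 0" by algebra
      with nz d show False by simp
    qed
    have "in_orbit (act 0 0 2 x)"
      using \<open>W x 2 = 0\<close> z sq by (intro in_orbit_one_block act_nonzero zero_act x) (simp_all add: U_W_sigma_2)
    then show ?thesis by (simp only: in_orbit_act)
  qed
qed

lemma in_orbit_sing:
  assumes x: "x \<noteq> 0" "zero x" "sing x"
  shows "in_orbit x"
proof -
  obtain a b c d where nz': "\<not> (a = 0 \<and> b = 0 \<and> c = 0 \<and> d = 0)" and
    k: "(al * a + be * b) * U x 0 = ga * c * U x 2" "(al * a - be * b) * U x 2 = ga * c * U x 0"
    "(be * a + al * b) * W x 0 = - ga * d * W x 2" "(be * a - al * b) * W x 2 = - ga * d * W x 0"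
    "(al * c - be * d) * U x 1 = ga * a * U x 3" "(al * c + be * d) * U x 3 = ga * a * U x 1"
    "(be * c - al * d) * W x 1 = - ga * b * W x 3" "(be * c + al * d) * W x 3 = - ga * b * W x 1"
    by (rule sing_kernel [OF x(3)]) (rule that; assumption)
  consider "U x 0 = 0" "U x 2 = 0" | "W x 0 = 0" "W x 2 = 0" | "U x 1 = 0" "U x 3 = 0" | "W x 1 = 0" "W x 3 = 0"
  proof -
    have False if "U x 0 \<noteq> 0 \<or> U x 2 \<noteq> 0" "W x 0 \<noteq> 0 \<or> W x 2 \<noteq> 0" "U x 1 \<noteq> 0 \<or> U x 3 \<noteq> 0" "W x 1 \<noteq> 0 \<or> W x 3 \<noteq> 0"
      using kernel_2x2 [OF k(1,2) that(1)] kernel_2x2 [OF k(3,4) that(2)] kernel_2x2 [OF k(5,6) that(3)]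
        kernel_2x2 [OF k(7,8) that(4)] nz' no_four_blocks [of a b c d] by simp
    then show ?thesis using that by blast
  qed
  then show ?thesis
  proof cases
    case 1
    with x show ?thesis by (intro in_orbit_block)
  next
    case 2
    then have "in_orbit (act 0 1 0 x)"
      by (intro in_orbit_block act_nonzero zero_act sing_act x) (simp_all add: U_W_tau)
    then show ?thesis by (simp only: in_orbit_act)
  next
    case 3
    then have "in_orbit (act 0 0 1 x)"
      by (intro in_orbit_block act_nonzero zero_act sing_act x) (simp_all add: U_W_sigma)
    then show ?thesis by (simp only: in_orbit_act)
  next
    case 4
    then have "in_orbit (act 0 0 1 (act 0 1 0 x))"
      by (intro in_orbit_block act_nonzero zero_act sing_act x) (simp_all add: U_W_sigma U_W_tau)
    then show ?thesis by (simp only: in_orbit_act)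
  qed
qed

section \<open>The orbit of \<open>y\<close> as singular locus, and its size\<close>

lemma zero_y: "zero y"
  using peval_quad_self [OF y] by (simp add: zero_def)

lemma sing_y: "sing y"
  unfolding sing_iff
proof (intro exI conjI allI)
  \<comment> \<open>In the notation of \<open>sing_kernel\<close> these coefficients are
    \<open>a = al\<close>, \<open>b = be\<close>, \<open>c = - ga\<close>,
    \<open>d = 0\<close>.\<close>
  show "\<not> (2 * par_p y = 0 \<and> - par_q y = 0 \<and> par_s y = 0 \<and> - par_q y = 0)"
    using par_nonzero by simp
  show "2 * par_p y * polar 0 y v + - par_q y * polar 1 y v + par_s y * polar 2 y v + - par_q y * polar 3 y v = 0" for v
    by (simp add: polar_explicit iota_minus_nth [OF y] par_p_def par_q_def par_s_def power2_eq_square algebra_simps)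
qed

lemma zero_smult: "zero x \<Longrightarrow> zero (t *s x)"
  by (simp add: zero_def peval_homogeneous_smult [OF homogeneous_quad])

lemma sing_smult: "sing x \<Longrightarrow> sing (t *s x)"
proof -
  assume "sing x"
  then obtain l0 l1 l2 l3 where nz: "\<not> (l0 = 0 \<and> l1 = 0 \<and> l2 = 0 \<and> l3 = 0)"
    and rel: "\<And>v. l0 * polar 0 x v + l1 * polar 1 x v + l2 * polar 2 x v + l3 * polar 3 x v = 0"
    unfolding sing_iff by blast
  have "l0 * polar 0 (t *s x) v + l1 * polar 1 (t *s x) v + l2 * polar 2 (t *s x) v + l3 * polar 3 (t *s x) v = 0" for v
    unfolding polar_linear using rel [of v] by algebra
  with nz show "sing (t *s x)" unfolding sing_iff by blast
qed

lemma in_orbit_zero: "in_orbit x \<Longrightarrow> zero x"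
  and in_orbit_sing': "in_orbit x \<Longrightarrow> sing x"
  and in_orbit_nonzero: "in_orbit x \<Longrightarrow> x \<noteq> 0"
  using act_nonzero [OF y_nonzero] by (auto simp: in_orbit_def intro!: zero_smult zero_act zero_y sing_smult sing_act sing_y)

lemma act_proj_pt: "act c b a ` proj_pt x = proj_pt (act c b a x)"
proof -
  have "proj_pt x = (\<lambda>t. t *s x) ` (- {0})" for x :: "complex ^ 8"
    by (auto simp: proj_pt_def)
  then show ?thesis by (simp add: image_image act_smult)
qed

lemma in_orbit_act_y: "in_orbit (act c b a y)"
proof -
  have "act c b a y = 1 *s act c b a y" by simp
  then show ?thesis unfolding in_orbit_def using zero_neq_one by metis
qed

lemma H8_orbit_eq: "H8_orbit (proj_pt y) = {proj_pt x | x. in_orbit x}"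
proof (intro equalityI subsetI)
  fix z assume "z \<in> H8_orbit (proj_pt y)"
  then obtain h where "h \<in> H8" "z = h ` proj_pt y" by (auto simp: H8_orbit_def)
  moreover from H8_act [OF this(1)] obtain c b a where "h = act c b a" by blast
  ultimately have "z = proj_pt (act c b a y)" by (simp add: act_proj_pt)
  then show "z \<in> {proj_pt x | x. in_orbit x}"
    using in_orbit_act_y by blast
next
  fix z assume "z \<in> {proj_pt x | x. in_orbit x}"
  then obtain t c b a where t: "t \<noteq> 0" "z = proj_pt (t *s act c b a y)" by (auto simp: in_orbit_def)
  obtain c' where c': "act c' b a \<in> H8" using act_in_H8 by blast
  have "act c b a y = chi (c - c') *s act c' b a y"
    by (simp add: vec_eq_iff flip: mult.assoc chi_add)
  then have "z = act c' b a ` proj_pt y"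
    using t by (simp add: proj_pt_smult act_proj_pt)
  then show "z \<in> H8_orbit (proj_pt y)"
    using c' by (auto simp: H8_orbit_def)
qed

lemma proj_zeros_V8: "proj_pt x \<in> proj_zeros (V8 (proj_pt y)) \<longleftrightarrow> x \<noteq> 0 \<and> zero x"
proof
  assume z: "proj_pt x \<in> proj_zeros (V8 (proj_pt y))"
  then have "zero x"
    using V8_quad_in mem_proj_pt [of x] by (auto simp: zero_def proj_zeros_def vanishes_at_def)
  moreover have "x \<noteq> 0"
  proof
    assume "x = 0"
    from z obtain w :: "complex ^ 8" where "w \<noteq> 0" "proj_pt x = proj_pt w"
      by (auto simp: proj_zeros_def proj_space_def)
    with mem_proj_pt [of w] \<open>x = 0\<close> show False by (auto simp: proj_pt_def)
  qed
  ultimately show "x \<noteq> 0 \<and> zero x" by simp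
next
  assume x: "x \<noteq> 0 \<and> zero x"
  then have "peval q (c *s x) = 0" if "q \<in> V8 (proj_pt y)" for q c
    using that zero_smult [of x c] unfolding V8_eq [OF y y123(2)]
    by (intro peval_ideal_gen_zero [of q]) (auto simp: zero_def)
  then show "proj_pt x \<in> proj_zeros (V8 (proj_pt y))"
    using x by (auto simp: proj_zeros_def proj_space_def vanishes_at_def proj_pt_def)
qed

text \<open>The local dimension is 3 at every closed point, so singular means that the tangent space
  of the cone has dimension above 4, that is, that the four polar equations are dependent.\<close>

lemma singular_iff:
  assumes "x \<noteq> 0" "zero x"
  shows "proj_pt x \<in> singular_points (V8 (proj_pt y)) \<longleftrightarrow> sing x"
proof -
  have z: "\<And>k. peval (quad y k) x = 0" using assms by (simp add: zero_def)
  have "proj_pt x \<in> singular_points (V8 (proj_pt y)) \<longleftrightarrow> 4 < vec.dim {v. \<forall>k. polar k x v = 0}"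
    using assms proj_zeros_V8 [of x] local_dim_V8 [OF z assms(1)] cone_tangent_V8 [OF z]
    by (simp add: singular_points_def one_enat_def numeral_eq_enat)
  also have "\<dots> \<longleftrightarrow> sing x"
  proof
    assume dim: "4 < vec.dim {v. \<forall>k. polar k x v = 0}"
    show "sing x"
    proof (rule ccontr)
      assume neg: "\<not> sing x"
      have "vec.dim {v. \<forall>k. polar k x v = 0} = 4"
      proof (rule dim_tangent_le, rule ccontr)
        fix l0 l1 l2 l3
        assume rel: "\<And>v. l0 * polar 0 x v + l1 * polar 1 x v + l2 * polar 2 x v + l3 * polar 3 x v = 0"
          and "\<not> (l0 = 0 \<and> l1 = 0 \<and> l2 = 0 \<and> l3 = 0)"
        then have "sing x"
          unfolding sing_iff by (intro exI [of _ l0] exI [of _ l1] exI [of _ l2] exI [of _ l3] conjI allI)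
        with neg show False by contradiction
      qed
      with dim show False by simp
    qed
  next
    assume "sing x"
    then obtain l0 l1 l2 l3 where nz: "\<not> (l0 = 0 \<and> l1 = 0 \<and> l2 = 0 \<and> l3 = 0)"
      and rel: "\<And>v. l0 * polar 0 x v + l1 * polar 1 x v + l2 * polar 2 x v + l3 * polar 3 x v = 0"
      unfolding sing_iff by blast
    from dim_tangent_ge [OF rel nz] show "4 < vec.dim {v. \<forall>k. polar k x v = 0}"
      by linarith
  qed
  finally show ?thesis .
qed

lemma singular_points_V8: "singular_points (V8 (proj_pt y)) = H8_orbit (proj_pt y)"
proof (intro equalityI subsetI)
  fix z assume z: "z \<in> singular_points (V8 (proj_pt y))"
  then obtain x where x: "z = proj_pt x"
    by (auto simp: singular_points_def proj_zeros_def proj_space_def)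
  then have "x \<noteq> 0" "zero x"
    using z proj_zeros_V8 by (auto simp: singular_points_def)
  then have "in_orbit x"
    using z singular_iff x by (intro in_orbit_sing) auto
  then show "z \<in> H8_orbit (proj_pt y)"
    using x by (auto simp: H8_orbit_eq)
next
  fix z assume "z \<in> H8_orbit (proj_pt y)"
  then obtain x where "z = proj_pt x" "in_orbit x" by (auto simp: H8_orbit_eq)
  then show "z \<in> singular_points (V8 (proj_pt y))"
    using singular_iff in_orbit_zero in_orbit_sing' in_orbit_nonzero by auto
qed

text \<open>A stabilizing shift preserves the zero coordinates of \<open>y\<close>, which have index
  0 and 4. For shift 0 the coordinates 1 and 2 pin down the character; shift 4 would make
  \<open>y $ 3\<close> equal to \<open>y $ 1\<close> up to sign, against \<open>al\<close> and
  \<open>be\<close> being nonzero.\<close>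

lemma act_y_eqD:
  assumes "act c b a y = t *s y" shows "a = 0 \<and> b = 0"
proof -
  have e: "chi (c + b * i) * y $ (i - a) = t * y $ i" for i
    using assms by (simp add: vec_eq_iff)
  define K X where "K = chi (c + b)" and "X = chi b"
  have nK: "K \<noteq> 0" "X \<noteq> 0" by (simp_all add: K_def X_def)
  have chi2: "chi (c + b * 2) = K * X" and chi5: "chi (c + b * 5) = K * (X * X * (X * X))"
    unfolding K_def X_def chi_add [symmetric] by (rule arg_cong [of _ _ chi], use exhaust_8 [of b] in auto)+
  have "y $ (- a) = 0"
    using e [of 0] iota_minus_nth [OF y] by simp
  with exhaust_8 [of a] have "a = 0 \<or> a = 4"
    using iota_minus_nth [OF y] y123 by (auto simp: minus_numerals_8)
  then show ?thesis
  proof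
    assume a: "a = 0"
    have "K = t" "K * X = t"
      using e [of 1] e [of 2] y123 chi2 by (simp_all add: a K_def)
    then have "X = 1" using nK by simp
    with a show ?thesis by (simp add: X_def chi_eq_1_iff)
  next
    assume a: "a = 4"
    have eqs: "- (K * y $ 3) = t * y $ 1" "- (K * X * y $ 2) = t * y $ 2"
      "K * (X * X * (X * X)) * y $ 1 = - (t * y $ 3)"
      using e [of 1] e [of 2] e [of 5] iota_minus_nth [OF y] chi2 chi5 by (simp_all add: a minus_numerals_8 numerals_8 K_def)
    have "(t + K * X) * y $ 2 = 0"
      using eqs(2) by algebra
    then have "t + K * X = 0" using y123 by simp
    then have t: "t = - (K * X)" by (simp add: eq_neg_iff_add_eq_0)
    have "K * (y $ 3 - X * y $ 1) = 0"
      using eqs(1) unfolding t by algebra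
    then have y3: "y $ 3 = X * y $ 1" using nK by simp
    have "K * X * X * y $ 1 * (X\<^sup>2 - 1) = 0"
      using eqs(3) unfolding t y3 by algebra
    then have "X\<^sup>2 = 1" using nK y123 by simp
    then have "(y $ 1 + y $ 3) * (y $ 1 - y $ 3) = 0"
      unfolding y3 by algebra
    with nz al be show ?thesis by auto
  qed
qed

lemma card_orbit: "card (H8_orbit (proj_pt y)) = 64"
proof -
  define f where "f = (\<lambda>(b, a). proj_pt (act 0 b a y))"
  have "H8_orbit (proj_pt y) = range f"
  proof (intro equalityI subsetI)
    fix z assume "z \<in> H8_orbit (proj_pt y)"
    then obtain t c b a where "t \<noteq> 0" "z = proj_pt (t *s act c b a y)"
      by (auto simp: H8_orbit_eq in_orbit_def)
    moreover have "act c b a y = chi c *s act 0 b a y"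
      by (simp add: vec_eq_iff chi_add)
    ultimately have "z = f (b, a)" by (simp add: proj_pt_smult f_def)
    then show "z \<in> range f" by blast
  next
    fix z assume "z \<in> range f"
    then obtain b a where "z = proj_pt (act 0 b a y)" by (auto simp: f_def)
    then show "z \<in> H8_orbit (proj_pt y)"
      unfolding H8_orbit_eq using in_orbit_act_y by blast
  qed
  moreover have "inj f"
  proof (rule injI, clarify)
    fix b a b' a' assume "f (b, a) = f (b', a')"
    then obtain t where t: "act 0 b a y = t *s act 0 b' a' y"
      using mem_proj_pt [of "act 0 b a y"] by (auto simp: f_def proj_pt_def)
    have "act (- 0 - b' * a') (- b') (- a') (act 0 b a y) = t *s y"
      unfolding t act_smult act_inverse ..
    then have "- a' + a = 0 \<and> - b' + b = 0"
      unfolding act_act by (rule act_y_eqD)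
    then show "b = b' \<and> a = a'" by simp
  qed
  ultimately show ?thesis
    by (simp add: card_image card_cartesian_product flip: UNIV_Times_UNIV)
qed

end

section \<open>Formal power series\<close>

lemma mps_eqI: "(\<And>m. mps_coeff f m = mps_coeff g m) \<Longrightarrow> f = g"
  by (metis ext mps_coeff_inject)

lemma mps_coeff_simps [simp]:
  "mps_coeff 0 m = 0" "mps_coeff (f + g) m = mps_coeff f m + mps_coeff g m"
  "mps_coeff (f - g) m = mps_coeff f m - mps_coeff g m" "mps_coeff (- f) m = - mps_coeff f m"
  "mps_coeff (1 :: 'v::finite mps) m = (if m = 0 then 1 else 0)"
  "mps_coeff (mps_const c :: 'v mps) m = (if m = 0 then c else 0)"
  "mps_coeff (mps_var i) m = (if m = single i 1 then 1 else 0)" for f g :: "'v::finite mps"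
  by (simp_all add: zero_mps.rep_eq plus_mps.rep_eq minus_mps.rep_eq uminus_mps.rep_eq one_mps.rep_eq
      mps_const.rep_eq mps_var.rep_eq)

lemma mps_coeff_mult: "mps_coeff (f * g) m = (\<Sum>p\<in>splits m. mps_coeff f (fst p) * mps_coeff g (snd p))"
  by (simp add: times_mps.rep_eq case_prod_unfold)

lemma splits_0: "splits (0 :: 'v \<Rightarrow>\<^sub>0 nat) = {(0, 0)}"
proof -
  have "a = 0 \<and> b = 0" if "a + b = 0" for a b :: "'v \<Rightarrow>\<^sub>0 nat"
  proof -
    have "lookup a k + lookup b k = 0" for k
      unfolding lookup_add [symmetric] that by simp
    then show ?thesis by (auto intro!: poly_mapping_eqI)
  qed
  note * = this
  show ?thesis
  proof (intro equalityI subsetI)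
    fix p :: "('v \<Rightarrow>\<^sub>0 nat) \<times> ('v \<Rightarrow>\<^sub>0 nat)" assume "p \<in> splits 0"
    then have "fst p + snd p = 0"
      by (simp add: splits_def case_prod_unfold)
    from * [OF this] show "p \<in> {(0, 0)}"
      by (simp add: prod_eq_iff)
  qed (simp add: splits_def)
qed

lemma splits_mdegree:
  fixes m :: "'v::finite \<Rightarrow>\<^sub>0 nat"
  assumes "p \<in> splits m"
  shows "fst p \<noteq> 0 \<Longrightarrow> mdegree (snd p) < mdegree m" "snd p \<noteq> 0 \<Longrightarrow> mdegree (fst p) < mdegree m"
    "fst p = 0 \<Longrightarrow> p = (0, m)" "snd p = 0 \<Longrightarrow> p = (m, 0)"
proof -
  have "mdegree m = mdegree (fst p) + mdegree (snd p)"
    using assms by (auto simp: splits_def mdegree_add)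
  then show "fst p \<noteq> 0 \<Longrightarrow> mdegree (snd p) < mdegree m" "snd p \<noteq> 0 \<Longrightarrow> mdegree (fst p) < mdegree m"
    using mdegree_eq_0_iff by auto
  show "fst p = 0 \<Longrightarrow> p = (0, m)" "snd p = 0 \<Longrightarrow> p = (m, 0)"
    using assms by (auto simp: splits_def prod_eq_iff)
qed

lemma splits_single:
  "splits (single j 1 :: 'v::finite \<Rightarrow>\<^sub>0 nat) = {(0, single j 1), (single j 1, 0)}"
proof -
  have "p = (0, single j 1) \<or> p = (single j 1, 0)"
    if p: "p \<in> splits (single j 1)" for p :: "('v \<Rightarrow>\<^sub>0 nat) \<times> ('v \<Rightarrow>\<^sub>0 nat)"
  proof (cases "fst p = 0")
    case False
    with splits_mdegree(1) [OF p] have "snd p = 0" by (simp add: mdegree_eq_0_iff)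
    with splits_mdegree(4) [OF p] show ?thesis by simp
  qed (use splits_mdegree(3) [OF p] in simp)
  then show ?thesis by (auto simp: splits_def)
qed

lemma mps_coeff_mult_0: "mps_coeff (f * g) 0 = mps_coeff f 0 * mps_coeff g 0"
  for f g :: "'v::finite mps"
  by (simp add: mps_coeff_mult splits_0)

lemma single_neq_0: "single j (1::nat) \<noteq> 0"
  by (metis lookup_single_eq lookup_zero zero_neq_one)

lemma single_1_eq_iff: "single i (1::nat) = single j 1 \<longleftrightarrow> i = j"
  by (metis lookup_single_eq lookup_single_not_eq zero_neq_one)

lemma mps_coeff_mult_single:
  "mps_coeff (f * g) (single j 1) = mps_coeff f 0 * mps_coeff g (single j 1)
     + mps_coeff f (single j 1) * mps_coeff g 0"
  for f g :: "'v::finite mps"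
  unfolding mps_coeff_mult splits_single using single_neq_0 [of j] by (subst sum.insert) auto

text \<open>Coefficient \<open>m\<close> of \<open>f * g = 1\<close>, solved for the coefficient of
  \<open>g\<close> at \<open>m\<close>, which occurs only in the removed pair
  \<open>(0, m)\<close>.\<close>

function inverse_coeff :: "(('v::finite \<Rightarrow>\<^sub>0 nat) \<Rightarrow> complex) \<Rightarrow> ('v \<Rightarrow>\<^sub>0 nat) \<Rightarrow> complex" where
  "inverse_coeff f m = (if m = 0 then 1 / f 0
     else - (\<Sum>p\<in>splits m - {(0, m)}. f (fst p) * inverse_coeff f (snd p)) / f 0)"
  by auto
termination
proof (relation "Wellfounded.measure (\<lambda>(f, m). mdegree m)")
  fix f :: "('v::finite \<Rightarrow>\<^sub>0 nat) \<Rightarrow> complex" and m :: "'v \<Rightarrow>\<^sub>0 nat" and p assume "p \<in> splits m - {(0, m)}"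
  then show "((f, snd p), f, m) \<in> Wellfounded.measure (\<lambda>(f, m). mdegree m)"
    using splits_mdegree [of p m] by auto
qed simp

declare inverse_coeff.simps [simp del]

lemma mps_inverse:
  fixes f :: "'v::finite mps" assumes "mps_coeff f 0 \<noteq> 0"
  obtains g where "f * g = 1"
proof
  let ?g = "Abs_mps (inverse_coeff (mps_coeff f))"
  show "f * ?g = 1"
  proof (rule mps_eqI)
    fix m
    have "mps_coeff (f * ?g) m = (\<Sum>p\<in>splits m. mps_coeff f (fst p) * inverse_coeff (mps_coeff f) (snd p))"
      by (simp add: mps_coeff_mult Abs_mps_inverse)
    also have "\<dots> = mps_coeff f 0 * inverse_coeff (mps_coeff f) m
       + (\<Sum>p\<in>splits m - {(0, m)}. mps_coeff f (fst p) * inverse_coeff (mps_coeff f) (snd p))"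
      by (subst sum.remove [of _ "(0, m)"]) (simp, simp add: splits_def, simp)
    also have "\<dots> = mps_coeff 1 m"
    proof (cases "m = 0")
      case True
      then show ?thesis
        using assms by (simp add: splits_0 inverse_coeff.simps [of _ 0])
    next
      case False
      then show ?thesis
        using assms by (simp add: inverse_coeff.simps [of _ m])
    qed
    finally show "mps_coeff (f * ?g) m = mps_coeff 1 m" .
  qed
qed

text \<open>Coefficient \<open>m\<close> of \<open>g * g = f\<close>, solved for the coefficient of
  \<open>g\<close> at \<open>m\<close>. For \<open>m \<noteq> 0\<close> it occurs in exactly the two
  removed pairs, whence the factor 2.\<close>

function sqrt_coeff :: "(('v::finite \<Rightarrow>\<^sub>0 nat) \<Rightarrow> complex) \<Rightarrow> ('v \<Rightarrow>\<^sub>0 nat) \<Rightarrow> complex" where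
  "sqrt_coeff f m = (if m = 0 then csqrt (f 0)
     else (f m - (\<Sum>p\<in>splits m - {(0, m), (m, 0)}. sqrt_coeff f (fst p) * sqrt_coeff f (snd p))) / (2 * csqrt (f 0)))"
  by auto
termination
proof (relation "Wellfounded.measure (\<lambda>(f, m). mdegree m)")
  fix f :: "('v::finite \<Rightarrow>\<^sub>0 nat) \<Rightarrow> complex" and m :: "'v \<Rightarrow>\<^sub>0 nat" and p assume "p \<in> splits m - {(0, m), (m, 0)}"
  then show "((f, fst p), f, m) \<in> Wellfounded.measure (\<lambda>(f, m). mdegree m)"
    "((f, snd p), f, m) \<in> Wellfounded.measure (\<lambda>(f, m). mdegree m)"
    using splits_mdegree [of p m] by auto
qed simp

declare sqrt_coeff.simps [simp del]

lemma mps_sqrt: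
  fixes f :: "'v::finite mps" assumes "mps_coeff f 0 \<noteq> 0"
  obtains g where "g * g = f" "mps_coeff g 0 \<noteq> 0"
proof
  let ?s = "sqrt_coeff (mps_coeff f)"
  let ?g = "Abs_mps ?s"
  have nz: "csqrt (mps_coeff f 0) \<noteq> 0" using assms by simp
  show "mps_coeff ?g 0 \<noteq> 0"
    using nz by (simp add: Abs_mps_inverse sqrt_coeff.simps [of _ 0])
  show "?g * ?g = f"
  proof (rule mps_eqI)
    fix m
    have g: "mps_coeff (?g * ?g) m = (\<Sum>p\<in>splits m. ?s (fst p) * ?s (snd p))"
      by (simp add: mps_coeff_mult Abs_mps_inverse)
    show "mps_coeff (?g * ?g) m = mps_coeff f m"
    proof (cases "m = 0")
      case True
      have "csqrt (mps_coeff f 0) * csqrt (mps_coeff f 0) = mps_coeff f 0"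
        by (metis power2_csqrt power2_eq_square)
      with g show ?thesis
        by (simp add: True splits_0 sqrt_coeff.simps [of _ 0])
    next
      case False
      have "(\<Sum>p\<in>splits m. ?s (fst p) * ?s (snd p))
        = (\<Sum>p\<in>{(0, m), (m, 0)}. ?s (fst p) * ?s (snd p)) + (\<Sum>p\<in>splits m - {(0, m), (m, 0)}. ?s (fst p) * ?s (snd p))"
      proof -
        have "{(0, m), (m, 0)} \<subseteq> splits m" by (simp add: splits_def)
        from sum.subset_diff [OF this, of "\<lambda>p. ?s (fst p) * ?s (snd p)"] show ?thesis
          by (simp only: finite_splits add.commute)
      qed
      also have "(\<Sum>p\<in>{(0, m), (m, 0)}. ?s (fst p) * ?s (snd p)) = 2 * csqrt (mps_coeff f 0) * ?s m"
        using False by (simp add: sqrt_coeff.simps [of _ 0])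
      also have "\<dots> = mps_coeff f m - (\<Sum>p\<in>splits m - {(0, m), (m, 0)}. ?s (fst p) * ?s (snd p))"
        using False nz by (simp add: sqrt_coeff.simps [of _ m])
      finally show ?thesis unfolding g by simp
    qed
  qed
qed

section \<open>Linear parts and formal coordinates\<close>

definition linear_part :: "'v::finite mps \<Rightarrow> complex ^ 'v \<Rightarrow> complex" where
  "linear_part f w = (\<Sum>j\<in>UNIV. mps_coeff f (single j 1) * w $ j)"

lemma linear_part_simps [simp]:
  "linear_part (f + g) w = linear_part f w + linear_part g w"
  "linear_part (f - g) w = linear_part f w - linear_part g w"
  "linear_part (- f) w = - linear_part f w"
  "linear_part (mps_const c) w = 0"
  "linear_part (mps_var i) w = w $ i"
  "linear_part (f * g) w = mps_coeff f 0 * linear_part g w + mps_coeff g 0 * linear_part f w"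
proof -
  have "(\<Sum>j\<in>UNIV. mps_coeff (mps_var i) (single j 1) * w $ j) = (\<Sum>j\<in>UNIV. if j = i then w $ i else 0)"
    by (rule sum.cong) (auto simp: single_1_eq_iff simp del: One_nat_def)
  then show "linear_part (mps_var i) w = w $ i"
    by (simp add: linear_part_def)
  show "linear_part (mps_const c) w = 0"
    by (simp add: linear_part_def single_neq_0 del: One_nat_def)
  show "linear_part (f * g) w = mps_coeff f 0 * linear_part g w + mps_coeff g 0 * linear_part f w"
    unfolding linear_part_def mps_coeff_mult_single sum_distrib_left sum.distrib [symmetric]
    by (rule sum.cong) (simp_all add: algebra_simps)
qed (simp_all add: linear_part_def distrib_right left_diff_distrib sum.distrib sum_subtractf sum_negf)

text \<open>Invertibility of the Jacobian matrix becomes triviality of a common kernel, which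
  elimination can check.\<close>

lemma formal_coordinates_iff:
  "formal_coordinates \<phi> \<longleftrightarrow> (\<forall>i. mps_coeff (\<phi> i) 0 = 0) \<and> (\<forall>w. (\<forall>i. linear_part (\<phi> i) w = 0) \<longrightarrow> w = 0)"
proof -
  have "(\<chi> i j. mps_coeff (\<phi> i) (single j 1)) *v w = 0 \<longleftrightarrow> (\<forall>i. linear_part (\<phi> i) w = 0)" for w
    by (simp add: vec_eq_iff matrix_vector_mult_def linear_part_def)
  then show ?thesis
    unfolding formal_coordinates_def invertible_left_inverse matrix_left_invertible_ker by simp
qed

lemma ideal_gen_eqI:
  assumes "\<And>g. g \<in> G \<Longrightarrow> g \<in> ideal_gen H" "\<And>h. h \<in> H \<Longrightarrow> h \<in> ideal_gen G"
  shows "ideal_gen G = ideal_gen (H :: 'a::comm_ring_1 set)"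
  using assms by (intro antisym ideal.span_minimal ideal.subspace_span) auto

lemma mps_const_mult_inverse: "c \<noteq> 0 \<Longrightarrow> mps_const (1 / c) * (mps_const c * f) = (f :: 'v::finite mps)"
  by (simp flip: mult.assoc emps.cmult)

lemma mps_const_simps:
  "mps_const (- a) = - (mps_const a :: 'v::finite mps)" "mps_const (a - b) = mps_const a - (mps_const b :: 'v mps)"
  "mps_const (numeral n) = (numeral n :: 'v mps)"
proof -
  show *: "mps_const (- a) = - (mps_const a :: 'v mps)" for a
    using emps.cadd [of a "- a"] by (simp add: eq_neg_iff_add_eq_0 add.commute)
  show "mps_const (a - b) = mps_const a - (mps_const b :: 'v mps)"
  proof -
    have "mps_const (a + - b) = mps_const a + (mps_const (- b) :: 'v mps)"
      by (rule emps.cadd)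
    then show ?thesis by (simp only: * diff_conv_add_uminus)
  qed
  have "mps_const (of_nat k) = (of_nat k :: 'v mps)" for k
    by (induction k) (simp_all add: emps.cadd)
  from this [of "numeral n"] show "mps_const (numeral n) = (numeral n :: 'v mps)" by simp
qed

lemma in_ideal_mps_const:
  assumes "mps_const c * f \<in> ideal_gen G" "c \<noteq> 0" shows "f \<in> ideal_gen (G :: 'v::finite mps set)"
  using ideal.span_scale [OF assms(1), of "mps_const (1 / c)"] by (simp add: mps_const_mult_inverse assms(2))

section \<open>Ordinary double points\<close>

text \<open>The ring identities that change from the quadrics \<open>\<sigma>\<^sup>k f\<close> near \<open>y\<close> to the coordinates \<open>u\<^sub>j\<close>, \<open>v\<^sub>j\<close>,
  where \<open>c\<^sub>i\<close> stands for \<open>y\<^sub>i\<close>.\<close>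

lemma quadric_combinations:
  fixes c1 c2 c3 :: "'a::comm_ring_1" and x :: "8 \<Rightarrow> 'a"
  defines "z \<equiv> \<lambda>k. qform (c1 * c3) (c2 * c2) (c1 * c1 + c3 * c3) x k"
    and "al \<equiv> (c1 + c3) * (c1 + c3)" and "be \<equiv> - ((c1 - c3) * (c1 - c3))" and "ga \<equiv> 2 * (c2 * c2)"
    and "u0 \<equiv> x 0 + x 4" and "u2 \<equiv> x 2 + x 6" and "v0 \<equiv> x 0 - x 4" and "V \<equiv> x 2 - x 6"
    and "P \<equiv> x 1 + x 5 + (x 3 + x 7)" and "D \<equiv> x 1 + x 5 - (x 3 + x 7)"
    and "R \<equiv> x 1 - x 5 - (x 3 - x 7)" and "E \<equiv> x 1 - x 5 + (x 3 - x 7)"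
  shows "2 * al * (u0 * u0 + u2 * u2) + 2 * be * (v0 * v0 + V * V) - ga * (P * P - D * D) = 8 * (z 0 + z 2)"
    "2 * be * (u0 * u0 - u2 * u2) + 2 * al * (v0 * v0 - V * V) + ga * (E * E - R * R) = 8 * (z 0 - z 2)"
    "al * (P * P + D * D) + be * (E * E + R * R) - 4 * ga * (u0 * u2) = 8 * (z 1 + z 3)"
    "be * (P * D) + al * (R * E) - 2 * ga * (v0 * V) = 4 * (z 3 - z 1)"
  unfolding assms by (simp_all add: qform_def minus_numerals_8 power2_eq_square algebra_simps)

section \<open>Local equations in coordinates adapted to the double point\<close>

context V8_general
begin

text \<open>The displacements \<open>X\<close> remain arbitrary, so that at another point of the
  orbit they can absorb the group element.\<close>

definition formal_quad :: "(8 \<Rightarrow> 8 mps) \<Rightarrow> 8 \<Rightarrow> 8 mps" where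
  "formal_quad X = qform (mps_const (par_p y)) (mps_const (par_q y)) (mps_const (par_s y)) (\<lambda>i. mps_const (y $ i) + X i)"

context
  fixes X :: "8 \<Rightarrow> 8 mps"
  assumes X: "formal_coordinates X"
begin

text \<open>These are the coordinates \<open>U\<close> and \<open>W\<close> near \<open>y\<close>.
  In the odd blocks they are replaced by sums and differences, since at \<open>y\<close> the two
  entries there are opposite or equal. Only \<open>V\<close>, \<open>D\<close> and \<open>E\<close>
  are nonzero at \<open>y\<close>, so exactly these three are units.\<close>

definition "u0 = X 0 + X 4"
definition "u2 = X 2 + X 6"
definition "v0 = X 0 - X 4"
definition "V = mps_const (2 * y $ 2) + X 2 - X 6"
definition "P = X 1 + X 5 + X 3 + X 7"
definition "D = mps_const (2 * (y $ 1 - y $ 3)) + X 1 + X 5 - X 3 - X 7"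
definition "R = X 1 - X 5 - X 3 + X 7"
definition "E = mps_const (2 * (y $ 1 + y $ 3)) + X 1 - X 5 + X 3 - X 7"

definition "Qa = mps_const (2 * al) * (u0 * u0 + u2 * u2) + mps_const (2 * be) * (v0 * v0 + V * V)
  - mps_const ga * (P * P - D * D)"
definition "Qb = mps_const (2 * be) * (u0 * u0 - u2 * u2) + mps_const (2 * al) * (v0 * v0 - V * V)
  + mps_const ga * (E * E - R * R)"
definition "Qc = mps_const al * (P * P + D * D) + mps_const be * (E * E + R * R) - mps_const (4 * ga) * (u0 * u2)"
definition "Qd = mps_const be * (P * D) + mps_const al * (R * E) - mps_const (2 * ga) * (v0 * V)"
text \<open>Half of \<open>al * Qa + be * Qb - ga * Qc\<close>, the quadric that is singular at
  \<open>y\<close>. The squares of the units \<open>V\<close>, \<open>D\<close>, \<open>E\<close>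
  cancel, so only terms of order at least two remain.\<close>

definition "Ql = mps_const (al\<^sup>2 + be\<^sup>2) * (u0 * u0) + mps_const (2 * ga\<^sup>2) * (u0 * u2) + mps_const (al\<^sup>2 - be\<^sup>2) * (u2 * u2)
  + mps_const (2 * al * be) * (v0 * v0) - mps_const (ga * al) * (P * P) - mps_const (ga * be) * (R * R)"

lemma X_0: "mps_coeff (X i) 0 = 0"
  using X by (simp add: formal_coordinates_def)

lemma constant_terms:
  "mps_coeff u0 0 = 0" "mps_coeff u2 0 = 0" "mps_coeff v0 0 = 0" "mps_coeff P 0 = 0" "mps_coeff R 0 = 0"
  "mps_coeff V 0 = 2 * y $ 2" "mps_coeff D 0 = 2 * (y $ 1 - y $ 3)" "mps_coeff E 0 = 2 * (y $ 1 + y $ 3)"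
  by (simp_all add: u0_def u2_def v0_def P_def R_def V_def D_def E_def X_0)

lemma y_nz: "y $ 1 - y $ 3 \<noteq> 0" "y $ 1 + y $ 3 \<noteq> 0"
  using nz al be by auto

lemma Q_eqs:
  "Qa = mps_const 8 * (formal_quad X 0 + formal_quad X 2)" "Qb = mps_const 8 * (formal_quad X 0 - formal_quad X 2)"
  "Qc = mps_const 8 * (formal_quad X 1 + formal_quad X 3)" "Qd = mps_const 4 * (formal_quad X 3 - formal_quad X 1)"
proof -
  let ?z = "\<lambda>i. mps_const (y $ i) + X i" and ?c = "\<lambda>i. mps_const (y $ i)"
  note q = quadric_combinations [where ?c1.0 = "?c 1" and ?c2.0 = "?c 2" and ?c3.0 = "?c 3" and x = ?z]
  have par: "?c 1 * ?c 3 = mps_const (par_p y)" "?c 2 * ?c 2 = mps_const (par_q y)"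
    "?c 1 * ?c 1 + ?c 3 * ?c 3 = mps_const (par_s y)"
    "(?c 1 + ?c 3) * (?c 1 + ?c 3) = mps_const al" "- ((?c 1 - ?c 3) * (?c 1 - ?c 3)) = mps_const be"
    "2 * mps_const (par_q y) = mps_const ga"
    by (simp_all add: parameters power2_eq_square mps_const_simps emps.cmult emps.cadd)
  have z: "?z 0 + ?z 4 = u0" "?z 2 + ?z 6 = u2" "?z 0 - ?z 4 = v0" "?z 2 - ?z 6 = V"
    "?z 1 + ?z 5 + (?z 3 + ?z 7) = P" "?z 1 + ?z 5 - (?z 3 + ?z 7) = D"
    "?z 1 - ?z 5 - (?z 3 - ?z 7) = R" "?z 1 - ?z 5 + (?z 3 - ?z 7) = E"
    by (simp_all add: u0_def u2_def v0_def V_def P_def D_def R_def E_def iota_minus_nth [OF y]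
        mps_const_simps emps.cmult emps.cadd algebra_simps)
  show "Qa = mps_const 8 * (formal_quad X 0 + formal_quad X 2)" "Qb = mps_const 8 * (formal_quad X 0 - formal_quad X 2)"
    "Qc = mps_const 8 * (formal_quad X 1 + formal_quad X 3)" "Qd = mps_const 4 * (formal_quad X 3 - formal_quad X 1)"
    using q [unfolded par z, folded formal_quad_def]
    unfolding Qa_def Qb_def Qc_def Qd_def by (simp_all only: emps.cmult mps_const_simps)
qed

lemma Ql_eq: "mps_const 2 * Ql = mps_const al * Qa + mps_const be * Qb - mps_const ga * Qc"
  unfolding Ql_def Qa_def Qb_def Qc_def
  by (simp add: emps.cmult emps.cadd mps_const_simps power2_eq_square algebra_simps)

lemma formal_quad_add_4: "formal_quad X (k + 4) = formal_quad X k"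
  by (simp add: formal_quad_def qform_add_4)

text \<open>\<open>Qc\<close> can be traded for \<open>Ql\<close> because \<open>ga\<close> is
  nonzero; the other changes of generators only divide by powers of 2.\<close>

lemma ideal_Q:
  "ideal_gen (insert (X 2) (range (formal_quad X))) = ideal_gen {X 2, Qa, Qb, Qd, Ql}"
    (is "ideal_gen ?G = ideal_gen ?H")
proof (rule ideal_gen_eqI)
  have f: "formal_quad X k \<in> ideal_gen ?G" for k
    by (intro ideal.span_base) auto
  have Qc: "Qc \<in> ideal_gen ?G" and Qab: "Qa \<in> ideal_gen ?G" "Qb \<in> ideal_gen ?G" "Qd \<in> ideal_gen ?G"
    unfolding Q_eqs by (intro ideal.span_scale ideal.span_add ideal.span_diff f)+
  then have "mps_const 2 * Ql \<in> ideal_gen ?G"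
    unfolding Ql_eq by (intro ideal.span_scale ideal.span_add ideal.span_diff)
  then have "Ql \<in> ideal_gen ?G"
    by (rule in_ideal_mps_const) simp
  with Qab show "h \<in> ideal_gen ?G" if "h \<in> ?H" for h
    using that by (auto intro: ideal.span_base)
  have h: "Qa \<in> ideal_gen ?H" "Qb \<in> ideal_gen ?H" "Qd \<in> ideal_gen ?H" "Ql \<in> ideal_gen ?H" "X 2 \<in> ideal_gen ?H"
    by (intro ideal.span_base; simp)+
  have "mps_const ga * Qc = mps_const al * Qa + mps_const be * Qb - mps_const 2 * Ql"
    unfolding Ql_eq by simp
  also have "\<dots> \<in> ideal_gen ?H"
    by (intro ideal.span_scale ideal.span_add ideal.span_diff h)
  finally have hc: "Qc \<in> ideal_gen ?H"
    by (rule in_ideal_mps_const) (rule nz)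
  have "mps_const 16 * formal_quad X 0 = Qa + Qb" "mps_const 16 * formal_quad X 2 = Qa - Qb"
    "mps_const 16 * formal_quad X 1 = Qc - mps_const 2 * Qd" "mps_const 16 * formal_quad X 3 = Qc + mps_const 2 * Qd"
    unfolding Q_eqs by (simp_all add: mps_const_simps algebra_simps)
  then have "mps_const 16 * formal_quad X 0 \<in> ideal_gen ?H" "mps_const 16 * formal_quad X 1 \<in> ideal_gen ?H"
    "mps_const 16 * formal_quad X 2 \<in> ideal_gen ?H" "mps_const 16 * formal_quad X 3 \<in> ideal_gen ?H"
    by (simp_all only: ideal.span_scale ideal.span_add ideal.span_diff h hc)
  then have q: "formal_quad X 0 \<in> ideal_gen ?H" "formal_quad X 1 \<in> ideal_gen ?H"
    "formal_quad X 2 \<in> ideal_gen ?H" "formal_quad X 3 \<in> ideal_gen ?H"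
    by (auto intro: in_ideal_mps_const)
  have "formal_quad X 4 = formal_quad X 0" "formal_quad X 5 = formal_quad X 1"
    "formal_quad X 6 = formal_quad X 2" "formal_quad X 7 = formal_quad X 3"
    using formal_quad_add_4 [of 0] formal_quad_add_4 [of 1] formal_quad_add_4 [of 2] formal_quad_add_4 [of 3] by simp_all
  with q have "formal_quad X k \<in> ideal_gen ?H" for k
    using exhaust_8 [of k] by auto
  with h(5) show "g \<in> ideal_gen ?H" if "g \<in> ?G" for g
    using that by auto
qed

text \<open>Modulo \<open>Qd\<close>, the coordinate \<open>v0\<close> is a combination of \<open>P\<close> and \<open>R\<close>, and \<open>Ql\<close> becomes a
  nondegenerate quadratic form in \<open>u0\<close>, \<open>u2\<close>, \<open>P\<close>, \<open>R\<close> with power series coefficients. Completing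
  squares needs roots of units.\<close>

lemma double_point:
  "\<exists>\<phi> A. formal_coordinates \<phi> \<and> card A = 4 \<and>
     ideal_gen (insert (X 2) (range (formal_quad X))) = ideal_gen (insert (\<Sum>i\<in>A. (\<phi> i)\<^sup>2) (\<phi> ` (- A)))"
proof -
  obtain Vi where Vi: "V * Vi = 1"
    using mps_inverse [of V] y123 by (auto simp: constant_terms)
  \<comment> \<open>\<open>V\<close> is a unit, so \<open>Qd\<close> can be solved for
    \<open>v0\<close>; \<open>M\<close> is the inverse of \<open>2 * ga * V\<close>.\<close>
  define M where "M = mps_const (1 / (2 * ga)) * Vi"
  define Qt where "Qt = mps_const be * (P * D) + mps_const al * (R * E)"
  have v0: "v0 = M * Qt - M * Qd"
  proof -
    have "M * Qt - M * Qd = (mps_const (1 / (2 * ga)) * mps_const (2 * ga)) * (V * Vi) * v0"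
      by (simp add: M_def Qt_def Qd_def algebra_simps)
    then show ?thesis
      using nz by (simp add: Vi flip: emps.cmult)
  qed
  define c11 where "c11 = mps_const (2 * al * be ^ 3) * (M * M * (D * D)) - mps_const (ga * al)"
  define c12 where "c12 = mps_const (2 * al\<^sup>2 * be\<^sup>2) * (M * M * (D * E))"
  define c22 where "c22 = mps_const (2 * al ^ 3 * be) * (M * M * (E * E)) - mps_const (ga * be)"
  \<comment> \<open>The value is \<open>1 / (8 * ga ^ 3)\<close>, since \<open>V\<close> has
    constant term \<open>2 * y $ 2\<close> and \<open>ga\<close> is twice the square of
    \<open>y $ 2\<close>.\<close>
  define T where "T = mps_coeff M 0 * mps_coeff M 0"
  have T: "T * (8 * ga ^ 3) = 1"
  proof -
    have "mps_coeff V 0 * mps_coeff Vi 0 = 1"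
      using arg_cong [OF Vi, of "\<lambda>f. mps_coeff f 0"] by (simp add: mps_coeff_mult_0)
    then have "mps_coeff M 0 * (4 * ga * y $ 2) = 1"
      using nz by (simp add: M_def mps_coeff_mult_0 constant_terms field_simps)
    then have "T * (16 * ga\<^sup>2 * (y $ 2)\<^sup>2) = 1"
      unfolding T_def by algebra
    then show ?thesis unfolding ga by algebra
  qed
  have c0: "mps_coeff c11 0 = 2 * al * be ^ 3 * T * (- 4 * be) - ga * al"
    "mps_coeff c22 0 = 2 * al ^ 3 * be * T * (4 * al) - ga * be"
    "(mps_coeff c12 0)\<^sup>2 = 4 * al ^ 4 * be ^ 4 * T\<^sup>2 * (- 16 * al * be)"
    by (simp_all add: c11_def c22_def c12_def mps_coeff_mult_0 constant_terms T_def al be power2_eq_square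
        power3_eq_cube power4_eq_xxxx algebra_simps)
  have "ga ^ 3 * mps_coeff c11 0 = - (al * (be ^ 4 + ga ^ 4))"
    unfolding c0 using T by algebra
  then have c11_nz: "mps_coeff c11 0 \<noteq> 0"
    using nz gen by auto
  have "ga\<^sup>2 * (mps_coeff c11 0 * mps_coeff c22 0 - (mps_coeff c12 0)\<^sup>2) * (8 * ga ^ 3 * T) * (8 * ga ^ 3 * T)
     = al * be * (be ^ 4 + ga ^ 4 - al ^ 4) * (8 * ga ^ 3 * T) * (8 * ga ^ 3 * T)"
    unfolding c0 using T by algebra
  \<comment> \<open>As \<open>8 * ga ^ 3 * T\<close> is 1, the determinant at the origin is
    \<open>al * be * (be ^ 4 + ga ^ 4 - al ^ 4)\<close> divided by the square of
    \<open>ga\<close>.\<close>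
  then have det_nz: "mps_coeff c11 0 * mps_coeff c22 0 - (mps_coeff c12 0)\<^sup>2 \<noteq> 0"
    using nz gen T by (auto simp: mult.commute)
  obtain s1 where s1: "s1 * s1 = c11" "mps_coeff s1 0 \<noteq> 0"
    using mps_sqrt [OF c11_nz] by blast
  obtain s1i where s1i: "s1 * s1i = 1"
    using mps_inverse [OF s1(2)] by blast
  \<comment> \<open>The Schur complement of \<open>c11\<close> in the matrix of the form in
    \<open>P\<close> and \<open>R\<close>, a unit because the determinant is one.\<close>
  define w where "w = c22 - c12 * c12 * (s1i * s1i)"
  have "mps_coeff w 0 \<noteq> 0"
  proof -
    have "c11 * w = c11 * c22 - c12 * c12 * ((s1 * s1i) * (s1 * s1i))"
      unfolding w_def s1(1) [symmetric] by (simp add: algebra_simps)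
    then have "c11 * w = c11 * c22 - c12 * c12"
      by (simp add: s1i)
    from arg_cong [OF this, of "\<lambda>f. mps_coeff f 0"] det_nz show ?thesis
      by (auto simp: mps_coeff_mult_0 power2_eq_square)
  qed
  then obtain s2 where s2: "s2 * s2 = w" "mps_coeff s2 0 \<noteq> 0"
    using mps_sqrt by blast
  have e11_nz: "al\<^sup>2 + be\<^sup>2 \<noteq> 0"
  proof
    assume "al\<^sup>2 + be\<^sup>2 = 0"
    then have "al ^ 4 = be ^ 4" by algebra
    with gen show False by simp
  qed
  define r1 where "r1 = csqrt (al\<^sup>2 + be\<^sup>2)"
  have r1: "r1 * r1 = al\<^sup>2 + be\<^sup>2" "r1 \<noteq> 0"
    using e11_nz power2_csqrt [of "al\<^sup>2 + be\<^sup>2"] by (auto simp: r1_def power2_eq_square)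
  \<comment> \<open>The same Schur complement for the form in \<open>u0\<close> and
    \<open>u2\<close> with constant coefficients, whose determinant is
    \<open>al ^ 4 - be ^ 4 - ga ^ 4\<close>.\<close>
  define e where "e = al\<^sup>2 - be\<^sup>2 - (ga\<^sup>2 / r1) * (ga\<^sup>2 / r1)"
  have "e * (al\<^sup>2 + be\<^sup>2) = al ^ 4 - (be ^ 4 + ga ^ 4)"
  proof -
    have "(ga\<^sup>2 / r1) * (ga\<^sup>2 / r1) * (r1 * r1) = ga ^ 4"
      using r1(2) by (simp add: power2_eq_square power4_eq_xxxx)
    then show ?thesis unfolding e_def r1(1) by algebra
  qed
  then have "e \<noteq> 0" using gen by auto
  define r2 where "r2 = csqrt e"
  have r2: "r2 * r2 = e" "r2 \<noteq> 0"
    using \<open>e \<noteq> 0\<close> power2_csqrt [of e] by (auto simp: r2_def power2_eq_square)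
  define f0 f1 f3 f4 where "f0 = mps_const r1 * u0 + mps_const (ga\<^sup>2 / r1) * u2" and "f1 = mps_const r2 * u2"
    and "f3 = s1 * P + c12 * s1i * R" and "f4 = s2 * R"
  \<comment> \<open>Positions 0, 1, 3, 4 carry the four squares and 2 keeps the chart coordinate.
    Positions 5, 6, 7 take the equations with independent linear parts, which cut out a smooth germ
    of dimension 4 in the chart.\<close>
  define \<phi> where "\<phi> i = (if i = 2 then X 2 else if i = 5 then Qd else if i = 6 then Qa else if i = 7 then Qb
    else if i = 0 then f0 else if i = 1 then f1 else if i = 3 then f3 else f4)" for i :: 8
  have \<phi>: "\<phi> 0 = f0" "\<phi> 1 = f1" "\<phi> 2 = X 2" "\<phi> 3 = f3" "\<phi> 4 = f4" "\<phi> 5 = Qd" "\<phi> 6 = Qa" "\<phi> 7 = Qb"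
    by (simp_all add: \<phi>_def)
  define A where "A = {0, 1, 3, 4 :: 8}"
  have A: "- A = {2, 5, 6, 7}"
    using UNIV_8 by (auto simp: A_def)
  define S where "S = (\<Sum>i\<in>A. (\<phi> i)\<^sup>2)"
  have S: "S = f0 * f0 + f1 * f1 + (f3 * f3 + f4 * f4)"
    by (simp add: S_def A_def \<phi> power2_eq_square add_ac)
  have f01: "f0 * f0 + f1 * f1 = mps_const (al\<^sup>2 + be\<^sup>2) * (u0 * u0) + mps_const (2 * ga\<^sup>2) * (u0 * u2)
    + mps_const (al\<^sup>2 - be\<^sup>2) * (u2 * u2)"
  proof -
    have "f0 * f0 + f1 * f1 = mps_const (r1 * r1) * (u0 * u0) + mps_const (2 * (r1 * (ga\<^sup>2 / r1))) * (u0 * u2)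
      + mps_const ((ga\<^sup>2 / r1) * (ga\<^sup>2 / r1) + r2 * r2) * (u2 * u2)"
      unfolding f0_def f1_def emps.cmult emps.cadd mps_const_simps by (simp add: algebra_simps)
    moreover have "(ga\<^sup>2 / r1) * (ga\<^sup>2 / r1) + r2 * r2 = al\<^sup>2 - be\<^sup>2"
      unfolding r2 e_def by simp
    moreover have "r1 * (ga\<^sup>2 / r1) = ga\<^sup>2"
      using r1(2) by simp
    ultimately show ?thesis by (simp only: r1(1))
  qed
  have f34: "f3 * f3 + f4 * f4 = c11 * (P * P) + 2 * c12 * (P * R) + c22 * (R * R)"
  proof -
    have "f3 * f3 + f4 * f4 = s1 * s1 * (P * P) + 2 * c12 * (s1 * s1i) * (P * R)
      + (c12 * c12 * (s1i * s1i) + s2 * s2) * (R * R)"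
      unfolding f3_def f4_def by (simp add: algebra_simps)
    then show ?thesis
      by (simp add: s1 s1i s2 w_def)
  qed
  have QtQt: "mps_const (2 * al * be) * ((M * Qt) * (M * Qt)) - mps_const (ga * al) * (P * P) - mps_const (ga * be) * (R * R)
    = c11 * (P * P) + 2 * c12 * (P * R) + c22 * (R * R)"
    unfolding c11_def c12_def c22_def Qt_def
    by (simp add: emps.cmult mps_const_simps power2_eq_square power3_eq_cube algebra_simps)
  have "Ql - S = mps_const (2 * al * be) * (v0 * v0 - (M * Qt) * (M * Qt))"
    unfolding Ql_def S f01 f34 QtQt [symmetric] by (simp add: algebra_simps)
  also have "\<dots> = - (mps_const (2 * al * be) * M * (v0 + M * Qt)) * Qd"
  proof -
    have "v0 * v0 - (M * Qt) * (M * Qt) = (v0 - M * Qt) * (v0 + M * Qt)"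
      by (simp add: algebra_simps)
    also have "v0 - M * Qt = - (M * Qd)"
      using v0 by simp
    finally show ?thesis by (simp add: mult_ac)
  qed
  finally have diff: "Ql - S = - (mps_const (2 * al * be) * M * (v0 + M * Qt)) * Qd" .
  have img: "\<phi> ` (- A) = {X 2, Qd, Qa, Qb}"
    unfolding A by (simp add: \<phi>)
  have ideal: "ideal_gen {X 2, Qa, Qb, Qd, Ql} = ideal_gen (insert S (\<phi> ` (- A)))"
    unfolding img
  proof (rule ideal_gen_eqI)
    let ?H = "insert S {X 2, Qd, Qa, Qb}" and ?G = "{X 2, Qa, Qb, Qd, Ql}"
    have "S + (Ql - S) \<in> ideal_gen ?H"
      unfolding diff by (intro ideal.span_add ideal.span_scale ideal.span_base) auto
    then have "Ql \<in> ideal_gen ?H" by simp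
    then show "g \<in> ideal_gen ?H" if "g \<in> ?G" for g
      using that by (auto intro: ideal.span_base)
    have "Ql - (Ql - S) \<in> ideal_gen ?G"
      unfolding diff by (intro ideal.span_diff ideal.span_scale ideal.span_base) auto
    then have "S \<in> ideal_gen ?G" by simp
    then show "h \<in> ideal_gen ?G" if "h \<in> ?H" for h
      using that by (auto intro: ideal.span_base)
  qed
  have "formal_coordinates \<phi>"
    unfolding formal_coordinates_iff
  proof (intro conjI allI impI)
    have sq: "(y $ 2)\<^sup>2 = ga / 2" "(y $ 1 - y $ 3)\<^sup>2 = - be" "(y $ 1 + y $ 3)\<^sup>2 = al"
      by (simp_all add: ga be al)
    have "mps_coeff Qa 0 = 8 * be * (y $ 2)\<^sup>2 + 4 * ga * (y $ 1 - y $ 3)\<^sup>2"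
      "mps_coeff Qb 0 = 4 * ga * (y $ 1 + y $ 3)\<^sup>2 - 8 * al * (y $ 2)\<^sup>2" "mps_coeff Qd 0 = 0"
      by (simp_all add: Qa_def Qb_def Qd_def mps_coeff_mult_0 constant_terms power2_eq_square algebra_simps)
    then have "mps_coeff Qa 0 = 0" "mps_coeff Qb 0 = 0" "mps_coeff Qd 0 = 0"
      unfolding sq by simp_all
    moreover have "mps_coeff f0 0 = 0" "mps_coeff f1 0 = 0" "mps_coeff f3 0 = 0" "mps_coeff f4 0 = 0"
      by (simp_all add: f0_def f1_def f3_def f4_def mps_coeff_mult_0 constant_terms)
    ultimately have "\<forall>i. mps_coeff (\<phi> i) 0 = 0"
      by (simp add: all_8 \<phi> X_0)
    then show "mps_coeff (\<phi> i) 0 = 0" for i by blast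
    \<comment> \<open>The elimination is triangular: \<open>f1\<close> and \<open>f0\<close> give
      \<open>u2\<close> and \<open>u0\<close>, and with \<open>X 2\<close> also \<open>V\<close>;
      then \<open>Qa\<close> and \<open>Qb\<close> give \<open>D\<close> and \<open>E\<close>,
      \<open>f4\<close> and \<open>f3\<close> give \<open>R\<close> and \<open>P\<close>, and
      \<open>Qd\<close> gives \<open>v0\<close>.\<close>
    fix v assume v: "\<forall>i. linear_part (\<phi> i) v = 0"
    then have l: "linear_part f0 v = 0" "linear_part f1 v = 0" "linear_part (X 2) v = 0" "linear_part f3 v = 0"
      "linear_part f4 v = 0" "linear_part Qd v = 0" "linear_part Qa v = 0" "linear_part Qb v = 0"
      by (simp_all add: all_8 \<phi>)
    let ?l = "\<lambda>f. linear_part f v"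
    have u2: "?l u2 = 0"
      using l(2) r2 by (simp add: f1_def constant_terms)
    have u0: "?l u0 = 0"
      using l(1) r1 u2 by (simp add: f0_def constant_terms)
    have X6: "?l (X 6) = 0"
      using u2 l(3) by (simp add: u2_def)
    then have V: "?l V = 0"
      using l(3) by (simp add: V_def)
    have D: "?l D = 0"
      using l(7) V nz y_nz by (simp add: Qa_def constant_terms)
    have E: "?l E = 0"
      using l(8) V nz y_nz by (simp add: Qb_def constant_terms del: distrib_left_numeral)
    have R: "?l R = 0"
      using l(5) s2 by (simp add: f4_def constant_terms)
    have P: "?l P = 0"
      using l(4) s1 R by (simp add: f3_def constant_terms mps_coeff_mult_0)
    have v0: "?l v0 = 0"
      using l(6) P D R E V nz y123 by (simp add: Qd_def constant_terms)
    have "?l (X 0) = 0 \<and> ?l (X 4) = 0"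
    proof -
      have "?l (X 0) + ?l (X 4) = 0" "?l (X 0) - ?l (X 4) = 0"
        using u0 v0 by (simp_all add: u0_def v0_def)
      then have "2 * ?l (X 0) = 0" "2 * ?l (X 4) = 0" by algebra+
      then show ?thesis by simp
    qed
    moreover have "?l (X 1) = 0 \<and> ?l (X 3) = 0 \<and> ?l (X 5) = 0 \<and> ?l (X 7) = 0"
    proof -
      have "?l (X 1) + ?l (X 5) + ?l (X 3) + ?l (X 7) = 0" "?l (X 1) + ?l (X 5) - ?l (X 3) - ?l (X 7) = 0"
        "?l (X 1) - ?l (X 5) - ?l (X 3) + ?l (X 7) = 0" "?l (X 1) - ?l (X 5) + ?l (X 3) - ?l (X 7) = 0"
        using P D R E by (simp_all add: P_def D_def R_def E_def)
      then have "4 * ?l (X 1) = 0" "4 * ?l (X 3) = 0" "4 * ?l (X 5) = 0" "4 * ?l (X 7) = 0" by algebra+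
      then show ?thesis by simp
    qed
    ultimately have "\<forall>i. linear_part (X i) v = 0"
      using X6 l(3) by (simp add: all_8)
    then show "v = 0"
      using X by (simp add: formal_coordinates_iff)
  qed
  moreover have "card A = 4" by (simp add: A_def)
  ultimately show ?thesis
    using ideal ideal_Q unfolding S_def by metis
qed

end

section \<open>Taylor expansions and transport along the orbit\<close>

lemma formal_ideal_V8:
  "formal_ideal (V8 (proj_pt y)) x k = ideal_gen (insert (mps_var k) (range (\<lambda>j. taylor x (quad y j))))"
  unfolding formal_ideal_def V8_eq [OF y y123(2)]
proof (rule ideal_gen_eqI)
  let ?H = "insert (mps_var k) (range (\<lambda>j. taylor x (quad y j)))"
  fix g assume "g \<in> insert (mps_var k) (taylor x ` ideal_gen (range (quad y)))"
  then consider "g = mps_var k" | q where "q \<in> ideal_gen (range (quad y))" "g = taylor x q" by blast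
  then show "g \<in> ideal_gen ?H"
  proof cases
    case 1
    then show ?thesis by (auto intro: ideal.span_base)
  next
    case 2
    show ?thesis
      unfolding 2(2) taylor_def
      by (rule emps.eval_ideal_gen [OF 2(1) ideal.subspace_span])
        (auto simp: taylor_def intro!: ideal.span_base)
  qed
next
  fix h assume "h \<in> insert (mps_var k) (range (\<lambda>j. taylor x (quad y j)))"
  then show "h \<in> ideal_gen (insert (mps_var k) (taylor x ` ideal_gen (range (quad y))))"
    by (auto intro!: ideal.span_base intro: ideal.span_base)
qed

lemma taylor_quad:
  "taylor x (quad y k) = qform (mps_const (par_p y)) (mps_const (par_q y)) (mps_const (par_s y))
     (\<lambda>i. mps_const (x $ i) + mps_var i) k"
  by (simp add: taylor_def quad_def emps.eval_qform emps.eval_simps)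

text \<open>The formal coordinates are moved by the group instead of the ideal: with
  \<open>X\<close> as below, the expansion of a quadric at \<open>act c b a y\<close> is a scalar
  times a formal quadric at \<open>y\<close> with shifted index. The chart is \<open>2 + a\<close>,
  where the coordinate is a nonzero multiple of \<open>y $ 2\<close>.\<close>

lemma ordinary_double_point_V8:
  assumes "z \<in> H8_orbit (proj_pt y)" shows "ordinary_double_point (V8 (proj_pt y)) z"
proof -
  obtain t c b a where t: "t \<noteq> 0" "z = proj_pt (t *s act c b a y)"
    using assms by (auto simp: H8_orbit_eq in_orbit_def)
  define x where "x = act c b a y"
  have z: "z = proj_pt x" using t by (simp add: proj_pt_smult x_def)
  have orb: "in_orbit x" unfolding x_def by (rule in_orbit_act_y)
  then have x: "x \<noteq> 0" "zero x" using in_orbit_nonzero in_orbit_zero by auto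
  define e :: "8 \<Rightarrow> 8 mps" where "e i = mps_const (chi (c + b * i))" for i
  define X :: "8 \<Rightarrow> 8 mps" where "X j = mps_const (1 / chi (c + b * (j + a))) * mps_var (j + a)" for j
  have eX: "e i * X (i - a) = mps_var i" for i
    by (simp add: e_def X_def flip: mult.assoc emps.cmult)
  have X: "formal_coordinates X"
    unfolding formal_coordinates_iff
  proof (intro conjI allI impI)
    show "mps_coeff (X i) 0 = 0" for i
      using single_neq_0 [of "i + a"] by (simp add: X_def mps_coeff_mult_0 eq_commute [of 0])
    fix w assume w: "\<forall>i. linear_part (X i) w = 0"
    have "w $ i = 0" for i
      using w [rule_format, of "i - a"] by (simp add: X_def)
    then show "w = 0" by (simp add: vec_eq_iff)
  qed
  have E: "e i * e j = mps_const (chi (c + c - b * (k + k)))" if "i + j = - (k + k)" for i j k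
  proof -
    have "c + b * i + (c + b * j) = c + c + b * (i + j)"
      by (simp add: algebra_simps)
    then have "chi (c + b * i) * chi (c + b * j) = chi (c + c - b * (k + k))"
      unfolding chi_add [symmetric] by (simp add: that)
    then show ?thesis by (simp add: e_def flip: emps.cmult)
  qed
  have quad: "taylor x (quad y k) = mps_const (chi (c + c - b * (k + k))) * formal_quad X (k + a)" for k
  proof -
    have "mps_const (x $ i) + mps_var i = e i * (mps_const (y $ (i - a)) + X (i - a))" for i
      unfolding distrib_left eX by (simp add: e_def x_def emps.cmult)
    then have "taylor x (quad y k) = qform (mps_const (par_p y)) (mps_const (par_q y)) (mps_const (par_s y))
      (\<lambda>i. e i * ((\<lambda>i. mps_const (y $ i) + X i) (i - a))) k"
      by (simp add: taylor_quad)
    also have "\<dots> = mps_const (chi (c + c - b * (k + k))) * formal_quad X (k + a)"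
      unfolding formal_quad_def by (rule qform_act [OF E])
    finally show ?thesis .
  qed
  have "formal_ideal (V8 (proj_pt y)) x (2 + a) = ideal_gen (insert (X 2) (range (formal_quad X)))"
    unfolding formal_ideal_V8
  proof (rule ideal_gen_eqI)
    let ?H = "insert (X 2) (range (formal_quad X))" and ?G = "insert (mps_var (2 + a)) (range (\<lambda>j. taylor x (quad y j)))"
    have "mps_var (2 + a) = e (2 + a) * X 2"
      using eX [of "2 + a"] by simp
    moreover have "X 2 = mps_const (1 / chi (c + b * (2 + a))) * mps_var (2 + a)"
      by (simp add: X_def)
    ultimately have v: "mps_var (2 + a) \<in> ideal_gen ?H" "X 2 \<in> ideal_gen ?G"
      by (metis ideal.span_base ideal.span_scale insertI1)+
    have "taylor x (quad y k) \<in> ideal_gen ?H" for k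
      unfolding quad by (intro ideal.span_scale ideal.span_base) auto
    with v show "g \<in> ideal_gen ?H" if "g \<in> ?G" for g
      using that by blast
    have "formal_quad X k \<in> ideal_gen ?G" for k
    proof (rule in_ideal_mps_const)
      have "mps_const (chi (c + c - b * (k - a + (k - a)))) * formal_quad X k = taylor x (quad y (k - a))"
        by (simp add: quad)
      also have "\<dots> \<in> ideal_gen ?G"
        by (intro ideal.span_base) auto
      finally show "mps_const (chi (c + c - b * (k - a + (k - a)))) * formal_quad X k \<in> ideal_gen ?G" .
    qed simp
    with v show "h \<in> ideal_gen ?G" if "h \<in> ?H" for h
      using that by auto
  qed
  with double_point [OF X] obtain \<phi> A where "formal_coordinates \<phi>" "card A = 4"
    "formal_ideal (V8 (proj_pt y)) x (2 + a) = ideal_gen (insert (\<Sum>i\<in>A. (\<phi> i)\<^sup>2) (\<phi> ` (- A)))"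
    by metis
  moreover have "local_dim (V8 (proj_pt y)) z = 3"
    unfolding z using x by (intro local_dim_V8) (auto simp: zero_def)
  moreover have "x $ (2 + a) \<noteq> 0"
    using y123 by (simp add: x_def)
  moreover have "z \<in> proj_zeros (V8 (proj_pt y))"
    unfolding z proj_zeros_V8 using x by simp
  ultimately show ?thesis
    unfolding ordinary_double_point_def
    using mem_proj_pt [of x] z by (auto simp: numeral_eq_enat one_enat_def intro!: bexI [of _ x] exI [of _ "2 + a"] exI [of _ \<phi>] exI [of _ A])
qed

end

section \<open>The theorem\<close>

lemma homogeneous_product:
  "\<exists>d. homogeneous d p \<Longrightarrow> \<exists>e. homogeneous e q \<Longrightarrow> \<exists>d. homogeneous d (p * q)"
  for p q :: "('v::finite, 'a::comm_semiring_1) mpoly"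
  using homogeneous_mult by blast

theorem theorem6p5:
  shows "for_general iota_minus (\<lambda>y.
    complete_intersection [2, 2, 2, 2] (V8 y) \<and>
    singular_points (V8 y) = H8_orbit y \<and>
    card (H8_orbit y) = 64 \<and>
    (\<forall>z\<in>H8_orbit y. ordinary_double_point (V8 y) z))"
proof -
  \<comment> \<open>At \<open>y\<close>, the forms \<open>a ^ 8\<close>, \<open>b ^ 8\<close> and
    \<open>c\<close> take the values \<open>al ^ 4\<close>, \<open>be ^ 4\<close> and
    \<open>ga ^ 4\<close>; the 16 is the fourth power of the 2 in \<open>ga\<close>.\<close>
  define a b c where "a = (mvar 1 + mvar 3 :: (8, complex) mpoly)" and "b = (mvar 1 - mvar 3 :: (8, complex) mpoly)"
    and "c = (cst 16 * mvar 2 ^ 8 :: (8, complex) mpoly)"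
  define q where "q = mvar 1 * (mvar 2 * (mvar 3 * (a * (b * ((a ^ 8 - b ^ 8) * ((a ^ 8 - c) * ((b ^ 8 + c) * (a ^ 8 - (b ^ 8 + c)))))))))"
  have a: "homogeneous 1 a" and b: "homogeneous 1 b"
    unfolding a_def b_def by (intro homogeneous_add homogeneous_diff homogeneous_mvar)+
  have 8: "homogeneous 8 (a ^ 8)" "homogeneous 8 (b ^ 8)" "homogeneous 8 c"
    using homogeneous_power [OF a, of 8] homogeneous_power [OF b, of 8]
      homogeneous_cst_mult [OF homogeneous_power [OF homogeneous_mvar [of 2], of 8], of 16] by (simp_all add: c_def)
  have hom: "\<exists>d. homogeneous d q"
    unfolding q_def using a b 8
    by (intro homogeneous_product; blast intro: homogeneous_mvar homogeneous_add homogeneous_diff)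
  have q: "peval q x = x $ 1 * (x $ 2 * (x $ 3 * ((x $ 1 + x $ 3) * ((x $ 1 - x $ 3) * (((x $ 1 + x $ 3) ^ 8 - (x $ 1 - x $ 3) ^ 8)
    * (((x $ 1 + x $ 3) ^ 8 - 16 * x $ 2 ^ 8) * (((x $ 1 - x $ 3) ^ 8 + 16 * x $ 2 ^ 8)
    * ((x $ 1 + x $ 3) ^ 8 - ((x $ 1 - x $ 3) ^ 8 + 16 * x $ 2 ^ 8)))))))))" for x
    by (simp add: q_def a_def b_def c_def)
  \<comment> \<open>The entries 3, 1, 1 give \<open>y1 + y3 = 4\<close> and
    \<open>y1 - y3 = 2\<close>, so no factor of \<open>q\<close> vanishes and the open set is
    nonempty.\<close>
  define y0 :: "complex ^ 8" where "y0 = (\<chi> i. if i = 1 then 3 else if i = 2 then 1 else if i = 3 then 1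
    else if i = 5 then - 1 else if i = 6 then - 1 else if i = 7 then - 3 else 0)"
  have "iota y0 = - y0"
    by (simp add: iota_def vec_eq_iff all_8 y0_def minus_numerals_8)
  moreover have "peval q y0 \<noteq> 0"
    by (simp add: q y0_def)
  moreover have "y0 \<noteq> 0"
    by (auto simp: vec_eq_iff all_8 y0_def)
  ultimately have "proj_pt y0 \<in> proj_space iota_minus - proj_zeros {q}"
    using mem_proj_pt [of y0] by (auto simp: proj_space_def iota_minus_def proj_zeros_def vanishes_at_def)
  moreover have "complete_intersection [2, 2, 2, 2] (V8 z) \<and> singular_points (V8 z) = H8_orbit z \<and>
    card (H8_orbit z) = 64 \<and> (\<forall>w\<in>H8_orbit z. ordinary_double_point (V8 z) w)"
    if "z \<in> proj_space iota_minus - proj_zeros {q}" for z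
  proof -
    obtain w where w: "w \<in> iota_minus" "w \<noteq> 0" "z = proj_pt w"
      using \<open>z \<in> _\<close> by (auto simp: proj_space_def)
    \<comment> \<open>Nonvanishing at the projective point provides some representative; every
      notion in the claim depends on the line only, so \<open>y\<close> may replace
      \<open>w\<close>.\<close>
    then obtain y where y: "y \<in> z" "peval q y \<noteq> 0"
      using \<open>z \<in> _\<close> by (auto simp: proj_zeros_def proj_space_def vanishes_at_def)
    then obtain t where t: "t \<noteq> 0" "y = t *s w"
      using w(3) by (auto simp: proj_pt_def)
    have z: "z = proj_pt y"
      using t w(3) by (simp add: proj_pt_smult)
    interpret V8_general y "(y $ 1 + y $ 3)\<^sup>2" "- (y $ 1 - y $ 3)\<^sup>2" "2 * (y $ 2)\<^sup>2"
    proof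
      show "y \<in> iota_minus"
        using w(1) by (simp add: t iota_minus_def iota_def vec_eq_iff)
    qed (use y(2) in \<open>auto simp: q power_mult_distrib simp flip: power_mult\<close>)
    show ?thesis
      unfolding z using complete_intersection_V8 singular_points_V8 card_orbit ordinary_double_point_V8 by blast
  qed
  ultimately show ?thesis
    unfolding for_general_def using hom by (intro exI [of _ "{q}"]) blast
qed

end
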